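(* Under the Stationarity Assumption on $R$ (see context), the Markov process $X$ (the cell process) is ergodic, i.e. for every initial distribution $\nu$ on $(0,\infty)$, $$d_{\mathrm{TV}}(\nu P_t,\pi)\to0\quad\text{as }t\to\infty .$$ Moreover, if $\mathcal M$ is a tight family of probability distributions on $(0,\infty)$, the convergence is uniform on $\mathcal M$, i.e. $\sup_{\nu\in\mathcal M}d_{\mathrm{TV}}(\nu P_t,\pi)\to0$ as $t\to\infty$.
   Context: Let $R:[0,\infty)\to[0,\infty)$ be a Borel function with $\int_0^kR(x)\,dx<\infty$ for all $k>0$. Stationarity Assumption. Let $\mathcal D$ be the set of c\`adl\`ag nondecreasing functions $F:[0,\infty]\to[0,1]$ (with $F(+\infty)=\lim_{x\to\infty}F(x)$). Let $\mathfrak R$ be the set of maps $t\mapsto F_t$ from $[0,\infty)$ to $\mathcal D$, Borel measurable for the $L^1_{\mathrm{loc}}([0,\infty))$ topology on $\mathcal D$, such that $dF_t\ll\mathrm{Leb}$, $F_t(+\infty)=1$, $F_t(0)=0$ for all $t\ge 0$, $\{F_t\}_{t\ge0}$ is tight, and for all $t\ge0,x>0$ $$F_t(x)=F_0(e^{-t}x)+\int_0^t(e^{s-t}x)^2\left[\int_{e^{s-t}x}^\infty\frac{R(z)}{z}\,dF_s(z)\right]ds .$$ It is assumed that there is a distribution function $F$ such that the constant family $F_t=F$ belongs to $\mathfrak R$; $\pi=dF$ is the corresponding probability measure on $(0,\infty)$. Cell process. For $z>0,t\ge0$ put $S_z(t)=\exp\left(-\int_z^{ze^t}R(u)\,du\right)$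 and let $S_z^{-1}(u)=\inf\{t\ge0:S_z(t)\le u\}\in[0,\infty]$. Let $U_1,U_2,\dots$ be i.i.d. uniform on $(0,1)$. For a starting point $x>0$, set $\tau_0=0$, $Y_0=x$ and for $k\ge1$: $J_k=\sqrt{U_{2k}}$; $\tau_k=\infty$ if $\tau_{k-1}=\infty$, otherwise $\tau_k=\tau_{k-1}+S_{Y_{k-1}}^{-1}(U_{2k-1})$; $Y_k=xe^{\tau_k}\prod_{j=1}^kJ_j$ (when $\tau_k<\infty$). One assumes without loss $\prod_{k}J_k=0$ surely. Set $X_t=xe^t\prod_{j=1}^kJ_j$ if $\tau_k\le t<\tau_{k+1}$, and $X_t=0$ if $t\ge\zeta:=\lim_k\tau_k$. If the starting point is $0$, set $X_t=0$ for all $t$. $\mathbb P_x$ denotes the law under which $X$ starts at $x$, and $P_tf(x)=\mathbb E_x[f(X_t)]$ for bounded Borel $f$; $\nu P_t$ is the law of $X_t$ when $X_0\sim\nu$. $d_{\mathrm{TV}}$ is total variation distance ($\pi$ being viewed as a measure on $[0,\infty)$). Tightness of $\mathcal M$ on $(0,\infty)$ means that for every $\epsilon>0$ there is a compact $K\subset(0,\infty)$ with $\nu(K^c)<\epsilon$ for all $\nu\in\mathcal M$. *)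

theory Defs
  imports "HOL-Probability.Probability"
begin

section \<open>Distribution functions on the extended half-line\<close>

text \<open>The domain \<open>[0,\<infinity>]\<close> is the type \<^typ>\<open>ennreal\<close>.\<close>

definition dist_funs :: "(ennreal \<Rightarrow> real) set" where
  "dist_funs = {F. mono F \<and> (\<forall>x. F x \<in> {0..1}) \<and>
     (\<forall>x. continuous (at_right x) F) \<and>
     (\<forall>x. \<exists>l. (F \<longlongrightarrow> l) (at_left x)) \<and>
     (F \<longlongrightarrow> F \<top>) (at_left \<top>)}"

text \<open>The Stieltjes measure \<open>dF\<close>, as a Borel measure on the real line carried by \<open>[0,\<infinity>)\<close>.\<close>

definition stieltjes :: "(ennreal \<Rightarrow> real) \<Rightarrow> real measure" where
  "stieltjes F = interval_measure (\<lambda>x. if x < 0 then 0 else F (ennreal x))"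

text \<open>The topology on \<^const>\<open>dist_funs\<close> whose subbase consists of the balls of the seminorms
  \<open>F \<mapsto> \<integral>\<^sub>0\<^sup>k \<bar>F(x)\<bar> dx\<close>.\<close>

definition L1loc_topology :: "(ennreal \<Rightarrow> real) topology" where
  "L1loc_topology = topology_generated_by
     {{G \<in> dist_funs. (LBINT x:{0..k}. \<bar>F (ennreal x) - G (ennreal x)\<bar>) < \<epsilon>} | F k \<epsilon>.
        F \<in> dist_funs \<and> 0 < k \<and> 0 < \<epsilon>}"

definition L1loc_borel :: "(ennreal \<Rightarrow> real) measure" where
  "L1loc_borel = sigma dist_funs {V. openin L1loc_topology V}"

definition tight_on :: "real set \<Rightarrow> real measure set \<Rightarrow> bool" where
  "tight_on S \<M> \<longleftrightarrow>
     (\<forall>\<epsilon>>0. \<exists>K. compact K \<and> K \<subseteq> S \<and> (\<forall>\<nu>\<in>\<M>. measure \<nu> (space \<nu> - K) < \<epsilon>))"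


section \<open>The evolution equation and its solutions\<close>

text \<open>A map on \<open>[0,\<infinity>)\<close> is represented by a function on the reals of which only the values at
  \<open>t \<ge> 0\<close> are constrained. The inner integral may a priori be infinite, so the identity is stated
  in \<^typ>\<open>ennreal\<close>.\<close>

definition evolution_family :: "(real \<Rightarrow> real) \<Rightarrow> (real \<Rightarrow> ennreal \<Rightarrow> real) set" where
  "evolution_family R = {\<F>.
     \<F> \<in> measurable (restrict_space borel {0..}) L1loc_borel \<and>
     (\<forall>t\<ge>0. absolutely_continuous lborel (stieltjes (\<F> t)) \<and> \<F> t \<top> = 1 \<and> \<F> t 0 = 0) \<and>
     tight_on {0..} ((\<lambda>t. stieltjes (\<F> t)) ` {0..}) \<and>
     (\<forall>t\<ge>0. \<forall>x>0. ennreal (\<F> t (ennreal x)) =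
        ennreal (\<F> 0 (ennreal (exp (- t) * x))) +
        (\<integral>\<^sup>+s\<in>{0..t}. ennreal ((exp (s - t) * x)\<^sup>2) *
           (\<integral>\<^sup>+z\<in>{exp (s - t) * x<..}. ennreal (R z / z) \<partial>stieltjes (\<F> s)) \<partial>lborel))}"


section \<open>The cell process\<close>

text \<open>Everything is first defined for one realization \<open>u\<close> of the sequence \<open>U\<^sub>1, U\<^sub>2, \<dots>\<close>;
  the entry \<open>u 0\<close> is not used.\<close>

definition survival :: "(real \<Rightarrow> real) \<Rightarrow> real \<Rightarrow> real \<Rightarrow> real" where
  "survival R z t = exp (- (LBINT y:{z..z * exp t}. R y))"

definition survival_inv :: "(real \<Rightarrow> real) \<Rightarrow> real \<Rightarrow> real \<Rightarrow> ennreal" where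
  "survival_inv R z v = Inf (ennreal ` {t. 0 \<le> t \<and> survival R z t \<le> v})"

definition jump_factor :: "(nat \<Rightarrow> real) \<Rightarrow> nat \<Rightarrow> real" where
  "jump_factor u k = sqrt (u (2 * k))"

text \<open>In the recursive clause, the first argument of \<^const>\<open>survival_inv\<close> is the position
  \<open>Y\<^sub>k = x e\<^bsup>\<tau>\<^sub>k\<^esup> J\<^sub>1 \<cdots> J\<^sub>k\<close> just after the \<open>k\<close>-th jump.\<close>

primrec jump_time :: "(real \<Rightarrow> real) \<Rightarrow> real \<Rightarrow> (nat \<Rightarrow> real) \<Rightarrow> nat \<Rightarrow> ennreal" where
  "jump_time R x u 0 = 0"
| "jump_time R x u (Suc k) =
     (if jump_time R x u k = \<infinity> then \<infinity>
      else jump_time R x u k +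
        survival_inv R (x * exp (enn2real (jump_time R x u k)) * (\<Prod>j=1..k. jump_factor u j))
          (u (2 * k + 1)))"

definition lifetime :: "(real \<Rightarrow> real) \<Rightarrow> real \<Rightarrow> (nat \<Rightarrow> real) \<Rightarrow> ennreal" where
  "lifetime R x u = lim (\<lambda>k. jump_time R x u k)"

text \<open>The value for \<open>x < 0\<close> is a dummy. For \<open>x > 0\<close> and \<open>0 \<le> t < \<zeta>\<close> the index \<open>k\<close> exists and is
  unique, the jump times being nondecreasing.\<close>

definition cell_process :: "(real \<Rightarrow> real) \<Rightarrow> real \<Rightarrow> (nat \<Rightarrow> real) \<Rightarrow> real \<Rightarrow> real" where
  "cell_process R x u t =
     (if x \<le> 0 \<or> lifetime R x u \<le> ennreal t then 0
      else let k = (THE k. jump_time R x u k \<le> ennreal t \<and> ennreal t < jump_time R x u (Suc k))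
           in x * exp t * (\<Prod>j=1..k. jump_factor u j))"

text \<open>\<open>\<nu>P\<^sub>t\<close>: the starting point has law \<open>\<nu>\<close> and is independent of the driving sequence \<open>U\<close>, which
  lives on the probability space \<open>M\<close>.\<close>

definition cell_law ::
  "(real \<Rightarrow> real) \<Rightarrow> 'a measure \<Rightarrow> (nat \<Rightarrow> 'a \<Rightarrow> real) \<Rightarrow> real measure \<Rightarrow> real \<Rightarrow> real measure" where
  "cell_law R M U \<nu> t =
     distr (\<nu> \<Otimes>\<^sub>M M) borel (\<lambda>(x, \<omega>). cell_process R x (\<lambda>k. U k \<omega>) t)"


section \<open>Probability distributions and total variation\<close>

definition pos_distribution :: "real measure \<Rightarrow> bool" where
  "pos_distribution \<nu> \<longleftrightarrow> prob_space \<nu> \<and> sets \<nu> = sets borel \<and> emeasure \<nu> {0<..} = 1"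

definition tv_dist :: "'b measure \<Rightarrow> 'b measure \<Rightarrow> real" where
  "tv_dist \<mu> \<nu> = (SUP A\<in>sets \<mu>. \<bar>measure \<mu> A - measure \<nu> A\<bar>)"

end

theory Submission
  imports Defs
begin

text \<open>Let \<open>\<Lambda>\<close> be the primitive of \<open>R\<close> vanishing at \<open>0\<close> and \<open>L = exp (- \<Lambda>)\<close>. The stationary equation forces
  \<open>dF = C y L(y) dy\<close>, because \<open>g(y) = \<integral>\<^sub>y\<^sup>\<infinity> R(z)/z dF(z)\<close> satisfies \<open>dF = y g(y) dy\<close>, hence \<open>dg = - R g dy\<close>.
  Started from this law, the process jumps at constant rate 2, so it is conservative and the law is invariant.
  On a compact set \<open>K\<close> the one-jump part of the kernel has a density bounded below with respect
  to the equilibrium, and after the first jump the law of the process is dominated by a multiple of the equilibrium. Functions with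
  the same equilibrium mean can therefore be reduced, at every step of length \<open>T\<close>, by a common multiple of
  the indicator of \<open>K\<close>; this shrinks their mean geometrically up to the mass outside \<open>K\<close>.\<close>

section \<open>The renewal equation\<close>

text \<open>The lower bound on the kernel is available only for starting points in \<open>K\<close>,
  so there is no pointwise contraction. Contraction is therefore measured in the mean with respect
  to the equilibrium, where the points outside \<open>K\<close> cost no more than their mass; the
  domination after the first jump then turns a small mean into small values on a compact interval.
  All functions are \<open>ennreal\<close>-valued and only upper bounds are transported; lower
  bounds come from complements. Conservation of mass is what turns one-sided bounds into equalities,
  both in the semigroup law and in the identification of \<open>Q\<close> with the law of the
  process.

  The rate 2 comes from the change of variables \<open>x = z * exp (- s)\<close>, where
  \<open>z\<close> is the position before the jump:
  \<open>x dx = z\<^sup>2 * exp (- 2 * s) ds\<close>, and \<open>z\<^sup>2\<close> cancels the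
  denominator of the jump density \<open>2 * w / z\<^sup>2\<close>. For a fixed starting point the
  jump rate depends on the state, so non-explosion is reached through the stationary law: first
  almost everywhere, then everywhere because a jump has a density.\<close>

lemma measurable_uncurried:
  assumes "case_prod \<phi> \<in> borel_measurable (borel \<Otimes>\<^sub>M borel)" "g \<in> borel_measurable N" "h \<in> borel_measurable N"
  shows "(\<lambda>y. \<phi> (g y) (h y)) \<in> borel_measurable N"
  using measurable_compose[OF measurable_Pair[OF assms(2,3)] assms(1)] by simp

text \<open>The expectation of \<open>h\<close> at the position \<open>z \<surd>U\<close> reached by a jump from \<open>z\<close>.\<close>

definition jump_mean :: "real \<Rightarrow> (real \<Rightarrow> ennreal) \<Rightarrow> ennreal" where
  "jump_mean z h = (\<integral>\<^sup>+w. ennreal (2 * w / z\<^sup>2) * h w * indicator {0<..<z} w \<partial>lborel)"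

lemma measurable_jump_mean [measurable (raw)]:
  assumes [measurable]: "g \<in> borel_measurable N" "case_prod h \<in> borel_measurable (N \<Otimes>\<^sub>M borel)"
  shows "(\<lambda>y. jump_mean (g y) (h y)) \<in> borel_measurable N"
proof -
  have [measurable]: "Measurable.pred (N \<Otimes>\<^sub>M borel) (\<lambda>p. snd p \<in> {0<..<g (fst p)})"
    by simp
  show ?thesis
    unfolding jump_mean_def indicator_def by measurable
qed

lemma jump_mean_mono: "(\<And>w. 0 < w \<Longrightarrow> h w \<le> h' w) \<Longrightarrow> jump_mean z h \<le> jump_mean z h'"
  unfolding jump_mean_def by (intro nn_integral_mono) (auto simp: indicator_def intro!: mult_left_mono)

text \<open>The substitution \<open>w = z * sqrt b\<close> carries the uniform law of
  \<open>b\<close> to the density \<open>2 * w / z\<^sup>2\<close> on \<open>(0, z)\<close>. This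
  ties \<open>jump_mean\<close> to the jump factors of the process.\<close>

lemma jump_mean_subst:
  assumes [measurable]: "h \<in> borel_measurable borel" and z: "0 < z"
  shows "(\<integral>\<^sup>+b. h (z * sqrt b) * indicator {0<..<1} b \<partial>lborel) = jump_mean z h"
proof -
  \<comment> \<open>The endpoints are written as images of \<open>0\<close> and \<open>z\<close>
    under \<open>w\<^sup>2 / z\<^sup>2\<close>, the form the substitution rule asks for; closing the
    interval changes a null set.\<close>
  have "(\<integral>\<^sup>+b. h (z * sqrt b) * indicator {0<..<1} b \<partial>lborel) =
      (\<integral>\<^sup>+b. h (z * sqrt b) * indicator {0\<^sup>2/z\<^sup>2..z\<^sup>2/z\<^sup>2} b \<partial>lborel)"
    using z by (intro nn_integral_cong_AE eventually_mono[OF AE_conjI[OF AE_lborel_singleton[of 0] AE_lborel_singleton[of 1]]])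
      (auto simp: indicator_def)
  also have "\<dots> = (\<integral>\<^sup>+w. h (z * sqrt (w\<^sup>2/z\<^sup>2)) * ennreal (2*w/z\<^sup>2) * indicator {0..z} w \<partial>lborel)"
  proof (rule nn_integral_substitution_aux)
    show "((\<lambda>w. w\<^sup>2 / z\<^sup>2) has_real_derivative 2 * w / z\<^sup>2) (at w)" for w
      using DERIV_cdivide[OF DERIV_power[OF DERIV_ident, of 2], of "z\<^sup>2"] by simp
  qed (use z in \<open>auto intro!: continuous_intros\<close>)
  also have "\<dots> = jump_mean z h"
    unfolding jump_mean_def using z
    by (intro nn_integral_cong_AE eventually_mono[OF AE_conjI[OF AE_lborel_singleton[of 0] AE_lborel_singleton[of z]]])
      (auto simp: indicator_def real_sqrt_divide mult.commute)
  finally show ?thesis .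
qed

lemma jump_mean_one:
  assumes z: "0 < z"
  shows "jump_mean z (\<lambda>_. 1) = 1"
  using jump_mean_subst[of "\<lambda>_. 1" z] z by simp

text \<open>\<open>L\<close> stands for \<open>exp (- \<Lambda>)\<close> with \<open>\<Lambda>\<close> the primitive of the jump rate, so that
  \<open>S\<^sub>z(t) = L (z e\<^sup>t) / L z\<close>; the equilibrium density is \<open>C x L x\<close>.\<close>

locale growth_jump =
  fixes L :: "real \<Rightarrow> real" and C :: real
  assumes L_cont: "continuous_on UNIV L"
    and L_antimono: "\<And>x y. x \<le> y \<Longrightarrow> L y \<le> L x"
    and L_0: "\<And>x. x \<le> 0 \<Longrightarrow> L x = 1"
    and L_pos: "\<And>x. 0 < L x"
    and L_lim: "(L \<longlongrightarrow> 0) at_top"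
    and C_pos: "0 < C"
    and total: "(\<integral>\<^sup>+x. ennreal (C * x * L x) * indicator {0<..} x \<partial>lborel) = 1"
begin

section \<open>The generalized inverse of \<open>L\<close>\<close>

lemma L_le1: "L x \<le> 1"
  using L_antimono[of 0 x] L_antimono[of x 0] L_0[of 0] L_0[of x] by (cases "x \<le> 0") auto

lemma L_measurable [measurable]: "L \<in> borel_measurable borel"
  using L_cont by (rule borel_measurable_continuous_onI)

text \<open>The position just before the first jump, started at \<open>x\<close>, is \<open>q (U\<^sub>1 L x)\<close>.\<close>

definition q :: "real \<Rightarrow> real" where
  "q v = (if 0 < v then Inf {z. 0 \<le> z \<and> L z \<le> v} else 0)"

text \<open>The infimum is attained: the set is closed because \<open>L\<close> is continuous and
  non-empty because \<open>L\<close> tends to 0. As \<open>L\<close> may be constant on intervals,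
  \<open>q\<close> is handled through this order equivalence instead of inverse identities.\<close>

lemma q_nonneg: "0 \<le> q v" and q_le_iff: "0 < v \<Longrightarrow> 0 \<le> z \<Longrightarrow> q v \<le> z \<longleftrightarrow> L z \<le> v"
proof -
  have *: "0 \<le> q v \<and> (0 \<le> z \<longrightarrow> (q v \<le> z \<longleftrightarrow> L z \<le> v))" if v: "0 < v" for z
  proof -
    let ?S = "{z. 0 \<le> z \<and> L z \<le> v}"
    have "\<forall>\<^sub>F z in at_top. L z < v" using L_lim v by (auto simp: order_tendsto_iff)
    then have "\<forall>\<^sub>F z in at_top. L z < v \<and> 0 \<le> z" using eventually_ge_at_top by eventually_elim auto
    then obtain z0 where "L z0 < v" "0 \<le> z0" using eventually_happens'[OF trivial_limit_at_top_linorder] by blast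
    then have ne: "?S \<noteq> {}" by (auto intro!: exI[of _ z0])
    have bdd: "bdd_below ?S" by (auto intro!: bdd_belowI[of _ 0])
    have "closed ?S"
      by (intro closed_Collect_conj closed_Collect_le continuous_intros L_cont)
    then have "Inf ?S \<in> ?S" by (rule closed_contains_Inf[OF ne bdd])
    moreover have "Inf ?S \<le> z" if "z \<in> ?S" for z using that bdd by (rule cInf_lower)
    ultimately show ?thesis using v L_antimono[of "Inf ?S" z] by (auto simp: q_def)
  qed
  show "0 \<le> q v" using * by (cases "0 < v") (auto simp: q_def)
  show "0 < v \<Longrightarrow> 0 \<le> z \<Longrightarrow> q v \<le> z \<longleftrightarrow> L z \<le> v" using * by blast
qed

lemma q_gt_iff: "0 < v \<Longrightarrow> 0 \<le> z \<Longrightarrow> z < q v \<longleftrightarrow> v < L z"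
  using q_le_iff[of v z] by auto

lemma q_measurable [measurable]: "q \<in> borel_measurable borel"
proof (rule borel_measurableI_le)
  fix y :: real
  show "{x \<in> space borel. q x \<le> y} \<in> sets borel"
  proof (cases "0 \<le> y")
    case True
    then have "{x. q x \<le> y} = {x. x \<le> 0 \<or> L y \<le> x}"
      using q_le_iff[of _ y] by (force simp: q_def)
    then show ?thesis by simp
  next
    case False
    then have "{x. q x \<le> y} = {}" using q_nonneg by (auto simp: not_le intro: less_le_trans)
    then show ?thesis by simp
  qed
qed

section \<open>The renewal operator and its minimal solution\<close>

definition flow :: "(real \<Rightarrow> ennreal) \<Rightarrow> real \<Rightarrow> real \<Rightarrow> ennreal" where
  "flow f t x = ennreal (L (x * exp t) / L x) * f (x * exp t)"

text \<open>The right-hand side of the renewal equation at the first jump: \<^term>\<open>flow\<close> is the contribution of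
  \<open>{t < \<tau>\<^sub>1}\<close>, and \<^term>\<open>jump_term \<phi> t x\<close> the expectation of \<open>\<phi> (t - \<tau>\<^sub>1) Y\<^sub>1\<close> on \<open>{\<tau>\<^sub>1 \<le> t}\<close>.\<close>

definition jump_term :: "(real \<Rightarrow> real \<Rightarrow> ennreal) \<Rightarrow> real \<Rightarrow> real \<Rightarrow> ennreal" where
  "jump_term \<phi> t x = ennreal (1 / L x) * (\<integral>\<^sup>+v. indicator {0<..<L x} v * indicator {..x * exp t} (q v) *
     jump_mean (q v) (\<phi> (t - ln (q v / x))) \<partial>lborel)"

lemma flow_measurable [measurable (raw)]:
  assumes [measurable]: "f \<in> borel_measurable borel" "g \<in> borel_measurable N" "h \<in> borel_measurable N"
  shows "(\<lambda>y. flow f (g y) (h y)) \<in> borel_measurable N"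
  unfolding flow_def by measurable

lemma jump_term_measurable_aux:
  assumes [measurable]: "case_prod \<phi> \<in> borel_measurable (borel \<Otimes>\<^sub>M borel)"
  shows "case_prod (jump_term \<phi>) \<in> borel_measurable (borel \<Otimes>\<^sub>M borel)"
proof -
  have [measurable]: "Measurable.pred ((borel \<Otimes>\<^sub>M borel) \<Otimes>\<^sub>M borel) (\<lambda>p::(real\<times>real)\<times>real. snd p \<in> {0<..<L (snd (fst p))})"
    by simp
  have [measurable]: "Measurable.pred ((borel \<Otimes>\<^sub>M borel) \<Otimes>\<^sub>M borel) (\<lambda>p::(real\<times>real)\<times>real. q (snd p) \<in> {..snd (fst p) * exp (fst (fst p))})"
    by simp
  note [measurable (raw)] = measurable_uncurried[OF assms]
  have [measurable]: "(\<lambda>p::(real\<times>real)\<times>real. jump_mean (q (snd p)) (\<phi> (fst (fst p) - ln (q (snd p) / snd (fst p))))) \<in> borel_measurable ((borel \<Otimes>\<^sub>M borel) \<Otimes>\<^sub>M borel)"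
    by measurable
  show ?thesis
    unfolding case_prod_beta jump_term_def indicator_def by measurable
qed

lemma jump_term_measurable [measurable (raw)]:
  assumes "case_prod \<phi> \<in> borel_measurable (borel \<Otimes>\<^sub>M borel)" "g \<in> borel_measurable N" "h \<in> borel_measurable N"
  shows "(\<lambda>y. jump_term \<phi> (g y) (h y)) \<in> borel_measurable N"
  using measurable_uncurried[OF jump_term_measurable_aux[OF assms(1)] assms(2,3)] .

text \<open>\<open>W n f t x\<close> is the expectation of \<open>f X\<^sub>t\<close> on \<open>{t < \<tau>\<^sub>n}\<close>, whence \<open>Q f t x = P\<^sub>t f x\<close> for \<open>f\<close> killed at explosion.\<close>

primrec W :: "nat \<Rightarrow> (real \<Rightarrow> ennreal) \<Rightarrow> real \<Rightarrow> real \<Rightarrow> ennreal" where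
  "W 0 f = (\<lambda>t x. 0)"
| "W (Suc n) f = (\<lambda>t x. flow f t x + jump_term (W n f) t x)"

definition Q :: "(real \<Rightarrow> ennreal) \<Rightarrow> real \<Rightarrow> real \<Rightarrow> ennreal" where
  "Q f t x = (SUP n. W n f t x)"

lemma W_measurable_aux:
  assumes [measurable]: "f \<in> borel_measurable borel"
  shows "case_prod (W n f) \<in> borel_measurable (borel \<Otimes>\<^sub>M borel)"
proof (induction n)
  case (Suc n)
  note [measurable] = Suc
  show ?case by (simp add: case_prod_beta)
qed simp

lemma Q_measurable_aux:
  assumes [measurable]: "f \<in> borel_measurable borel"
  shows "case_prod (Q f) \<in> borel_measurable (borel \<Otimes>\<^sub>M borel)"
proof -
  note [measurable] = W_measurable_aux[OF assms, unfolded case_prod_beta]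
  show ?thesis unfolding case_prod_beta Q_def by measurable
qed

lemma W_measurable [measurable (raw)]:
  assumes "f \<in> borel_measurable borel" "g \<in> borel_measurable N" "h \<in> borel_measurable N"
  shows "(\<lambda>y. W n f (g y) (h y)) \<in> borel_measurable N"
  using measurable_uncurried[OF W_measurable_aux[OF assms(1)] assms(2,3)] .

lemma Q_measurable [measurable (raw)]:
  assumes "f \<in> borel_measurable borel" "g \<in> borel_measurable N" "h \<in> borel_measurable N"
  shows "(\<lambda>y. Q f (g y) (h y)) \<in> borel_measurable N"
  using measurable_uncurried[OF Q_measurable_aux[OF assms(1)] assms(2,3)] .

text \<open>For \<open>v < L x\<close> the jump position \<open>q v\<close> exceeds \<open>x\<close>, so \<open>t - ln (q v / x)\<close> runs over \<open>[0, t]\<close>.\<close>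

lemma jump_term_time:
  assumes "0 < x" "v \<in> {0<..<L x}" "q v \<le> x * exp t"
  shows "x < q v" "0 < q v" "ln (q v / x) \<in> {0<..t}"
proof -
  show 1: "x < q v" using assms by (subst q_gt_iff) auto
  then show 2: "0 < q v" using assms by auto
  have "q v / x \<le> exp t" using assms by (simp add: field_simps)
  then have "ln (q v / x) \<le> t" using 2 assms by (metis divide_pos_pos ln_exp ln_le_cancel_iff exp_gt_zero)
  moreover have "0 < ln (q v / x)" using 1 assms by (intro ln_gt_zero) (simp add: field_simps)
  ultimately show "ln (q v / x) \<in> {0<..t}" by simp
qed

text \<open>A jump happens at a position above \<open>x > 0\<close>, so only remaining times in
  \<open>[0, t)\<close> and positive landing points are visited. Inductions on \<open>W\<close> can
  thus be confined to positive states and non-negative times.\<close>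

lemma jump_term_mono:
  assumes "0 < x" and "\<And>s w. 0 \<le> s \<Longrightarrow> s < t \<Longrightarrow> 0 < w \<Longrightarrow> \<phi> s w \<le> \<psi> s w"
  shows "jump_term \<phi> t x \<le> jump_term \<psi> t x"
  unfolding jump_term_def
proof (rule mult_left_mono[OF nn_integral_mono])
  fix v
  show "indicator {0<..<L x} v * indicator {..x * exp t} (q v) * jump_mean (q v) (\<phi> (t - ln (q v / x)))
     \<le> indicator {0<..<L x} v * indicator {..x * exp t} (q v) * jump_mean (q v) (\<psi> (t - ln (q v / x)))"
  proof (cases "v \<in> {0<..<L x} \<and> q v \<le> x * exp t")
    case True
    then have "jump_mean (q v) (\<phi> (t - ln (q v / x))) \<le> jump_mean (q v) (\<psi> (t - ln (q v / x)))"
      using jump_term_time[OF assms(1), of v t] by (intro jump_mean_mono assms(2)) auto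
    then show ?thesis by (rule mult_left_mono) simp
  qed (auto simp: indicator_def)
qed auto

lemma W_Suc_mono: "0 < x \<Longrightarrow> 0 \<le> t \<Longrightarrow> W n f t x \<le> W (Suc n) f t x"
proof (induction n arbitrary: t x)
  case (Suc n)
  have "jump_term (W n f) t x \<le> jump_term (W (Suc n) f) t x"
    using Suc by (intro jump_term_mono) auto
  then show ?case by (simp add: add_left_mono del: W.simps(2) add: W.simps(2)[of n] W.simps(2)[of "Suc n"])
qed simp

lemma W_incseq: "0 < x \<Longrightarrow> 0 \<le> t \<Longrightarrow> incseq (\<lambda>n. W n f t x)"
  using W_Suc_mono by (intro incseq_SucI) auto

lemma W_mono:
  assumes "\<And>x. 0 < x \<Longrightarrow> f x \<le> g x"
  shows "0 < x \<Longrightarrow> 0 \<le> t \<Longrightarrow> W n f t x \<le> W n g t x"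
proof (induction n arbitrary: t x)
  case (Suc n)
  then have "jump_term (W n f) t x \<le> jump_term (W n g) t x" by (intro jump_term_mono) auto
  moreover have "flow f t x \<le> flow g t x" using Suc assms unfolding flow_def by (intro mult_left_mono) auto
  ultimately show ?case by (simp add: add_mono)
qed simp

lemma Q_mono:
  assumes "\<And>x. 0 < x \<Longrightarrow> f x \<le> g x" "0 < x" "0 \<le> t"
  shows "Q f t x \<le> Q g t x"
  unfolding Q_def using W_mono[of f g, OF assms] by (intro SUP_mono) auto

lemma Q_cong:
  assumes "\<And>x. 0 < x \<Longrightarrow> f x = g x" "0 < x" "0 \<le> t"
  shows "Q f t x = Q g t x"
  using assms by (intro antisym Q_mono) auto

lemma jump_term_add:
  assumes [measurable]: "case_prod \<phi> \<in> borel_measurable (borel \<Otimes>\<^sub>M borel)" "case_prod \<psi> \<in> borel_measurable (borel \<Otimes>\<^sub>M borel)"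
  shows "jump_term (\<lambda>t x. \<phi> t x + \<psi> t x) t x = jump_term \<phi> t x + jump_term \<psi> t x"
proof -
  note [measurable (raw)] = measurable_uncurried[OF assms(1)]
  note [measurable (raw)] = measurable_uncurried[OF assms(2)]
  have *: "jump_mean z (\<lambda>w. \<phi> s w + \<psi> s w) = jump_mean z (\<phi> s) + jump_mean z (\<psi> s)" for z s
    unfolding jump_mean_def by (subst nn_integral_add[symmetric]) (auto intro!: nn_integral_cong simp: distrib_left distrib_right)
  show ?thesis unfolding jump_term_def distrib_left[symmetric]
    by (subst nn_integral_add[symmetric]) (auto simp: * distrib_left)
qed

lemma W_add:
  assumes [measurable]: "f \<in> borel_measurable borel" "g \<in> borel_measurable borel"
  shows "W n (\<lambda>x. f x + g x) t x = W n f t x + W n g t x"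
proof (induction n arbitrary: t x)
  case (Suc n)
  then have "jump_term (W n (\<lambda>x. f x + g x)) t x = jump_term (\<lambda>t x. W n f t x + W n g t x) t x" by (auto intro!: arg_cong[where f="\<lambda>\<phi>. jump_term \<phi> t x"])
  also have "\<dots> = jump_term (W n f) t x + jump_term (W n g) t x"
    by (intro jump_term_add W_measurable_aux) auto
  finally show ?case by (simp add: flow_def distrib_left add_ac)
qed simp

lemma Q_add:
  assumes [measurable]: "f \<in> borel_measurable borel" "g \<in> borel_measurable borel" and "0 < x" "0 \<le> t"
  shows "Q (\<lambda>x. f x + g x) t x = Q f t x + Q g t x"
  unfolding Q_def using W_incseq[OF assms(3,4)] assms(1,2) by (simp add: W_add ennreal_SUP_add)

text \<open>Monotone convergence is applied twice, in the landing point and in the level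
  \<open>v\<close>; the indicators keep the arguments in the range where the sequence is known to
  increase.\<close>

lemma jump_term_SUP:
  assumes [measurable]: "\<And>n. case_prod (\<phi> n) \<in> borel_measurable (borel \<Otimes>\<^sub>M borel)"
    and x: "0 < x" and inc: "\<And>s w. 0 \<le> s \<Longrightarrow> 0 < w \<Longrightarrow> incseq (\<lambda>n. \<phi> n s w)"
  shows "jump_term (\<lambda>s w. SUP n. \<phi> n s w) t x = (SUP n. jump_term (\<phi> n) t x)"
proof -
  note [measurable (raw)] = measurable_uncurried[OF assms(1)]
  have *: "jump_mean z (\<lambda>w. SUP n. \<phi> n s w) = (SUP n. jump_mean z (\<phi> n s))" if s: "0 \<le> s" for s z
  proof -
    have "jump_mean z (\<lambda>w. SUP n. \<phi> n s w) = (\<integral>\<^sup>+w. (SUP n. ennreal (2 * w / z\<^sup>2) * \<phi> n s w * indicator {0<..<z} w) \<partial>lborel)"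
      unfolding jump_mean_def
      by (intro nn_integral_cong) (simp add: SUP_mult_left_ennreal[symmetric] indicator_def)
    also have "\<dots> = (SUP n. jump_mean z (\<phi> n s))"
      unfolding jump_mean_def
      using inc[OF s] by (intro nn_integral_monotone_convergence_SUP)
        (auto simp: incseq_def le_fun_def indicator_def intro!: mult_left_mono)
    finally show ?thesis .
  qed
  let ?i = "\<lambda>v. indicator {0<..<L x} v * indicator {..x * exp t} (q v) :: ennreal"
  have "jump_term (\<lambda>s w. SUP n. \<phi> n s w) t x = ennreal (1 / L x) *
     (\<integral>\<^sup>+v. (SUP n. ?i v * jump_mean (q v) (\<phi> n (t - ln (q v / x)))) \<partial>lborel)"
    unfolding jump_term_def
  proof (intro arg_cong2[where f="(*)"] refl nn_integral_cong)
    fix v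
    show "?i v * jump_mean (q v) (\<lambda>w. \<Squnion>n. \<phi> n (t - ln (q v / x)) w) = (SUP n. ?i v * jump_mean (q v) (\<phi> n (t - ln (q v / x))))"
      using jump_term_time[OF x, of v t] *[of "t - ln (q v / x)"] by (auto simp: indicator_def)
  qed
  also have "\<dots> = ennreal (1 / L x) * (SUP n. \<integral>\<^sup>+v. ?i v * jump_mean (q v) (\<phi> n (t - ln (q v / x))) \<partial>lborel)"
  proof (subst nn_integral_monotone_convergence_SUP)
    show "incseq (\<lambda>n v. ?i v * jump_mean (q v) (\<phi> n (t - ln (q v / x))))"
      unfolding incseq_def le_fun_def
    proof (intro allI impI)
      fix m n :: nat and v assume "m \<le> n"
      then show "?i v * jump_mean (q v) (\<phi> m (t - ln (q v / x))) \<le> ?i v * jump_mean (q v) (\<phi> n (t - ln (q v / x)))"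
        using jump_term_time[OF x, of v t] inc[of "t - ln (q v / x)"]
        by (auto simp: indicator_def incseq_def intro!: jump_mean_mono)
    qed
  qed auto
  also have "\<dots> = (SUP n. jump_term (\<phi> n) t x)"
    unfolding jump_term_def by (rule SUP_mult_left_ennreal)
  finally show ?thesis .
qed

lemma Q_renewal:
  assumes [measurable]: "f \<in> borel_measurable borel" and "0 < x" "0 \<le> t"
  shows "Q f t x = flow f t x + jump_term (Q f) t x"
proof -
  have "jump_term (Q f) t x = jump_term (\<lambda>s w. SUP n. W n f s w) t x" by (simp add: Q_def[abs_def])
  also have "\<dots> = (SUP n. jump_term (W n f) t x)"
    using assms by (intro jump_term_SUP W_measurable_aux W_incseq)
  finally have "flow f t x + jump_term (Q f) t x = (SUP n. W (Suc n) f t x)"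
    by (simp add: ennreal_SUP_add_right)
  also have "\<dots> = Q f t x"
    unfolding Q_def
  proof (rule antisym)
    show "(SUP n. W n f t x) \<le> (SUP n. W (Suc n) f t x)"
      using W_Suc_mono[OF assms(2,3), of _ f] by (intro SUP_mono) blast
  qed (intro SUP_mono, blast)
  finally show ?thesis ..
qed

end

section \<open>Invariance and the semigroup property\<close>

text \<open>With \<open>x = z * exp (- s)\<close> one has
  \<open>x dx = z\<^sup>2 * exp (- 2 * s) ds\<close>. A linear density of starting points thereby
  becomes an exponential density of the time \<open>s\<close> needed to grow from \<open>x\<close>
  to \<open>z\<close>.\<close>

lemma nn_integral_log_substitution:
  assumes [measurable]: "\<psi> \<in> borel_measurable borel" and z: "0 < z" and t: "0 \<le> t"
  shows "(\<integral>\<^sup>+x. ennreal x * \<psi> (ln (z / x)) * indicator {z * exp (- t)..<z} x \<partial>lborel) =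
     (\<integral>\<^sup>+s. ennreal (z\<^sup>2 * exp (- 2 * s)) * \<psi> s * indicator {0..t} s \<partial>lborel)"
proof (cases "t = 0")
  case True
  then show ?thesis
    by (auto simp: indicator_def intro!: nn_integral_zero' eventually_mono[OF AE_lborel_singleton[of 0]]
       arg_cong2[where f="(=)" and a=0, THEN iffD2])
next
  case False
  have "(\<integral>\<^sup>+x. ennreal x * \<psi> (ln (z / x)) * indicator {z * exp (- t)..<z} x \<partial>lborel) =
    (\<integral>\<^sup>+x. (ennreal x * \<psi> (ln (z / x))) * indicator {z * exp (- t)..z * exp 0} x \<partial>lborel)"
    by (intro nn_integral_cong_AE eventually_mono[OF AE_lborel_singleton[of z]]) (auto simp: indicator_def)
  also have "\<dots> = (\<integral>\<^sup>+r. (ennreal (z * exp r) * \<psi> (ln (z / (z * exp r)))) * ennreal (z * exp r) * indicator {-t..0} r \<partial>lborel)"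
    using z t False by (intro nn_integral_substitution_aux) (auto intro!: derivative_eq_intros continuous_intros)
  \<comment> \<open>The substitution rule is for increasing maps, so the exponent is reflected only
    afterwards.\<close>
  also have "\<dots> = (\<integral>\<^sup>+s. (ennreal (z * exp (-s)) * \<psi> (ln (z / (z * exp (-s))))) * ennreal (z * exp (-s)) * indicator {-t..0} (-s) \<partial>lborel)"
    by (subst nn_integral_real_affine[where c="-1" and t=0]) auto
  also have "\<dots> = (\<integral>\<^sup>+s. ennreal (z\<^sup>2 * exp (- 2 * s)) * \<psi> s * indicator {0..t} s \<partial>lborel)"
  proof (rule nn_integral_cong)
    fix s
    have 1: "ln (z / (z * exp (-s))) = s" using z by (simp add: exp_minus divide_simps)
    have "ennreal (z * exp (-s)) * \<psi> s * ennreal (z * exp (-s)) = ennreal (z * exp (-s) * (z * exp (-s))) * \<psi> s"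
      using z by (simp add: ennreal_mult mult_ac)
    also have "z * exp (-s) * (z * exp (-s)) = z\<^sup>2 * exp (-2 * s)"
      by (simp add: power2_eq_square mult_ac exp_add[symmetric] mult_exp_exp)
    finally show "(ennreal (z * exp (-s)) * \<psi> (ln (z / (z * exp (-s))))) * ennreal (z * exp (-s)) * indicator {-t..0} (-s)
      = ennreal (z\<^sup>2 * exp (- 2 * s)) * \<psi> s * indicator {0..t} s"
      unfolding 1 by (auto simp: indicator_def)
  qed
  finally show ?thesis .
qed

lemma nn_integral_exp2:
  assumes "0 \<le> t"
  shows "(\<integral>\<^sup>+s. ennreal (2 * exp (- 2 * s)) * indicator {0..t} s \<partial>lborel) = ennreal (1 - exp (- 2 * t))"
proof -
  have "(\<integral>\<^sup>+s. ennreal (2 * exp (- 2 * s)) * indicator {0..t} s \<partial>lborel) = ennreal ((- exp (-2 * t)) - (- exp (-2 * 0)))"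
    using assms by (intro nn_integral_FTC_Icc) (auto intro!: derivative_eq_intros)
  then show ?thesis by simp
qed

section \<open>Conservation of mass and invariance of the equilibrium\<close>

context growth_jump
begin

text \<open>The condition \<open>q v \<le> x * exp t\<close> is
  \<open>L (x * exp t) \<le> v\<close>, so the integral is the length of an interval. The value is
  the probability of a jump by time \<open>t\<close>.\<close>

lemma jump_term_one:
  assumes x: "0 < x" and t: "0 \<le> t"
  shows "jump_term (\<lambda>_ _. 1) t x = ennreal (1 - L (x * exp t) / L x)"
proof -
  have xt: "x \<le> x * exp t" using x t by simp
  have "(\<integral>\<^sup>+v. indicator {0<..<L x} v * indicator {..x * exp t} (q v) * jump_mean (q v) (\<lambda>_. 1) \<partial>lborel) =
        (\<integral>\<^sup>+v. indicator {L (x * exp t)..<L x} v \<partial>lborel)"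
  proof (rule nn_integral_cong)
    fix v
    show "indicator {0<..<L x} v * indicator {..x * exp t} (q v) * jump_mean (q v) (\<lambda>_. 1) = indicator {L (x * exp t)..<L x} v"
    proof (cases "v \<in> {0<..<L x}")
      case True
      then have "0 < q v" "q v \<le> x * exp t \<longleftrightarrow> L (x * exp t) \<le> v"
        using q_gt_iff[of v x] q_le_iff[of v "x * exp t"] x by auto
      then show ?thesis using True by (auto simp: indicator_def jump_mean_one)
    next
      case False
      then show ?thesis using L_pos[of "x * exp t"] by (auto simp: indicator_def)
    qed
  qed
  also have "\<dots> = ennreal (L x - L (x * exp t))"
    using L_antimono[OF xt] by (simp add: emeasure_lborel_Ico)
  finally show ?thesis
    unfolding jump_term_def using L_antimono[OF xt] L_pos[of x]
    by (simp add: ennreal_mult[symmetric] field_simps)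
qed

lemma flow_one: "flow (\<lambda>_. 1) t x = ennreal (L (x * exp t) / L x)"
  by (simp add: flow_def)

lemma L_ratio: "0 < x \<Longrightarrow> 0 \<le> t \<Longrightarrow> L (x * exp t) / L x \<in> {0..1}"
  using L_pos[of x] L_pos[of "x * exp t"] L_antimono[of x "x * exp t"] by (auto simp: field_simps)

lemma W_le_one: "0 < x \<Longrightarrow> 0 \<le> t \<Longrightarrow> W n (\<lambda>_. 1) t x \<le> 1"
proof (induction n arbitrary: t x)
  case (Suc n)
  have "W (Suc n) (\<lambda>_. 1) t x \<le> flow (\<lambda>_. 1) t x + jump_term (\<lambda>_ _. 1) t x"
    using Suc by (auto intro!: add_mono jump_term_mono)
  also have "\<dots> = 1"
    using Suc L_ratio[of x t] by (simp add: jump_term_one flow_one ennreal_plus[symmetric] del: ennreal_plus)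
  finally show ?case .
qed simp

lemma Q_le_one:
  assumes "\<And>x. 0 < x \<Longrightarrow> f x \<le> 1" "0 < x" "0 \<le> t" shows "Q f t x \<le> 1"
proof -
  have "Q f t x \<le> Q (\<lambda>_. 1) t x" using assms by (intro Q_mono) auto
  also have "\<dots> \<le> 1" unfolding Q_def using W_le_one assms by (intro SUP_least) auto
  finally show ?thesis .
qed

definition equil_mean :: "(real \<Rightarrow> ennreal) \<Rightarrow> ennreal" where
  "equil_mean f = (\<integral>\<^sup>+x. ennreal (C * x * L x) * f x * indicator {0<..} x \<partial>lborel)"

lemma equil_mean_mono: "(\<And>x. 0 < x \<Longrightarrow> f x \<le> g x) \<Longrightarrow> equil_mean f \<le> equil_mean g"
  unfolding equil_mean_def by (intro nn_integral_mono) (auto simp: indicator_def intro!: mult_left_mono)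

lemma equil_mean_cong: "(\<And>x. 0 < x \<Longrightarrow> f x = g x) \<Longrightarrow> equil_mean f = equil_mean g"
  by (intro antisym equil_mean_mono) auto

lemma equil_mean_add:
  assumes [measurable]: "f \<in> borel_measurable borel" "g \<in> borel_measurable borel"
  shows "equil_mean (\<lambda>x. f x + g x) = equil_mean f + equil_mean g"
  unfolding equil_mean_def by (subst nn_integral_add[symmetric]) (auto simp: distrib_left distrib_right)

lemma equil_mean_cmult:
  assumes [measurable]: "f \<in> borel_measurable borel"
  shows "equil_mean (\<lambda>x. c * f x) = c * equil_mean f"
  unfolding equil_mean_def by (subst nn_integral_cmult[symmetric]) (auto simp: mult_ac)

lemma equil_mean_const: "equil_mean (\<lambda>_. c) = c"
  using total equil_mean_cmult[of "\<lambda>_. 1" c] by (simp add: equil_mean_def)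

lemma equil_mean_measurable [measurable (raw)]:
  assumes [measurable]: "case_prod h \<in> borel_measurable (N \<Otimes>\<^sub>M borel)"
  shows "(\<lambda>y. equil_mean (h y)) \<in> borel_measurable N"
  unfolding equil_mean_def by measurable

text \<open>In the variable \<open>y = x * exp t\<close> both \<open>dx\<close> and the linear
  factor \<open>x\<close> contribute \<open>exp (- t)\<close>, and the survival ratio replaces
  \<open>L x\<close> by \<open>L y\<close>. Without a jump the shape of the equilibrium is kept and
  its mass decays at rate 2.\<close>

lemma equil_mean_flow:
  assumes [measurable]: "f \<in> borel_measurable borel"
  shows "equil_mean (flow f t) = ennreal (exp (- 2 * t)) * equil_mean f"
proof -
  have "equil_mean f = ennreal (exp t) * (\<integral>\<^sup>+x. ennreal (C * (exp t * x) * L (exp t * x)) * f (exp t * x) * indicator {0<..} (exp t * x) \<partial>lborel)"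
    unfolding equil_mean_def by (subst nn_integral_real_affine[where c="exp t" and t=0]) auto
  then have "ennreal (exp (- 2 * t)) * equil_mean f =
    (\<integral>\<^sup>+x. ennreal (exp (- 2 * t)) * (ennreal (exp t) * (ennreal (C * (exp t * x) * L (exp t * x)) * f (exp t * x) * indicator {0<..} (exp t * x))) \<partial>lborel)"
    by (simp add: nn_integral_cmult)
  also have "\<dots> = equil_mean (flow f t)"
    unfolding equil_mean_def
  proof (rule nn_integral_cong)
    fix x :: real
    show "ennreal (exp (- 2 * t)) * (ennreal (exp t) * (ennreal (C * (exp t * x) * L (exp t * x)) * f (exp t * x) * indicator {0<..} (exp t * x)))
      = ennreal (C * x * L x) * flow f t x * indicator {0<..} x"
    proof (cases "0 < x")
      case True
      have "exp (-2 * t) * (exp t * (C * (exp t * x) * L (exp t * x))) = (exp (-2 * t) * exp t * exp t) * (C * x * L (exp t * x))"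
        by simp
      also have "exp (-2 * t) * exp t * exp t = 1" by (simp add: exp_add[symmetric] mult_exp_exp)
      also have "1 * (C * x * L (exp t * x)) = C * x * L x * (L (x * exp t) / L x)"
        using L_pos[of x] by (simp add: mult.commute)
      finally have "ennreal (exp (- 2 * t)) * (ennreal (exp t) * ennreal (C * (exp t * x) * L (exp t * x))) =
         ennreal (C * x * L x) * ennreal (L (x * exp t) / L x)"
        using True C_pos L_pos by (simp add: ennreal_mult[symmetric] less_imp_le)
      then show ?thesis using True unfolding flow_def by (simp add: mult.assoc[symmetric] mult.commute[of x])
    qed (simp add: indicator_def zero_less_mult_iff)
  qed
  finally show ?thesis ..
qed

text \<open>Integrating the jump term against the equilibrium density replaces the state-dependent
  jump rate by the constant rate 2, so under equilibrium the number of jumps is Poisson.\<close>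

lemma equil_mean_gam:
  assumes \<phi> [measurable]: "case_prod \<phi> \<in> borel_measurable (borel \<Otimes>\<^sub>M borel)" and t: "0 \<le> t"
  shows "equil_mean (jump_term \<phi> t) = (\<integral>\<^sup>+s. ennreal (2 * exp (- 2 * s)) * equil_mean (\<phi> (t - s)) * indicator {0..t} s \<partial>lborel)"
proof -
  note [measurable (raw)] = measurable_uncurried[OF assms(1)]
  have [measurable]: "Measurable.pred (borel \<Otimes>\<^sub>M borel) (\<lambda>p::real\<times>real. snd p \<in> {0<..<L (fst p)})"
    "Measurable.pred (borel \<Otimes>\<^sub>M borel) (\<lambda>p::real\<times>real. q (snd p) \<in> {..fst p * exp t})"
    "Measurable.pred ((borel \<Otimes>\<^sub>M borel) \<Otimes>\<^sub>M borel) (\<lambda>p::(real\<times>real)\<times>real. snd p \<in> {0<..<q (fst (fst p))})"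
    "Measurable.pred (borel \<Otimes>\<^sub>M borel) (\<lambda>p::(real\<times>real). snd p \<in> {0<..<q (fst p)})" by simp_all
  have [measurable (raw)]: "Measurable.pred N (\<lambda>y. g y \<in> {0<..<q (h y)})"
    if [measurable]: "g \<in> borel_measurable N" "h \<in> borel_measurable N" for g h and N :: "'z measure"
    by simp
  have "equil_mean (jump_term \<phi> t) = (\<integral>\<^sup>+x. \<integral>\<^sup>+v. ennreal (C * x) * indicator {0<..} x * (indicator {0<..<L x} v * indicator {..x * exp t} (q v) *
     jump_mean (q v) (\<phi> (t - ln (q v / x)))) \<partial>lborel \<partial>lborel)"
    unfolding equil_mean_def
  proof (rule nn_integral_cong)
    fix x :: real
    let ?I = "\<integral>\<^sup>+v. (indicator {0<..<L x} v * indicator {..x * exp t} (q v) * jump_mean (q v) (\<phi> (t - ln (q v / x)))) \<partial>lborel"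
    have "(\<integral>\<^sup>+v. ennreal (C * x) * indicator {0<..} x * (indicator {0<..<L x} v * indicator {..x * exp t} (q v) *
       jump_mean (q v) (\<phi> (t - ln (q v / x)))) \<partial>lborel) = ennreal (C * x) * indicator {0<..} x * ?I"
      by (subst nn_integral_cmult) auto
    moreover have "ennreal (C * x * L x) * ennreal (1 / L x) = ennreal (C * x)" if "0 < x"
      using that C_pos L_pos[of x] by (simp add: ennreal_mult[symmetric])
    ultimately show "ennreal (C * x * L x) * jump_term \<phi> t x * indicator {0<..} x = (\<integral>\<^sup>+v. ennreal (C * x) * indicator {0<..} x * (indicator {0<..<L x} v * indicator {..x * exp t} (q v) *
       jump_mean (q v) (\<phi> (t - ln (q v / x)))) \<partial>lborel)"
      unfolding jump_term_def by (auto simp: indicator_def mult.assoc[symmetric])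
  qed
  \<comment> \<open>The exchange fixes the level \<open>v\<close>, hence the jump position
    \<open>q v\<close>, and lets the starting point vary.\<close>
  also have "\<dots> = (\<integral>\<^sup>+v. \<integral>\<^sup>+x. ennreal (C * x) * indicator {0<..} x * (indicator {0<..<L x} v * indicator {..x * exp t} (q v) *
     jump_mean (q v) (\<phi> (t - ln (q v / x)))) \<partial>lborel \<partial>lborel)"
    unfolding indicator_def by (subst lborel_pair.Fubini') (auto simp: case_prod_beta)
  also have "\<dots> = (\<integral>\<^sup>+v. \<integral>\<^sup>+s. \<integral>\<^sup>+w. ennreal (2 * exp (- 2 * s)) * indicator {0..t} s *
       (ennreal (C * w) * \<phi> (t - s) w) * (indicator {0<..<1} v * indicator {0<..<q v} w) \<partial>lborel \<partial>lborel \<partial>lborel)"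
  proof (rule nn_integral_cong)
    fix v :: real
    show "(\<integral>\<^sup>+x. ennreal (C * x) * indicator {0<..} x * (indicator {0<..<L x} v * indicator {..x * exp t} (q v) *
       jump_mean (q v) (\<phi> (t - ln (q v / x)))) \<partial>lborel) =
      (\<integral>\<^sup>+s. \<integral>\<^sup>+w. ennreal (2 * exp (- 2 * s)) * indicator {0..t} s *
       (ennreal (C * w) * \<phi> (t - s) w) * (indicator {0<..<1} v * indicator {0<..<q v} w) \<partial>lborel \<partial>lborel)"
    proof (cases "v \<in> {0<..<1}")
      case False
      then have "indicator {0<..<L x} v = (0::ennreal)" for x using L_le1[of x] by (auto simp: indicator_def)
      then show ?thesis using False by simp
    next
      case True
      define z where "z = q v"
      have z: "0 < z" using True L_0[of 0] unfolding z_def by (subst q_gt_iff) auto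
      have "(\<integral>\<^sup>+x. ennreal (C * x) * indicator {0<..} x * (indicator {0<..<L x} v * indicator {..x * exp t} (q v) *
       jump_mean (q v) (\<phi> (t - ln (q v / x)))) \<partial>lborel) =
        (\<integral>\<^sup>+x. ennreal x * (ennreal C * jump_mean z (\<phi> (t - ln (z / x)))) * indicator {z * exp (- t)..<z} x \<partial>lborel)"
      proof (rule nn_integral_cong)
        fix x
        \<comment> \<open>For fixed \<open>z = q v\<close>, these are the starting points from which
          \<open>z\<close> is reached by growth within time \<open>t\<close>.\<close>
        have "0 < x \<and> v \<in> {0<..<L x} \<and> z \<le> x * exp t \<longleftrightarrow> x \<in> {z * exp (- t)..<z}"
        proof (cases "0 < x")
          case True
          then show ?thesis using \<open>v \<in> _\<close> q_gt_iff[of v x] by (auto simp: z_def exp_minus divide_simps)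
        next
          case False
          moreover have "0 < z * exp (- t)" using z by simp
          ultimately show ?thesis by auto
        qed
        then show "ennreal (C * x) * indicator {0<..} x * (indicator {0<..<L x} v * indicator {..x * exp t} (q v) *
           jump_mean (q v) (\<phi> (t - ln (q v / x)))) = ennreal x * (ennreal C * jump_mean z (\<phi> (t - ln (z / x)))) * indicator {z * exp (- t)..<z} x"
          using C_pos unfolding z_def[symmetric] by (auto simp: indicator_def ennreal_mult mult_ac)
      qed
      also have "\<dots> = (\<integral>\<^sup>+s. ennreal (z\<^sup>2 * exp (- 2 * s)) * (ennreal C * jump_mean z (\<phi> (t - s))) * indicator {0..t} s \<partial>lborel)"
        by (rule nn_integral_log_substitution[OF _ z t]) measurable
      also have "\<dots> = (\<integral>\<^sup>+s. \<integral>\<^sup>+w. ennreal (2 * exp (- 2 * s)) * indicator {0..t} s *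
       (ennreal (C * w) * \<phi> (t - s) w) * (indicator {0<..<1} v * indicator {0<..<q v} w) \<partial>lborel \<partial>lborel)"
      proof (rule nn_integral_cong)
        fix s
        have "ennreal (z\<^sup>2 * exp (- 2 * s)) * (ennreal C * jump_mean z (\<phi> (t - s))) * indicator {0..t} s =
         (\<integral>\<^sup>+w. (ennreal (z\<^sup>2 * exp (- 2 * s)) * ennreal C * indicator {0..t} s) * (ennreal (2 * w / z\<^sup>2) * \<phi> (t-s) w * indicator {0<..<z} w) \<partial>lborel)"
          by (subst nn_integral_cmult) (auto simp: jump_mean_def mult_ac)
        also have "\<dots> = (\<integral>\<^sup>+w. ennreal (2 * exp (- 2 * s)) * indicator {0..t} s *
         (ennreal (C * w) * \<phi> (t - s) w) * (indicator {0<..<1} v * indicator {0<..<q v} w) \<partial>lborel)"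
        proof (rule nn_integral_cong)
          fix w
          \<comment> \<open>The factor \<open>z\<^sup>2\<close> of the time substitution cancels the
            one in the jump density; the jump position survives only in the condition
            \<open>w < q v\<close>.\<close>
          have "ennreal (z\<^sup>2 * exp (- 2 * s)) * ennreal C * ennreal (2 * w / z\<^sup>2) = ennreal (2 * exp (- 2 * s)) * ennreal (C * w)" if "0 < w"
          proof -
            have "z\<^sup>2 * exp (- 2 * s) * C * (2 * w / z\<^sup>2) = 2 * exp (- 2 * s) * (C * w)" using z by simp
            then show ?thesis using that C_pos by (simp add: ennreal_mult[symmetric])
          qed
          then show "(ennreal (z\<^sup>2 * exp (- 2 * s)) * ennreal C * indicator {0..t} s) * (ennreal (2 * w / z\<^sup>2) * \<phi> (t-s) w * indicator {0<..<z} w)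
            = ennreal (2 * exp (- 2 * s)) * indicator {0..t} s *
           (ennreal (C * w) * \<phi> (t - s) w) * (indicator {0<..<1} v * indicator {0<..<q v} w)"
            using True unfolding z_def[symmetric] by (auto simp: indicator_def mult.assoc[symmetric])
        qed
        finally show "ennreal (z\<^sup>2 * exp (- 2 * s)) * (ennreal C * jump_mean z (\<phi> (t - s))) * indicator {0..t} s =
          (\<integral>\<^sup>+w. ennreal (2 * exp (- 2 * s)) * indicator {0..t} s *
         (ennreal (C * w) * \<phi> (t - s) w) * (indicator {0<..<1} v * indicator {0<..<q v} w) \<partial>lborel)" .
      qed
      finally show ?thesis .
    qed
  qed
  also have "\<dots> = (\<integral>\<^sup>+s. \<integral>\<^sup>+v. \<integral>\<^sup>+w. ennreal (2 * exp (- 2 * s)) * indicator {0..t} s *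
       (ennreal (C * w) * \<phi> (t - s) w) * (indicator {0<..<1} v * indicator {0<..<q v} w) \<partial>lborel \<partial>lborel \<partial>lborel)"
    unfolding indicator_def by (subst lborel_pair.Fubini') (auto simp: case_prod_beta)
  also have "\<dots> = (\<integral>\<^sup>+s. \<integral>\<^sup>+w. \<integral>\<^sup>+v. ennreal (2 * exp (- 2 * s)) * indicator {0..t} s *
       (ennreal (C * w) * \<phi> (t - s) w) * (indicator {0<..<1} v * indicator {0<..<q v} w) \<partial>lborel \<partial>lborel \<partial>lborel)"
    unfolding indicator_def by (rule nn_integral_cong, subst lborel_pair.Fubini') (auto simp: case_prod_beta)
  also have "\<dots> = (\<integral>\<^sup>+s. ennreal (2 * exp (- 2 * s)) * equil_mean (\<phi> (t - s)) * indicator {0..t} s \<partial>lborel)"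
  proof (rule nn_integral_cong)
    fix s
    \<comment> \<open>Since \<open>w < q v\<close> means \<open>v < L w\<close>, integrating over
      the level restores the factor \<open>L w\<close> of the equilibrium density at the landing
      point.\<close>
    have *: "(\<integral>\<^sup>+v. indicator {0<..<1} v * indicator {0<..<q v} w \<partial>lborel) = ennreal (L w) * indicator {0<..} w" for w
    proof (cases "0 < w")
      case True
      have "(\<integral>\<^sup>+v. indicator {0<..<1} v * indicator {0<..<q v} w \<partial>lborel) = (\<integral>\<^sup>+v. indicator {0<..<L w} v \<partial>lborel)"
        using True q_gt_iff[of _ w] L_le1[of w] by (intro nn_integral_cong) (auto simp: indicator_def)
      also have "\<dots> = ennreal (L w)" using L_pos[of w] by simp
      finally show ?thesis using True by simp
    qed (simp add: indicator_def)
    have "(\<integral>\<^sup>+w. \<integral>\<^sup>+v. ennreal (2 * exp (- 2 * s)) * indicator {0..t} s *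
       (ennreal (C * w) * \<phi> (t - s) w) * (indicator {0<..<1} v * indicator {0<..<q v} w) \<partial>lborel \<partial>lborel) =
      (\<integral>\<^sup>+w. (ennreal (2 * exp (- 2 * s)) * indicator {0..t} s) *
       ((ennreal (C * w) * \<phi> (t - s) w) * (ennreal (L w) * indicator {0<..} w)) \<partial>lborel)"
    proof (rule nn_integral_cong)
      fix w
      have "(\<integral>\<^sup>+v. ennreal (2 * exp (- 2 * s)) * indicator {0..t} s * (ennreal (C * w) * \<phi> (t - s) w) * (indicator {0<..<1} v * indicator {0<..<q v} w) \<partial>lborel)
         = ennreal (2 * exp (- 2 * s)) * indicator {0..t} s * (ennreal (C * w) * \<phi> (t - s) w) * (\<integral>\<^sup>+v. indicator {0<..<1} v * indicator {0<..<q v} w \<partial>lborel)"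
        unfolding indicator_def by (subst nn_integral_cmult) auto
      then show "(\<integral>\<^sup>+v. ennreal (2 * exp (- 2 * s)) * indicator {0..t} s * (ennreal (C * w) * \<phi> (t - s) w) * (indicator {0<..<1} v * indicator {0<..<q v} w) \<partial>lborel)
         = (ennreal (2 * exp (- 2 * s)) * indicator {0..t} s) * ((ennreal (C * w) * \<phi> (t - s) w) * (ennreal (L w) * indicator {0<..} w))"
        unfolding * by (simp add: mult.assoc)
    qed
    also have "\<dots> = (ennreal (2 * exp (- 2 * s)) * indicator {0..t} s) * equil_mean (\<phi> (t - s))"
    proof (subst nn_integral_cmult)
      show "(ennreal (2 * exp (- 2 * s)) * indicator {0..t} s) * (\<integral>\<^sup>+w. ((ennreal (C * w) * \<phi> (t - s) w) * (ennreal (L w) * indicator {0<..} w)) \<partial>lborel)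
        = (ennreal (2 * exp (- 2 * s)) * indicator {0..t} s) * equil_mean (\<phi> (t - s))"
        unfolding equil_mean_def using C_pos L_pos
        by (intro arg_cong2[where f="(*)", OF refl nn_integral_cong]) (auto simp: indicator_def ennreal_mult less_imp_le mult_ac)
    qed simp
    finally show "(\<integral>\<^sup>+w. \<integral>\<^sup>+v. ennreal (2 * exp (- 2 * s)) * indicator {0..t} s *
       (ennreal (C * w) * \<phi> (t - s) w) * (indicator {0<..<1} v * indicator {0<..<q v} w) \<partial>lborel \<partial>lborel) =
      ennreal (2 * exp (- 2 * s)) * equil_mean (\<phi> (t - s)) * indicator {0..t} s" by (simp add: mult_ac)
  qed
  finally show ?thesis .
qed

lemma equil_mean_W_Suc:
  assumes [measurable]: "f \<in> borel_measurable borel" and t: "0 \<le> t"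
  shows "equil_mean (W (Suc n) f t) = ennreal (exp (- 2 * t)) * equil_mean f +
    (\<integral>\<^sup>+s. ennreal (2 * exp (- 2 * s)) * equil_mean (W n f (t - s)) * indicator {0..t} s \<partial>lborel)"
  using equil_mean_add[of "flow f t" "jump_term (W n f) t"] W_measurable_aux[OF assms(1), of n]
  by (simp add: equil_mean_flow equil_mean_gam t)

lemma equil_mean_W_le:
  assumes [measurable]: "f \<in> borel_measurable borel"
  shows "0 \<le> t \<Longrightarrow> equil_mean (W n f t) \<le> equil_mean f"
proof (induction n arbitrary: t)
  case (Suc n)
  have "equil_mean (W (Suc n) f t) \<le> ennreal (exp (- 2 * t)) * equil_mean f +
    (\<integral>\<^sup>+s. (ennreal (2 * exp (- 2 * s)) * indicator {0..t} s) * equil_mean f \<partial>lborel)"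
    unfolding equil_mean_W_Suc[OF assms Suc.prems]
    by (intro add_left_mono nn_integral_mono) (auto simp: indicator_def intro!: mult_left_mono Suc)
  also have "\<dots> = (ennreal (exp (- 2 * t)) + ennreal (1 - exp (- 2 * t))) * equil_mean f"
    using Suc.prems by (subst nn_integral_multc) (auto simp: nn_integral_exp2[simplified] distrib_right)
  also have "\<dots> = equil_mean f" using Suc.prems by (simp add: ennreal_plus[symmetric] del: ennreal_plus)
  finally show ?case .
qed (simp add: equil_mean_def)

text \<open>Under equilibrium \<open>1 - exp (- 2 * T)\<close> is the probability of a jump within
  time \<open>T\<close>, and its \<open>n\<close>-th power bounds that of \<open>n\<close> jumps.
  This crude replacement of the Poisson tail is stable under the recursion.\<close>

lemma equil_mean_W_ge:
  assumes [measurable]: "f \<in> borel_measurable borel" and T: "0 \<le> T"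
  shows "0 \<le> t \<Longrightarrow> t \<le> T \<Longrightarrow> ennreal (1 - (1 - exp (- 2 * T)) ^ n) * equil_mean f \<le> equil_mean (W n f t)"
proof (induction n arbitrary: t)
  case (Suc n)
  let ?r = "1 - exp (- 2 * T)"
  have r: "0 \<le> ?r" "?r \<le> 1" using T by auto
  have "(1 - exp (-2 * t)) * ?r ^ n \<le> ?r * ?r ^ n"
    using Suc.prems r by (intro mult_right_mono) auto
  then have "1 - ?r ^ Suc n \<le> exp (- 2 * t) + (1 - exp (- 2 * t)) * (1 - ?r ^ n)"
    by (simp add: algebra_simps)
  then have "ennreal (1 - ?r ^ Suc n) * equil_mean f \<le> ennreal (exp (- 2 * t) + (1 - exp (- 2 * t)) * (1 - ?r ^ n)) * equil_mean f"
    by (intro mult_right_mono ennreal_leI) auto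
  also have "\<dots> = (ennreal (exp (- 2 * t)) + ennreal (1 - exp (- 2 * t)) * ennreal (1 - ?r ^ n)) * equil_mean f"
    using Suc.prems r by (simp add: ennreal_mult power_le_one)
  also have "\<dots> = ennreal (exp (- 2 * t)) * equil_mean f +
    (\<integral>\<^sup>+s. (ennreal (2 * exp (- 2 * s)) * indicator {0..t} s) * (ennreal (1 - ?r ^ n) * equil_mean f) \<partial>lborel)"
    using Suc.prems by (subst nn_integral_multc) (auto simp: nn_integral_exp2[simplified] distrib_right mult.assoc)
  also have "\<dots> \<le> equil_mean (W (Suc n) f t)"
    unfolding equil_mean_W_Suc[OF assms(1) Suc.prems(1)] using Suc.prems
    by (intro add_left_mono nn_integral_mono) (auto simp: indicator_def intro!: mult_left_mono Suc.IH[simplified])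
  finally show ?case .
qed simp

text \<open>The lower bound of \<open>equil_mean_W_ge\<close> converges to the upper bound of
  \<open>equil_mean_W_le\<close>: started from equilibrium, no mass is lost by explosion.\<close>

lemma equil_mean_Q:
  assumes [measurable]: "f \<in> borel_measurable borel" and t: "0 \<le> t"
  shows "equil_mean (Q f t) = equil_mean f"
proof (rule antisym)
  have "equil_mean (Q f t) = (\<integral>\<^sup>+x. (SUP n. ennreal (C * x * L x) * W n f t x * indicator {0<..} x) \<partial>lborel)"
    unfolding equil_mean_def Q_def by (intro nn_integral_cong) (simp add: SUP_mult_left_ennreal[symmetric] indicator_def)
  also have "\<dots> = (SUP n. equil_mean (W n f t))"
    unfolding equil_mean_def using W_incseq[of _ t f] t
    by (intro nn_integral_monotone_convergence_SUP)
       (auto simp: incseq_def le_fun_def indicator_def simp del: W.simps intro!: mult_left_mono)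
  also have "\<dots> \<le> equil_mean f" using equil_mean_W_le[OF assms] by (intro SUP_least)
  finally show "equil_mean (Q f t) \<le> equil_mean f" .
  have "(\<lambda>n. ennreal (1 - (1 - exp (- 2 * t)) ^ n) * equil_mean f) \<longlonglongrightarrow> ennreal (1 - 0) * equil_mean f"
    using t by (intro tendsto_mult_ennreal tendsto_ennrealI tendsto_diff tendsto_const LIMSEQ_power_zero) auto
  moreover have "ennreal (1 - (1 - exp (- 2 * t)) ^ n) * equil_mean f \<le> equil_mean (Q f t)" for n
  proof -
    have "equil_mean (W n f t) \<le> equil_mean (Q f t)" unfolding Q_def by (intro equil_mean_mono SUP_upper UNIV_I)
    then show ?thesis using equil_mean_W_ge[OF assms t order_refl, of n] by simp
  qed
  ultimately show "equil_mean f \<le> equil_mean (Q f t)"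
    by (intro LIMSEQ_le_const2) auto
qed

text \<open>The function \<open>Q (\<lambda>_. 1) t\<close> is at most 1 and has mean 1, while the
  equilibrium density is positive on the positive half-line; so it equals 1 almost everywhere
  there.\<close>

lemma Q_one_AE:
  assumes t: "0 \<le> t"
  shows "AE x in lborel. 0 < x \<longrightarrow> Q (\<lambda>_. 1) t x = 1"
proof -
  have m [measurable]: "Q (\<lambda>_. 1) t \<in> borel_measurable borel" by measurable
  let ?f = "\<lambda>x. ennreal (C * x * L x) * Q (\<lambda>_. 1) t x * indicator {0<..} x"
  let ?g = "\<lambda>x. ennreal (C * x * L x) * indicator {0<..} x"
  have le: "?f x \<le> ?g x" for x
    using Q_le_one[of "\<lambda>_. 1" x t] t by (auto simp: indicator_def intro!: mult_left_le)
  have "(\<integral>\<^sup>+x. (?g x - ?f x) \<partial>lborel) = (\<integral>\<^sup>+x. ?g x \<partial>lborel) - (\<integral>\<^sup>+x. ?f x \<partial>lborel)"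
    using le equil_mean_Q[OF _ t, of "\<lambda>_. 1"] equil_mean_const[of 1] by (intro nn_integral_diff) (auto simp: equil_mean_def)
  also have "\<dots> = 0" using equil_mean_Q[OF _ t, of "\<lambda>_. 1"] equil_mean_const[of 1] by (simp add: equil_mean_def)
  finally have "AE x in lborel. ?g x - ?f x = 0"
    by (subst (asm) nn_integral_0_iff_AE) auto
  then show ?thesis
  proof eventually_elim
    case (elim x)
    show ?case
    proof
      assume x: "0 < x"
      let ?d = "C * x * L x"
      have d: "0 < ?d" using x C_pos L_pos[of x] by simp
      have le1: "Q (\<lambda>_. 1) t x \<le> 1" using Q_le_one[of "\<lambda>_. 1" x t] t x by auto
      then obtain r where r: "Q (\<lambda>_. 1) t x = ennreal r" "0 \<le> r" by (cases "Q (\<lambda>_. 1) t x") (auto simp: top_unique)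
      have "ennreal ?d \<le> ennreal ?d * ennreal r"
        using elim x r by (simp add: diff_eq_0_iff_ennreal)
      then have "?d \<le> ?d * r" using r d by (simp add: ennreal_mult[symmetric])
      then have "1 \<le> r" using d mult_le_cancel_left_pos[of ?d 1 r] by simp
      then show "Q (\<lambda>_. 1) t x = 1" using le1 r by (auto intro: antisym)
    qed
  qed
qed

lemma jump_mean_cong_AE:
  assumes "AE w in lborel. 0 < w \<longrightarrow> h w = h' w"
  shows "jump_mean z h = jump_mean z h'"
  unfolding jump_mean_def using assms
  by (intro nn_integral_cong_AE) (auto elim!: eventually_mono simp: indicator_def)

text \<open>The renewal equation sees \<open>Q\<close> after the first jump only through
  \<open>jump_mean\<close>, an integral against a density. Exceptional null sets are invisible to
  it, so the almost sure statement becomes one for every starting point.\<close>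

lemma Q_one:
  assumes x: "0 < x" and t: "0 \<le> t"
  shows "Q (\<lambda>_. 1) t x = 1"
proof -
  have "jump_term (Q (\<lambda>_. 1)) t x = jump_term (\<lambda>_ _. 1) t x"
    unfolding jump_term_def
  proof (rule arg_cong2[where f="(*)", OF refl nn_integral_cong])
    fix v
    show "indicator {0<..<L x} v * indicator {..x * exp t} (q v) * jump_mean (q v) (Q (\<lambda>_. 1) (t - ln (q v / x)))
      = indicator {0<..<L x} v * indicator {..x * exp t} (q v) * jump_mean (q v) (\<lambda>_. 1)"
    proof (cases "v \<in> {0<..<L x} \<and> q v \<le> x * exp t")
      case True
      then have "jump_mean (q v) (Q (\<lambda>_. 1) (t - ln (q v / x))) = jump_mean (q v) (\<lambda>_. 1)"
        using jump_term_time[OF x, of v t] by (intro jump_mean_cong_AE Q_one_AE) auto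
      then show ?thesis by simp
    qed (auto simp: indicator_def)
  qed
  then show ?thesis
    using Q_renewal[of "\<lambda>_. 1" x t] assms L_ratio[of x t]
    by (simp add: jump_term_one flow_one ennreal_plus[symmetric] del: ennreal_plus)
qed

text \<open>Homogeneity of each \<open>W n\<close> reduces this to \<open>Q_one\<close>. It later
  lets the constant function \<open>equil_mean f\<close> be evolved alongside
  \<open>f\<close>.\<close>

lemma Q_const:
  assumes x: "0 < x" and t: "0 \<le> t"
  shows "Q (\<lambda>_. c) t x = c"
proof -
  have *: "W n (\<lambda>_. c) t x = c * W n (\<lambda>_. 1) t x" for n t x
  proof (induction n arbitrary: t x)
    case (Suc n)
    have j: "jump_mean z (\<lambda>x. c * W n (\<lambda>_. 1) t x) = c * jump_mean z (W n (\<lambda>_. 1) t)" for z t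
      unfolding jump_mean_def by (subst nn_integral_cmult[symmetric]) (auto simp: mult_ac)
    have "jump_term (W n (\<lambda>_. c)) t x = jump_term (\<lambda>t x. c * W n (\<lambda>_. 1) t x) t x"
      using Suc by (auto intro!: arg_cong[where f="\<lambda>\<phi>. jump_term \<phi> t x"])
    also have "\<dots> = c * jump_term (W n (\<lambda>_. 1)) t x"
    proof -
      note [measurable] = W_measurable_aux[of "\<lambda>_. 1" n]
      have [measurable]: "Measurable.pred borel (\<lambda>v. v \<in> {0<..<L x})" "Measurable.pred borel (\<lambda>v. q v \<in> {..x * exp t})" by simp_all
      let ?i = "\<lambda>v. indicator {0<..<L x} v * indicator {..x * exp t} (q v) :: ennreal"
      have "(\<integral>\<^sup>+v. ?i v * (c * jump_mean (q v) (W n (\<lambda>_. 1) (t - ln (q v / x)))) \<partial>lborel) =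
        (\<integral>\<^sup>+v. c * (?i v * jump_mean (q v) (W n (\<lambda>_. 1) (t - ln (q v / x)))) \<partial>lborel)"
        by (simp add: mult_ac)
      also have "\<dots> = c * (\<integral>\<^sup>+v. ?i v * jump_mean (q v) (W n (\<lambda>_. 1) (t - ln (q v / x))) \<partial>lborel)"
        unfolding indicator_def by (subst nn_integral_cmult) auto
      finally show ?thesis
        unfolding jump_term_def j by (simp add: mult_ac)
    qed
    finally show ?case by (simp add: flow_def distrib_left mult_ac)
  qed simp
  show ?thesis using Q_one[OF assms] by (simp add: Q_def * SUP_mult_left_ennreal[symmetric])
qed

text \<open>The levels split at \<open>L (x * exp t)\<close>: those above give a jump by time
  \<open>t\<close>, those below are exactly the levels for a start at \<open>x * exp t\<close>,
  because \<open>q v\<close> does not depend on the starting point. This is the memorylessness of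
  the first jump.\<close>

lemma jump_term_shift:
  assumes [measurable]: "case_prod \<phi> \<in> borel_measurable (borel \<Otimes>\<^sub>M borel)" and x: "0 < x" and t: "0 \<le> t" and s: "0 \<le> s"
  shows "jump_term \<phi> (t + s) x = jump_term (\<lambda>r. \<phi> (r + s)) t x + ennreal (L (x * exp t) / L x) * jump_term \<phi> s (x * exp t)"
proof -
  note [measurable (raw)] = measurable_uncurried[OF assms(1)]
  have [measurable]: "Measurable.pred borel (\<lambda>v. v \<in> {0<..<L x})" "Measurable.pred borel (\<lambda>v. q v \<in> {..x})" for x by simp_all
  let ?y = "x * exp t"
  let ?I = "\<lambda>x t v. indicator {0<..<L x} v * indicator {..x * exp t} (q v) :: ennreal"
  have y: "0 < ?y" "x \<le> ?y" using x t by auto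
  have split: "?I x (t + s) v * jump_mean (q v) (\<phi> (t + s - ln (q v / x))) =
     ?I x t v * jump_mean (q v) (\<phi> (t - ln (q v / x) + s)) + ?I ?y s v * jump_mean (q v) (\<phi> (s - ln (q v / ?y)))" for v
  proof (cases "v \<in> {0<..<L x}")
    case False
    then show ?thesis using L_antimono[OF y(2)] by (auto simp: indicator_def)
  next
    case True
    then have qx: "x < q v" using x by (subst q_gt_iff) auto
    have le: "?y \<le> x * exp (t + s)" using x s by simp
    show ?thesis
    proof (cases "q v \<le> ?y")
      case T: True
      then have "L ?y \<le> v" using True y q_le_iff[of v ?y] by auto
      then show ?thesis using True T le by (simp add: indicator_def algebra_simps)
    next
      case F: False
      then have "v < L ?y" using True y q_gt_iff[of v ?y] by auto
      moreover have "ln (q v / ?y) = ln (q v / x) - t"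
        using qx x by (simp add: ln_div ln_mult)
      then have "s - ln (q v / ?y) = t + s - ln (q v / x)" by simp
      ultimately show ?thesis using True F by (simp add: indicator_def exp_add mult.assoc algebra_simps)
    qed
  qed
  have "jump_term \<phi> (t + s) x = ennreal (1 / L x) * ((\<integral>\<^sup>+v. ?I x t v * jump_mean (q v) (\<phi> (t - ln (q v / x) + s)) \<partial>lborel) +
     (\<integral>\<^sup>+v. ?I ?y s v * jump_mean (q v) (\<phi> (s - ln (q v / ?y))) \<partial>lborel))"
    unfolding jump_term_def split
    by (subst nn_integral_add) (auto simp: indicator_def)
  moreover have "ennreal (1 / L x) = ennreal (L ?y / L x) * ennreal (1 / L ?y)"
    using L_pos[of x] L_pos[of ?y] by (simp add: ennreal_mult[symmetric])
  ultimately show ?thesis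
    unfolding jump_term_def by (simp add: distrib_left mult.assoc)
qed

text \<open>The Markov property at the fixed time \<open>t\<close>, sorted by whether a jump has
  occurred by then.\<close>

lemma Q_shift:
  assumes [measurable]: "f \<in> borel_measurable borel" and x: "0 < x" and t: "0 \<le> t" and s: "0 \<le> s"
  shows "Q f (t + s) x = flow (Q f s) t x + jump_term (\<lambda>r. Q f (r + s)) t x"
proof -
  have y: "0 < x * exp t" using x by simp
  have "flow (Q f s) t x = ennreal (L (x * exp t) / L x) * flow f s (x * exp t) + ennreal (L (x * exp t) / L x) * jump_term (Q f) s (x * exp t)"
    unfolding flow_def[of "Q f s"] Q_renewal[OF assms(1) y s] by (simp add: distrib_left)
  moreover have "ennreal (L (x * exp t) / L x) * flow f s (x * exp t) = flow f (t + s) x"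
    unfolding flow_def mult.assoc[symmetric] exp_add
    using L_pos[of x] L_pos[of "x * exp t"] L_pos[of "x * exp t * exp s"] by (simp add: ennreal_mult[symmetric] mult.assoc[symmetric])
  ultimately show ?thesis
    using Q_renewal[of f x "t + s"] jump_term_shift[OF Q_measurable_aux[of f] x t s] x t s by (simp add: add_ac)
qed

text \<open>\<open>t \<mapsto> Q f (t + s)\<close> solves the renewal equation with initial value \<open>Q f s\<close>, of which
  \<open>Q (Q f s)\<close> is the minimal solution.\<close>

lemma Q_semigroup_le:
  assumes [measurable]: "f \<in> borel_measurable borel" and s: "0 \<le> s" and x: "0 < x" and t: "0 \<le> t"
  shows "Q (Q f s) t x \<le> Q f (t + s) x"
  unfolding Q_def[of "Q f s"]
proof (rule SUP_least)
  fix n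
  show "W n (Q f s) t x \<le> Q f (t + s) x"
    using x t
  proof (induction n arbitrary: t x)
    case (Suc n)
    have "jump_term (W n (Q f s)) t x \<le> jump_term (\<lambda>r. Q f (r + s)) t x"
      using Suc by (intro jump_term_mono) auto
    then show ?case using Suc.prems s by (simp add: Q_shift add_left_mono)
  qed simp
qed

text \<open>The inequality becomes an equality when it is applied to both \<open>f\<close> and \<open>1 - f\<close>,
  because no mass is lost.\<close>

lemma Q_semigroup:
  assumes [measurable]: "f \<in> borel_measurable borel" and f1: "\<And>x. 0 < x \<Longrightarrow> f x \<le> 1"
    and s: "0 \<le> s" and x: "0 < x" and t: "0 \<le> t"
  shows "Q f (t + s) x = Q (Q f s) t x"
proof (rule antisym)
  define f' where "f' = (\<lambda>x. 1 - f x)"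
  have [measurable]: "f' \<in> borel_measurable borel" unfolding f'_def by measurable
  have ff': "f x + f' x = 1" if "0 < x" for x unfolding f'_def using f1[OF that] by (simp add: add.commute[of "f x"] diff_add_cancel_ennreal)
  have Q1: "Q f r y + Q f' r y = 1" if "0 < y" "0 \<le> r" for r y
  proof -
    have "Q f r y + Q f' r y = Q (\<lambda>x. f x + f' x) r y" using that by (intro Q_add[symmetric]) auto
    also have "\<dots> = Q (\<lambda>_. 1) r y" using ff' that by (intro Q_cong)
    finally show ?thesis using Q_one that by simp
  qed
  have "Q (Q f s) t x + Q (Q f' s) t x = Q (\<lambda>x. Q f s x + Q f' s x) t x" using x t by (intro Q_add[symmetric]) auto
  also have "\<dots> = Q (\<lambda>_. 1) t x" using Q1 s x t by (intro Q_cong) auto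
  also have "\<dots> = 1" using Q_one x t by simp
  finally have 1: "Q (Q f s) t x + Q (Q f' s) t x = 1" .
  have fin: "Q f' (t + s) x \<noteq> \<top>" using Q1[of x "t + s"] x t s by auto
  have "Q f (t + s) x + Q f' (t + s) x = Q (Q f s) t x + Q (Q f' s) t x" using 1 Q1[of x "t + s"] x t s by simp
  also have "\<dots> \<le> Q (Q f s) t x + Q f' (t + s) x" using s x t by (intro add_left_mono Q_semigroup_le) auto
  finally show "Q f (t + s) x \<le> Q (Q f s) t x" using fin by (simp add: add.commute[of _ "Q f' (t + s) x"] ennreal_add_left_cancel_le)
qed (use assms in \<open>auto intro!: Q_semigroup_le\<close>)

end

section \<open>Convergence of the semigroup\<close>

lemma pos_distribution_compact:
  assumes \<nu>: "pos_distribution \<nu>" and \<epsilon>: "0 < \<epsilon>"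
  obtains a b where "0 < a" "a \<le> b" "measure \<nu> (UNIV - {a..b}) < \<epsilon>"
proof -
  interpret prob_space \<nu> using \<nu> by (simp add: pos_distribution_def)
  have sets_\<nu> [measurable_cong, simp]: "sets \<nu> = sets borel" using \<nu> by (simp add: pos_distribution_def)
  have sp [simp]: "space \<nu> = UNIV" using sets_eq_imp_space_eq[of \<nu> borel] by simp
  let ?A = "\<lambda>n. {1 / real (Suc n)..real (Suc n)}"
  have inc: "incseq ?A" by (auto simp: incseq_def le_fun_def frac_le intro: order_trans)
  have "(\<Union>n. ?A n) = {0<..}"
  proof (intro antisym subsetI)
    fix x :: real assume x: "x \<in> {0<..}"
    obtain n where n: "1 / x \<le> real n" using real_arch_simple by blast
    obtain m where m: "x \<le> real m" using real_arch_simple by blast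
    have "1 / x \<le> real (Suc (n + m))" using n by simp
    then have "1 / real (Suc (n + m)) \<le> x" using x by (simp add: field_simps)
    then show "x \<in> (\<Union>n. ?A n)" using m by (intro UN_I[of "n + m"]) auto
  qed (auto intro: less_le_trans[of 0 "1 / real (Suc n)" for n])
  then have "(\<lambda>n. measure \<nu> (?A n)) \<longlonglongrightarrow> measure \<nu> {0<..}"
    using finite_Lim_measure_incseq[OF _ inc] by (simp only: sets_\<nu> image_subset_iff) simp
  moreover have "measure \<nu> {0<..} = 1" using \<nu> by (simp add: pos_distribution_def measure_def)
  ultimately have "\<forall>\<^sub>F n in sequentially. 1 - \<epsilon> < measure \<nu> (?A n)"
    using \<epsilon> by (auto simp: order_tendsto_iff)
  then obtain n where "1 - \<epsilon> < measure \<nu> (?A n)" using eventually_happens'[OF sequentially_bot] by blast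
  then have "measure \<nu> (UNIV - ?A n) < \<epsilon>" using prob_compl[of "?A n"] by simp
  moreover have "1 / real (Suc n) \<le> real (Suc n)" by (simp add: field_simps)
  ultimately show ?thesis by (intro that[of "1 / real (Suc n)" "real (Suc n)"]) auto
qed

section \<open>Upper and lower bounds for the transition kernel, and the contraction\<close>

context growth_jump
begin

definition equil :: "real measure" where
  "equil = density lborel (\<lambda>x. ennreal (C * x * L x) * indicator {0<..} x)"

lemma sets_equil [measurable_cong, simp]: "sets equil = sets borel" and space_equil [simp]: "space equil = UNIV"
  by (simp_all add: equil_def)

lemma emeasure_equil: "A \<in> sets borel \<Longrightarrow> emeasure equil A = equil_mean (indicator A)"
  unfolding equil_def equil_mean_def by (subst emeasure_density) (auto intro!: nn_integral_cong simp: mult_ac)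

lemma pos_distribution_equil: "pos_distribution equil"
proof -
  have "emeasure equil {0<..} = 1"
    using equil_mean_cong[of "indicator {0<..}" "\<lambda>_. 1"] equil_mean_const[of 1] by (simp add: emeasure_equil)
  moreover have "emeasure equil UNIV = 1"
    using equil_mean_const[of 1] equil_mean_cong[of "indicator UNIV" "\<lambda>_. 1"] by (simp add: emeasure_equil)
  ultimately show ?thesis
    by (auto simp: pos_distribution_def intro!: prob_spaceI)
qed

text \<open>The jump positions are averaged with total weight
  \<open>jump_term (\<lambda>_ _. 1) t x\<close>, the probability of a jump by time
  \<open>t\<close>; a bound uniform in the position gets this weight as a factor.\<close>

lemma jump_term_ge:
  assumes "0 < x" "0 \<le> t" "\<And>v. v \<in> {0<..<L x} \<Longrightarrow> q v \<le> x * exp t \<Longrightarrow> D \<le> jump_mean (q v) (\<phi> (t - ln (q v / x)))"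
  shows "D * jump_term (\<lambda>_ _. 1) t x \<le> jump_term \<phi> t x"
proof -
  let ?I = "\<lambda>v. indicator {0<..<L x} v * indicator {..x * exp t} (q v) :: ennreal"
  have "D * jump_term (\<lambda>_ _. 1) t x = ennreal (1 / L x) * (\<integral>\<^sup>+v. D * (?I v * jump_mean (q v) (\<lambda>_. 1)) \<partial>lborel)"
    unfolding jump_term_def by (subst nn_integral_cmult) (auto simp: indicator_def mult_ac)
  also have "\<dots> \<le> jump_term \<phi> t x"
    unfolding jump_term_def
  proof (rule mult_left_mono[OF nn_integral_mono])
    fix v
    show "D * (?I v * jump_mean (q v) (\<lambda>_. 1)) \<le> ?I v * jump_mean (q v) (\<phi> (t - ln (q v / x)))"
      using jump_term_time[of x v t] assms(1) assms(3)[of v] by (auto simp: indicator_def jump_mean_one)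
  qed simp
  finally show ?thesis .
qed

lemma jump_term_le:
  assumes "0 < x" "0 \<le> t" "\<And>v. v \<in> {0<..<L x} \<Longrightarrow> q v \<le> x * exp t \<Longrightarrow> jump_mean (q v) (\<phi> (t - ln (q v / x))) \<le> D"
  shows "jump_term \<phi> t x \<le> D"
proof -
  let ?I = "\<lambda>v. indicator {0<..<L x} v * indicator {..x * exp t} (q v) :: ennreal"
  have "jump_term \<phi> t x \<le> ennreal (1 / L x) * (\<integral>\<^sup>+v. D * (?I v * jump_mean (q v) (\<lambda>_. 1)) \<partial>lborel)"
    unfolding jump_term_def
  proof (rule mult_left_mono[OF nn_integral_mono])
    fix v
    show "?I v * jump_mean (q v) (\<phi> (t - ln (q v / x))) \<le> D * (?I v * jump_mean (q v) (\<lambda>_. 1))"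
      using jump_term_time[of x v t] assms(1) assms(3)[of v] by (auto simp: indicator_def jump_mean_one)
  qed simp
  also have "\<dots> = D * jump_term (\<lambda>_ _. 1) t x"
    unfolding jump_term_def by (subst nn_integral_cmult) (auto simp: indicator_def mult_ac)
  also have "\<dots> \<le> D"
    using jump_term_one[of x t] L_ratio[of x t] assms(1,2) by (intro mult_left_le) auto
  finally show ?thesis .
qed

text \<open>Jump positions \<open>z\<close> lie between \<open>a\<close> and
  \<open>b * exp T\<close>, so the landing density \<open>2 * w / z\<^sup>2\<close> is at most
  \<open>2 * w / a\<^sup>2\<close>, and \<open>L w\<close> is at least \<open>L (b * exp T)\<close>
  there: the landing law is dominated by \<open>c\<close> times the equilibrium. Invariance makes
  the bound independent of the remaining time.\<close>

lemma Q_le_flow_plus_equil_mean: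
  assumes a: "0 < a" and T: "0 \<le> T"
  obtains c :: real where "0 < c"
    "\<And>f x. f \<in> borel_measurable borel \<Longrightarrow> x \<in> {a..b} \<Longrightarrow> Q f T x \<le> flow f T x + ennreal c * equil_mean f"
proof
  define c where "c = 2 / (C * a\<^sup>2 * L (b * exp T))"
  show c: "0 < c" unfolding c_def using C_pos L_pos a by simp
  fix f :: "real \<Rightarrow> ennreal" and x assume [measurable]: "f \<in> borel_measurable borel" and x: "x \<in> {a..b}"
  have x0: "0 < x" using x a by simp
  have "jump_term (Q f) T x \<le> ennreal c * equil_mean f"
  proof (rule jump_term_le[OF x0 T])
    fix v assume v: "v \<in> {0<..<L x}" "q v \<le> x * exp T"
    note g = jump_term_time[OF x0 v]
    let ?r = "T - ln (q v / x)"
    have zb: "q v \<le> b * exp T" using v x by (auto intro: order_trans)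
    have "jump_mean (q v) (Q f ?r) \<le> ennreal c * equil_mean (Q f ?r)"
      unfolding jump_mean_def equil_mean_def
    proof (subst nn_integral_cmult[symmetric], measurable, rule nn_integral_mono)
      fix w
      have "2 * w / (q v)\<^sup>2 \<le> c * (C * w * L w)" if w: "0 < w" "w < q v"
      proof -
        have "2 * w / (q v)\<^sup>2 \<le> 2 * w / a\<^sup>2"
          using w a x g by (intro divide_left_mono power_mono mult_pos_pos) auto
        also have "\<dots> = c * (C * w * L (b * exp T))" unfolding c_def using C_pos L_pos[of "b * exp T"] a by (simp add: field_simps)
        also have "\<dots> \<le> c * (C * w * L w)" using c C_pos w zb by (intro mult_left_mono L_antimono) auto
        finally show ?thesis .
      qed
      then have "ennreal (2 * w / (q v)\<^sup>2) \<le> ennreal c * ennreal (C * w * L w)" if "0 < w" "w < q v"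
        using that c C_pos L_pos[of w] by (simp add: ennreal_mult[symmetric] ennreal_leI)
      then show "ennreal (2 * w / (q v)\<^sup>2) * Q f ?r w * indicator {0<..<q v} w \<le> ennreal c * (ennreal (C * w * L w) * Q f ?r w * indicator {0<..} w)"
        by (auto simp: indicator_def mult.assoc[symmetric] intro!: mult_right_mono)
    qed
    also have "equil_mean (Q f ?r) = equil_mean f" using g by (intro equil_mean_Q) auto
    finally show "jump_mean (q v) (Q f ?r) \<le> ennreal c * equil_mean f" .
  qed
  then show "Q f T x \<le> flow f T x + ennreal c * equil_mean f"
    by (subst Q_renewal[OF _ x0 T]) (auto intro: add_left_mono)
qed

text \<open>Following a jump that leads from \<open>z\<close> to the random point \<open>w\<close>, growth up to a fixed time takes \<open>w\<close> to \<open>w \<theta>\<close>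
  where \<open>z \<theta>\<close> does not depend on the jump time; hence the one-jump part of the transition kernel has
  a density bounded below by a multiple of the equilibrium density.\<close>

lemma jump_mean_flow_ge:
  assumes [measurable]: "p \<in> borel_measurable borel" and z: "0 < z" and s: "0 \<le> s" and b: "b < z * exp s" "0 < a" "a \<le> b"
  shows "ennreal (2 / (C * (z * exp s)\<^sup>2)) * equil_mean (\<lambda>y. p y * indicator {a..b} y) \<le> jump_mean z (flow p s)"
proof -
  let ?\<theta> = "exp s"
  let ?h = "\<lambda>y. ennreal (2 / (C * (z * ?\<theta>)\<^sup>2)) * (ennreal (C * y * L y) * (p y * indicator {a..b} y) * indicator {0<..} y)"
  have "ennreal (2 / (C * (z * exp s)\<^sup>2)) * equil_mean (\<lambda>y. p y * indicator {a..b} y) = (\<integral>\<^sup>+y. ?h y \<partial>lborel)"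
    unfolding equil_mean_def by (subst nn_integral_cmult) auto
  also have "\<dots> = (\<integral>\<^sup>+w. ennreal ?\<theta> * ?h (?\<theta> * w) \<partial>lborel)"
    by (subst nn_integral_real_affine[where c="?\<theta>" and t=0]) (auto simp: nn_integral_cmult)
  also have "\<dots> \<le> jump_mean z (flow p s)"
    unfolding jump_mean_def
  proof (rule nn_integral_mono)
    fix w
    show "ennreal ?\<theta> * ?h (?\<theta> * w) \<le> ennreal (2 * w / z\<^sup>2) * flow p s w * indicator {0<..<z} w"
    proof (cases "?\<theta> * w \<in> {a..b}")
      case True
      then have "0 < w * ?\<theta>" "w * ?\<theta> < z * ?\<theta>" using b unfolding mult.commute[of ?\<theta>] atLeastAtMost_iff by linarith+
      then have w: "0 < w" "w < z" using mult_less_cancel_right_pos[of ?\<theta> w z] by (simp_all add: zero_less_mult_iff)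
      have "ennreal ?\<theta> * (ennreal (2 / (C * (z * ?\<theta>)\<^sup>2)) * ennreal (C * (?\<theta> * w) * L (?\<theta> * w))) =
        ennreal (?\<theta> * (2 / (C * (z * ?\<theta>)\<^sup>2) * (C * (?\<theta> * w) * L (?\<theta> * w))))"
      proof -
        have "ennreal x * (ennreal y * ennreal u) = ennreal (x * (y * u))" if "0 \<le> x" "0 \<le> y" "0 \<le> u" for x y u
          using that by (simp add: ennreal_mult)
        then show ?thesis using w C_pos z L_pos[of "?\<theta> * w"] by simp
      qed
      also have "?\<theta> * (2 / (C * (z * ?\<theta>)\<^sup>2) * (C * (?\<theta> * w) * L (?\<theta> * w))) = 2 * w / z\<^sup>2 * L (?\<theta> * w)"
        using C_pos z by (simp add: field_simps power2_eq_square)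
      \<comment> \<open>The survival ratio is bounded below by its numerator, as
        \<open>L w \<le> 1\<close>; what is left is the equilibrium density at
        \<open>?\<theta> * w\<close>.\<close>
      also have "ennreal (2 * w / z\<^sup>2 * L (?\<theta> * w)) \<le> ennreal (2 * w / z\<^sup>2 * (L (?\<theta> * w) / L w))"
        using w L_pos[of w] L_pos[of "?\<theta> * w"] L_le1[of w] by (intro ennreal_leI mult_left_mono) (auto simp: field_simps)
      also have "\<dots> = ennreal (2 * w / z\<^sup>2) * ennreal (L (?\<theta> * w) / L w)"
        using w L_pos[of w] L_pos[of "?\<theta> * w"] by (simp add: ennreal_mult[symmetric])
      finally have "ennreal ?\<theta> * (ennreal (2 / (C * (z * ?\<theta>)\<^sup>2)) * ennreal (C * (?\<theta> * w) * L (?\<theta> * w))) * p (?\<theta> * w) \<le>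
        ennreal (2 * w / z\<^sup>2) * ennreal (L (?\<theta> * w) / L w) * p (?\<theta> * w)"
        by (intro mult_right_mono) auto
      then show ?thesis using True w by (simp add: flow_def mult.assoc mult.commute[of w])
    next
      case False
      then have "indicator {a..b} (?\<theta> * w) = (0::ennreal)" by simp
      then show ?thesis by (simp only: mult_zero_right mult_zero_left zero_le)
    qed
  qed
  finally show ?thesis .
qed

text \<open>If the jump is at \<open>q v\<close>, growth for the remaining time would take
  \<open>q v\<close> to \<open>x * exp T\<close>, whatever \<open>v\<close> is. The bound of
  \<open>jump_mean_flow_ge\<close> is therefore uniform over the jump positions and is multiplied by
  the probability of a jump by time \<open>T\<close>.\<close>

lemma Q_minorization:
  assumes a: "0 < a" and ab: "a \<le> b"
  obtains T \<delta> :: real where "0 \<le> T" "0 < \<delta>"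
    "\<And>p x. p \<in> borel_measurable borel \<Longrightarrow> x \<in> {a..b} \<Longrightarrow> ennreal \<delta> * equil_mean (\<lambda>y. p y * indicator {a..b} y) \<le> Q p T x"
proof -
  have "filterlim (\<lambda>T. a * exp T) at_top at_top"
    using a by (intro filterlim_tendsto_pos_mult_at_top[OF tendsto_const] exp_at_top)
  then have "((\<lambda>T. L (a * exp T)) \<longlongrightarrow> 0) at_top"
    by (rule filterlim_compose[OF L_lim])
  \<comment> \<open>This choice serves two ends: from every point of \<open>[a, b]\<close> a jump
    occurs by time \<open>T\<close> with probability at least 1/2, and \<open>a * exp T\<close>
    exceeds \<open>b\<close>.\<close>
  then have "\<forall>\<^sub>F T in at_top. L (a * exp T) < L b / 2"
    by (rule order_tendstoD) (simp add: L_pos)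
  then have "\<forall>\<^sub>F T in at_top. L (a * exp T) < L b / 2 \<and> 0 \<le> T"
    using eventually_ge_at_top by eventually_elim auto
  then obtain T where T: "L (a * exp T) < L b / 2" "0 \<le> T"
    using eventually_happens'[OF trivial_limit_at_top_linorder] by blast
  have baT: "b < a * exp T"
  proof (rule ccontr)
    assume "\<not> b < a * exp T"
    then have "L b \<le> L (a * exp T)" by (intro L_antimono) auto
    then show False using T(1) L_pos[of b] by simp
  qed
  \<comment> \<open>This is half of the density bound \<open>2 / (C * (b * exp T)\<^sup>2)\<close>,
    the half being the lower bound for the jump probability.\<close>
  define \<delta> where "\<delta> = 1 / (C * (b * exp T)\<^sup>2)"
  have \<delta>: "0 < \<delta>" unfolding \<delta>_def using C_pos a ab by simp
  have "ennreal \<delta> * equil_mean (\<lambda>y. p y * indicator {a..b} y) \<le> Q p T x"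
    if [measurable]: "p \<in> borel_measurable borel" and x: "x \<in> {a..b}" for p x
  proof -
    have x0: "0 < x" using x a by simp
    let ?P = "equil_mean (\<lambda>y. p y * indicator {a..b} y)"
    \<comment> \<open>Only the paths with exactly one jump by time \<open>T\<close> are
      kept.\<close>
    have "ennreal (2 / (C * (x * exp T)\<^sup>2)) * ?P * jump_term (\<lambda>_ _. 1) T x \<le> jump_term (flow p) T x"
    proof (rule jump_term_ge[OF x0 T(2)])
      fix v assume v: "v \<in> {0<..<L x}" "q v \<le> x * exp T"
      note g = jump_term_time[OF x0 v]
      have eq: "q v * exp (T - ln (q v / x)) = x * exp T"
        using g x0 by (simp add: exp_diff)
      have "a * exp T \<le> x * exp T" using x by simp
      then have "b < x * exp T" using baT by linarith
      then show "ennreal (2 / (C * (x * exp T)\<^sup>2)) * ?P \<le> jump_mean (q v) (flow p (T - ln (q v / x)))"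
        using jump_mean_flow_ge[of p "q v" "T - ln (q v / x)" b a] g baT a ab unfolding eq by auto
    qed
    also have "\<dots> \<le> jump_term (W 1 p) T x"
      using x0 by (intro jump_term_mono) (auto)
    also have "\<dots> \<le> W (Suc 1) p T x" by simp
    also have "\<dots> \<le> Q p T x" unfolding Q_def by (rule SUP_upper) simp
    finally have 1: "ennreal (2 / (C * (x * exp T)\<^sup>2)) * ?P * jump_term (\<lambda>_ _. 1) T x \<le> Q p T x" .
    have "L (x * exp T) \<le> L (a * exp T)" using x by (intro L_antimono) simp
    moreover have "L b \<le> L x" using x by (intro L_antimono) simp
    ultimately have "L (x * exp T) \<le> L x / 2" using T(1) by linarith
    then have half: "1 / 2 \<le> 1 - L (x * exp T) / L x" using L_pos[of x] by (simp add: field_simps)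
    have sq: "(x * exp T)\<^sup>2 \<le> (b * exp T)\<^sup>2" using x x0 by (intro power_mono mult_right_mono) auto
    have "\<delta> = 2 / (C * (b * exp T)\<^sup>2) * (1 / 2)" unfolding \<delta>_def by simp
    also have "\<dots> \<le> 2 / (C * (x * exp T)\<^sup>2) * (1 - L (x * exp T) / L x)"
      using C_pos x0 a ab sq half by (intro mult_mono divide_left_mono mult_left_mono mult_pos_pos) auto
    finally have "ennreal \<delta> \<le> ennreal (2 / (C * (x * exp T)\<^sup>2)) * jump_term (\<lambda>_ _. 1) T x"
    proof -
      have "0 \<le> 2 / (C * (x * exp T)\<^sup>2)" using C_pos by simp
      then show "\<delta> \<le> 2 / (C * (x * exp T)\<^sup>2) * (1 - L (x * exp T) / L x) \<Longrightarrow> ?thesis"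
        unfolding jump_term_one[OF x0 T(2)] using order_trans[OF _ half, of 0] by (subst ennreal_mult[symmetric]) (auto intro: ennreal_leI)
    qed
    then have "ennreal \<delta> * ?P \<le> ennreal (2 / (C * (x * exp T)\<^sup>2)) * jump_term (\<lambda>_ _. 1) T x * ?P"
      by (rule mult_right_mono) simp
    also have "\<dots> \<le> Q p T x" using 1 by (simp add: mult_ac)
    finally show ?thesis .
  qed
  then show ?thesis using that[OF T(2) \<delta>] by blast
qed

text \<open>The remainder \<open>p'\<close> has smaller mean, and the subtracted part depends on \<open>p\<close> only
  through its mean \<open>a\<close>.\<close>

lemma Q_subtract_step:
  fixes p :: "real \<Rightarrow> ennreal" and a \<delta> \<epsilon> k T :: real
  assumes [measurable]: "p \<in> borel_measurable borel" "K \<in> sets borel" and T: "0 \<le> T" and K0: "K \<subseteq> {0<..}"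
    and minor: "\<And>x. x \<in> K \<Longrightarrow> ennreal \<delta> * equil_mean (\<lambda>y. p y * indicator K y) \<le> Q p T x"
    and p1: "\<And>x. 0 < x \<Longrightarrow> p x \<le> 1" and a: "equil_mean p = ennreal a" "0 \<le> a" and \<delta>: "0 < \<delta>" and \<epsilon>: "0 \<le> \<epsilon>"
    and K\<epsilon>: "equil_mean (indicator (- K)) \<le> ennreal \<epsilon>" and k: "equil_mean (indicator K) = ennreal k" "0 \<le> k"
    and \<eta>: "\<eta> = max 0 (\<delta> * (a - \<epsilon>))"
  obtains p' where "p' \<in> borel_measurable borel" "\<And>x. 0 < x \<Longrightarrow> p' x \<le> 1"
    "\<And>x. 0 < x \<Longrightarrow> Q p T x = p' x + ennreal \<eta> * indicator K x"
    "equil_mean p' = ennreal (a - \<eta> * k)" "\<eta> * k \<le> a"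
proof
  let ?p = "\<lambda>x. Q p T x - ennreal \<eta> * indicator K x"
  have \<eta>0: "0 \<le> \<eta>" using \<eta> by simp
  \<comment> \<open>As \<open>p \<le> 1\<close>, restricting it to \<open>K\<close> costs at most
    \<epsilon> of its mean. This is why the contraction works on the excess
    \<open>a - \<epsilon>\<close>.\<close>
  have "equil_mean p \<le> equil_mean (\<lambda>x. p x * indicator K x + indicator (- K) x)"
    using p1 by (intro equil_mean_mono) (auto simp: indicator_def)
  also have "\<dots> = equil_mean (\<lambda>x. p x * indicator K x) + equil_mean (indicator (- K))"
    by (intro equil_mean_add) auto
  also have "\<dots> \<le> equil_mean (\<lambda>x. p x * indicator K x) + ennreal \<epsilon>" using K\<epsilon> by (rule add_left_mono)
  finally have "ennreal a - ennreal \<epsilon> \<le> equil_mean (\<lambda>x. p x * indicator K x)"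
    using a by (simp add: ennreal_minus_le_iff add.commute)
  then have "ennreal \<delta> * ennreal (a - \<epsilon>) \<le> ennreal \<delta> * equil_mean (\<lambda>x. p x * indicator K x)"
    using \<epsilon> by (intro mult_left_mono) (auto simp: ennreal_minus)
  then have "ennreal \<eta> \<le> ennreal \<delta> * equil_mean (\<lambda>x. p x * indicator K x)"
    unfolding \<eta> using \<delta> by (cases "a \<le> \<epsilon>") (auto simp: max_def ennreal_mult'[symmetric] mult_le_0_iff zero_le_mult_iff ennreal_neg)
  then have le: "ennreal \<eta> * indicator K x \<le> Q p T x" for x
    using minor[of x] by (auto simp: indicator_def)
  show "?p \<in> borel_measurable borel" by measurable
  show "?p x \<le> 1" if "0 < x" for x
    using Q_le_one[of p x T] p1 that T by (auto intro: order_trans[OF diff_le_self_ennreal])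
  show eq: "Q p T x = ?p x + ennreal \<eta> * indicator K x" for x
    using le[of x] by (simp add: diff_add_cancel_ennreal)
  have "ennreal a = equil_mean (Q p T)" using a T by (simp add: equil_mean_Q)
  also have "\<dots> = equil_mean (\<lambda>x. ?p x + ennreal \<eta> * indicator K x)" using eq by (intro equil_mean_cong)
  also have "\<dots> = equil_mean ?p + ennreal (\<eta> * k)"
    using k \<eta>0 by (subst equil_mean_add) (auto simp: equil_mean_cmult ennreal_mult)
  finally have sum: "ennreal a = equil_mean ?p + ennreal (\<eta> * k)" .
  then have "ennreal (\<eta> * k) \<le> ennreal a" by simp
  then show le': "\<eta> * k \<le> a" using a by (simp add: ennreal_le_iff)
  show "equil_mean ?p = ennreal (a - \<eta> * k)"
    using sum \<eta>0 k by (simp add: ennreal_minus[symmetric])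
qed

text \<open>Instead of the signed difference between \<open>Q f\<close> and its mean, two
  non-negative functions \<open>p\<close> and \<open>g\<close> with a common remainder
  \<open>r\<close> are evolved. Their means agree, so \<open>Q_subtract_step\<close> removes the
  same multiple of \<open>indicator K\<close> from both, and it can be moved into
  \<open>r\<close>.\<close>

lemma Q_contraction:
  fixes \<epsilon> :: real
  assumes [measurable]: "K \<in> sets borel" and T: "0 \<le> T" and K0: "K \<subseteq> {0<..}" and \<delta>: "0 < \<delta>" and \<epsilon>: "0 \<le> \<epsilon>"
    and minor: "\<And>x p. p \<in> borel_measurable borel \<Longrightarrow> x \<in> K \<Longrightarrow> ennreal \<delta> * equil_mean (\<lambda>y. p y * indicator K y) \<le> Q p T x"
    and K\<epsilon>: "equil_mean (indicator (- K)) \<le> ennreal \<epsilon>" and k: "equil_mean (indicator K) = ennreal k" "0 \<le> k"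
    and \<kappa>: "\<delta> * k \<le> 1"
    and f [measurable]: "f \<in> borel_measurable borel" and f1: "\<And>x. 0 < x \<Longrightarrow> f x \<le> 1"
  shows "\<exists>p g r. p \<in> borel_measurable borel \<and> g \<in> borel_measurable borel \<and> r \<in> borel_measurable borel \<and>
    (\<forall>x>0. Q f (real n * T) x = p x + r x \<and> equil_mean f = g x + r x \<and> p x \<le> 1 \<and> g x \<le> 1) \<and>
    (\<exists>a. equil_mean p = ennreal a \<and> equil_mean g = ennreal a \<and> 0 \<le> a \<and> a \<le> \<epsilon> + (1 - \<delta> * k) ^ n)"
proof (induction n)
  case 0
  have c1: "equil_mean f \<le> 1" using equil_mean_mono[of f "\<lambda>_. 1"] f1 equil_mean_const[of 1] by simp
  then obtain c where c: "equil_mean f = ennreal c" "0 \<le> c" by (cases "equil_mean f") (auto simp: top_unique)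
  have "c \<le> 1" using c c1 by simp
  then show ?case
  proof -
    have "\<forall>x>0. Q f (real 0 * T) x = Q f 0 x + 0 \<and> equil_mean f = equil_mean f + 0 \<and> Q f 0 x \<le> 1 \<and> equil_mean f \<le> 1"
      using c1 f1 by (auto intro!: Q_le_one)
    moreover have "equil_mean (Q f 0) = ennreal c" "equil_mean (\<lambda>_. equil_mean f) = ennreal c" using c by (simp_all add: equil_mean_Q equil_mean_const)
    moreover have "c \<le> \<epsilon> + (1 - \<delta> * k) ^ 0" using \<epsilon> \<open>c \<le> 1\<close> by simp
    moreover have "Q f 0 \<in> borel_measurable borel" by measurable
    ultimately show ?thesis using c(2)
      by - (rule exI[of _ "Q f 0"], rule exI[of _ "\<lambda>_. equil_mean f"], rule exI[of _ "\<lambda>_. 0"], auto)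
  qed
next
  case (Suc n)
  then obtain p g r a where [measurable]: "p \<in> borel_measurable borel" "g \<in> borel_measurable borel" "r \<in> borel_measurable borel"
    and eq: "\<And>x. 0 < x \<Longrightarrow> Q f (real n * T) x = p x + r x" "\<And>x. 0 < x \<Longrightarrow> equil_mean f = g x + r x"
    and le: "\<And>x. 0 < x \<Longrightarrow> p x \<le> 1" "\<And>x. 0 < x \<Longrightarrow> g x \<le> 1"
    and a: "equil_mean p = ennreal a" "equil_mean g = ennreal a" "0 \<le> a" and a_le: "a \<le> \<epsilon> + (1 - \<delta> * k) ^ n"
    by blast
  define \<eta> where "\<eta> = max 0 (\<delta> * (a - \<epsilon>))"
  have mp: "p \<in> borel_measurable borel" and mg: "g \<in> borel_measurable borel" by measurable
  obtain p' where p': "p' \<in> borel_measurable borel" "\<And>x. 0 < x \<Longrightarrow> p' x \<le> 1"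
    "\<And>x. 0 < x \<Longrightarrow> Q p T x = p' x + ennreal \<eta> * indicator K x"
    "equil_mean p' = ennreal (a - \<eta> * k)" "\<eta> * k \<le> a"
    by (rule Q_subtract_step[OF mp assms(1) T K0 minor[OF mp] le(1) a(1,3) \<delta> \<epsilon> K\<epsilon> k \<eta>_def]) (assumption | rule that)+
  obtain g' where g': "g' \<in> borel_measurable borel" "\<And>x. 0 < x \<Longrightarrow> g' x \<le> 1"
    "\<And>x. 0 < x \<Longrightarrow> Q g T x = g' x + ennreal \<eta> * indicator K x"
    "equil_mean g' = ennreal (a - \<eta> * k)" "\<eta> * k \<le> a"
    by (rule Q_subtract_step[OF mg assms(1) T K0 minor[OF mg] le(2) a(2,3) \<delta> \<epsilon> K\<epsilon> k \<eta>_def]) (assumption | rule that)+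
  let ?r = "\<lambda>x. ennreal \<eta> * indicator K x + Q r T x"
  have 1: "Q f (real (Suc n) * T) x = p' x + ?r x" if x: "0 < x" for x
  proof -
    have "Q f (real (Suc n) * T) x = Q f (T + real n * T) x" by (simp add: algebra_simps)
    also have "\<dots> = Q (Q f (real n * T)) T x" using f1 T x by (intro Q_semigroup) auto
    also have "\<dots> = Q (\<lambda>x. p x + r x) T x" using eq T x by (intro Q_cong) auto
    also have "\<dots> = Q p T x + Q r T x" using T x by (intro Q_add) auto
    finally show ?thesis using p'(3)[OF x] by (simp add: add.assoc)
  qed
  have 2: "equil_mean f = g' x + ?r x" if x: "0 < x" for x
  proof -
    \<comment> \<open>A constant is fixed by the semigroup, so its decomposition into
      \<open>g\<close> and \<open>r\<close> can be evolved as well.\<close>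
    have "equil_mean f = Q (\<lambda>_. equil_mean f) T x" using x T by (simp add: Q_const)
    also have "\<dots> = Q (\<lambda>x. g x + r x) T x" using T x by (intro Q_cong eq(2)) auto
    also have "\<dots> = Q g T x + Q r T x" using T x by (intro Q_add) auto
    finally show ?thesis using g'(3)[OF x] by (simp add: add.assoc)
  qed
  \<comment> \<open>Above the threshold \<epsilon> the excess \<open>a - \<epsilon>\<close> shrinks
    by the factor \<open>1 - \<delta> * k\<close>; below it nothing is subtracted and the bound
    holds already.\<close>
  have "a - \<eta> * k \<le> \<epsilon> + (1 - \<delta> * k) ^ Suc n"
  proof (cases "\<epsilon> \<le> a")
    case True
    then have "a - \<eta> * k = \<epsilon> + (1 - \<delta> * k) * (a - \<epsilon>)" using \<delta> by (simp add: \<eta>_def algebra_simps)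
    also have "\<dots> \<le> \<epsilon> + (1 - \<delta> * k) * (1 - \<delta> * k) ^ n" using \<kappa> a_le by (intro add_left_mono mult_left_mono) auto
    finally show ?thesis by simp
  next
    case False
    then have "\<eta> = 0" using \<delta> by (simp add: \<eta>_def mult_le_0_iff max_def zero_le_mult_iff)
    moreover have "0 \<le> (1 - \<delta> * k) ^ Suc n" using \<kappa> by simp
    ultimately show ?thesis using False by (simp del: power_Suc)
  qed
  then have "\<exists>a. equil_mean p' = ennreal a \<and> equil_mean g' = ennreal a \<and> 0 \<le> a \<and> a \<le> \<epsilon> + (1 - \<delta> * k) ^ Suc n"
    using p'(4,5) g'(4) by (intro exI[of _ "a - \<eta> * k"] conjI) (simp_all del: power_Suc)
  moreover have "?r \<in> borel_measurable borel" by measurable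
  moreover have "\<forall>x>0. Q f (real (Suc n) * T) x = p' x + ?r x \<and> equil_mean f = g' x + ?r x \<and> p' x \<le> 1 \<and> g' x \<le> 1"
    using 1 2 p'(2) g'(2) by blast
  ultimately show ?case using p'(1) g'(1) by blast
qed

text \<open>Contraction makes the equilibrium mean of the excess small, and one further period
  \<open>T0\<close> turns this into a bound at each point of \<open>[a, b]\<close>. The compact set
  of the contraction is chosen from the equilibrium and is unrelated to
  \<open>[a, b]\<close>.\<close>

theorem Q_converges:
  assumes a: "0 < a" "a \<le> b" and \<epsilon>: "0 < \<epsilon>"
  obtains t0 :: real where "0 \<le> t0"
    "\<And>f t x. f \<in> borel_measurable borel \<Longrightarrow> (\<And>x. 0 < x \<Longrightarrow> f x \<le> 1) \<Longrightarrow> t0 \<le> t \<Longrightarrow> x \<in> {a..b} \<Longrightarrow>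
      Q f t x \<le> equil_mean f + ennreal \<epsilon>"
proof -
  have "filterlim (\<lambda>T. a * exp T) at_top at_top"
    using a by (intro filterlim_tendsto_pos_mult_at_top[OF tendsto_const] exp_at_top)
  then have "((\<lambda>T. L (a * exp T)) \<longlongrightarrow> 0) at_top"
    by (rule filterlim_compose[OF L_lim])
  \<comment> \<open>Half of the error is reserved for the paths from \<open>[a, b]\<close> that do
    not jump by time \<open>T0\<close>.\<close>
  then have "\<forall>\<^sub>F T in at_top. L (a * exp T) < L b * (\<epsilon> / 2)"
    by (rule order_tendstoD) (simp add: L_pos \<epsilon>)
  then have "\<forall>\<^sub>F T in at_top. L (a * exp T) < L b * (\<epsilon> / 2) \<and> 0 \<le> T"
    using eventually_ge_at_top by eventually_elim auto
  then obtain T0 where T0: "L (a * exp T0) < L b * (\<epsilon> / 2)" "0 \<le> T0"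
    using eventually_happens'[OF trivial_limit_at_top_linorder] by blast
  obtain c where c: "0 < c" "\<And>f x. f \<in> borel_measurable borel \<Longrightarrow> x \<in> {a..b} \<Longrightarrow> Q f T0 x \<le> flow f T0 x + ennreal c * equil_mean f"
    using Q_le_flow_plus_equil_mean[OF a(1) T0(2)] by blast
  \<comment> \<open>After contraction the mean is at most \<open>2 * \<epsilon>'\<close>, which the
    domination constant \<open>c\<close> may enlarge to \<epsilon>/2; the cap 1/2 keeps the mass
    \<open>k\<close> of the compact set away from 0.\<close>
  define \<epsilon>' where "\<epsilon>' = min (1 / 2) (\<epsilon> / (4 * c))"
  have \<epsilon>': "0 < \<epsilon>'" "\<epsilon>' \<le> 1 / 2" "c * (2 * \<epsilon>') \<le> \<epsilon> / 2"
    using c \<epsilon> by (auto simp: \<epsilon>'_def min_def field_simps)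
  interpret E: prob_space equil using pos_distribution_equil by (simp add: pos_distribution_def)
  obtain a' b' where K: "0 < a'" "a' \<le> b'" "measure equil (UNIV - {a'..b'}) < \<epsilon>'"
    using pos_distribution_compact[OF pos_distribution_equil \<epsilon>'(1)] by blast
  let ?K = "{a'..b'}"
  obtain T \<delta> where T: "0 \<le> T" "0 < \<delta>"
    and minor: "\<And>p x. p \<in> borel_measurable borel \<Longrightarrow> x \<in> ?K \<Longrightarrow> ennreal \<delta> * equil_mean (\<lambda>y. p y * indicator ?K y) \<le> Q p T x"
    using Q_minorization[OF K(1,2)] by blast
  define k where "k = measure equil ?K"
  have k: "equil_mean (indicator ?K) = ennreal k" "0 \<le> k"
    by (simp_all add: k_def emeasure_equil[symmetric] E.emeasure_eq_measure)
  have "1 / 2 \<le> k" using K(3) \<epsilon>'(2) E.prob_compl[of ?K] by (simp add: k_def)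
  have K\<epsilon>: "equil_mean (indicator (- ?K)) \<le> ennreal \<epsilon>'"
    using K(3) by (simp add: emeasure_equil[symmetric] E.emeasure_eq_measure Compl_eq_Diff_UNIV ennreal_leI)
  \<comment> \<open>The minorization applied to the constant 1 gives this, since \<open>Q\<close> of
    it is at most 1.\<close>
  have "ennreal \<delta> * ennreal k \<le> 1"
    using minor[of "\<lambda>_. 1" a'] Q_le_one[of "\<lambda>_. 1" a' T] T K(1,2) k by auto
  then have \<kappa>: "\<delta> * k \<le> 1" using T k by (simp add: ennreal_mult[symmetric])
  have "0 < \<delta> * k" using T \<open>1 / 2 \<le> k\<close> by simp
  then have "(\<lambda>n. (1 - \<delta> * k) ^ n) \<longlonglongrightarrow> 0" using \<kappa> by (intro LIMSEQ_power_zero) auto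
  then have "\<forall>\<^sub>F n in sequentially. (1 - \<delta> * k) ^ n < \<epsilon>'" using \<epsilon>' by (auto simp: order_tendsto_iff)
  then obtain n where n: "(1 - \<delta> * k) ^ n < \<epsilon>'" using eventually_happens'[OF sequentially_bot] by blast
  show ?thesis
  proof (rule that[of "T0 + real n * T"])
    show "0 \<le> T0 + real n * T" using T0 T by simp
    fix f :: "real \<Rightarrow> ennreal" and t x
    assume [measurable]: "f \<in> borel_measurable borel" and f1: "\<And>x. 0 < x \<Longrightarrow> f x \<le> 1" and t: "T0 + real n * T \<le> t" and x: "x \<in> {a..b}"
    have x0: "0 < x" using x a by simp
    \<comment> \<open>The time left over between \<open>n\<close> contraction periods and the final
      \<open>T0\<close>; by invariance it leaves the mean of \<open>p\<close> unchanged.\<close>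
    define t' where "t' = t - T0 - real n * T"
    have t': "0 \<le> t'" "t = T0 + (t' + real n * T)" using t by (auto simp: t'_def)
    have mf: "f \<in> borel_measurable borel" by measurable
    have mK: "?K \<in> sets borel" and K0: "?K \<subseteq> {0<..}" using K(1) by auto
    obtain p g r A where [measurable]: "p \<in> borel_measurable borel" "r \<in> borel_measurable borel"
      and eqs: "\<forall>x>0. Q f (real n * T) x = p x + r x \<and> equil_mean f = g x + r x \<and> p x \<le> 1 \<and> g x \<le> 1"
      and A: "equil_mean p = ennreal A" "0 \<le> A" "A \<le> \<epsilon>' + (1 - \<delta> * k) ^ n"
      using Q_contraction[OF mK T(1) K0 T(2) less_imp_le[OF \<epsilon>'(1)] minor K\<epsilon> k \<kappa> mf f1, of n] by blast
    have eq: "\<And>x. 0 < x \<Longrightarrow> Q f (real n * T) x = p x + r x" "\<And>x. 0 < x \<Longrightarrow> r x \<le> equil_mean f" "\<And>x. 0 < x \<Longrightarrow> p x \<le> 1"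
      using eqs by auto
    have nT: "0 \<le> real n * T" using T by simp
    \<comment> \<open>The common remainder \<open>r\<close> never exceeds
      \<open>equil_mean f\<close>, so only \<open>p\<close> can contribute an excess.\<close>
    have "Q f (t' + real n * T) y \<le> Q p t' y + equil_mean f" if y: "0 < y" for y
    proof -
      have "Q f (t' + real n * T) y = Q (Q f (real n * T)) t' y" using f1 t' nT y by (intro Q_semigroup) auto
      also have "\<dots> \<le> Q (\<lambda>x. p x + equil_mean f) t' y" using eq y t' by (intro Q_mono) (auto intro: add_left_mono)
      also have "\<dots> = Q p t' y + equil_mean f" using y t' by (subst Q_add) (auto simp: Q_const)
      finally show ?thesis .
    qed
    then have "Q (Q f (t' + real n * T)) T0 x \<le> Q (\<lambda>y. Q p t' y + equil_mean f) T0 x" using x0 T0 by (intro Q_mono) auto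
    also have "\<dots> = Q (Q p t') T0 x + equil_mean f" using x0 T0 by (subst Q_add) (auto simp: Q_const)
    also have "Q (Q p t') T0 x \<le> ennreal \<epsilon>"
    proof -
      have "Q (Q p t') T0 x \<le> flow (Q p t') T0 x + ennreal c * equil_mean (Q p t')" using c(2) x by simp
      also have "flow (Q p t') T0 x \<le> ennreal (\<epsilon> / 2)"
      proof -
        have "L (x * exp T0) \<le> L (a * exp T0)" using x by (intro L_antimono) simp
        also have "\<dots> \<le> L b * (\<epsilon> / 2)" using T0 by simp
        also have "\<dots> \<le> L x * (\<epsilon> / 2)" using x \<epsilon> by (intro mult_right_mono L_antimono) auto
        finally have "L (x * exp T0) / L x \<le> \<epsilon> / 2" using L_pos[of x] by (simp add: field_simps)
        moreover have "Q p t' (x * exp T0) \<le> 1" using eq x0 t' by (intro Q_le_one) auto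
        ultimately have "flow (Q p t') T0 x \<le> ennreal (\<epsilon> / 2) * 1" unfolding flow_def
          by (intro mult_mono ennreal_leI) auto
        then show ?thesis by simp
      qed
      also have "ennreal c * equil_mean (Q p t') \<le> ennreal (\<epsilon> / 2)"
      proof -
        have "c * A \<le> c * (2 * \<epsilon>')" using c(1) A n by (intro mult_left_mono) auto
        then have "c * A \<le> \<epsilon> / 2" using \<epsilon>' by simp
        then show ?thesis using A c(1) t' by (simp add: equil_mean_Q ennreal_mult[symmetric] ennreal_leI)
      qed
      finally show ?thesis using \<epsilon> by (simp add: ennreal_plus[symmetric] add_mono del: ennreal_plus)
    qed
    finally have "Q (Q f (t' + real n * T)) T0 x \<le> equil_mean f + ennreal \<epsilon>" by (simp add: add.commute add_left_mono)
    moreover have "Q f t x = Q (Q f (t' + real n * T)) T0 x"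
      unfolding t'(2) using f1 t' nT T0 x0 by (intro Q_semigroup) auto
    ultimately show "Q f t x \<le> equil_mean f + ennreal \<epsilon>" by simp
  qed
qed

end

section \<open>The law of the cell process\<close>

lemma ln_le_iff_le_exp: "0 < y \<Longrightarrow> ln y \<le> c \<longleftrightarrow> y \<le> exp c"
  for y c :: real
  using exp_le_cancel_iff[of "ln y" c] by simp

text \<open>The entry at index 0 is never read. This permits replacing \<open>U k\<close> by
  \<open>U (Suc (k - 1))\<close>, a sequence of measurable functions at every index.\<close>

lemma jump_time_cong:
  assumes "\<And>k. 1 \<le> k \<Longrightarrow> u k = u' k"
  shows "jump_time R x u n = jump_time R x u' n"
proof (induction n)
  case (Suc n)
  have "(\<Prod>j=1..n. jump_factor u j) = (\<Prod>j=1..n. jump_factor u' j)"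
    using assms by (intro prod.cong) (auto simp: jump_factor_def)
  then show ?case using Suc assms by simp
qed simp

lemma cell_process_cong:
  assumes "\<And>k. 1 \<le> k \<Longrightarrow> u k = u' k"
  shows "cell_process R x u t = cell_process R x u' t"
proof -
  have "jump_time R x u = jump_time R x u'" by (intro ext jump_time_cong assms)
  moreover have "(\<Prod>j=1..n. jump_factor u j) = (\<Prod>j=1..n. jump_factor u' j)" for n
    using assms by (intro prod.cong) (auto simp: jump_factor_def)
  ultimately show ?thesis by (simp add: cell_process_def lifetime_def)
qed

section \<open>Jump times and the restart after the first jump\<close>

lemma jump_time_Suc_mono: "jump_time R x u k \<le> jump_time R x u (Suc k)"
  by simp

lemma jump_time_mono: "incseq (jump_time R x u)"
  by (rule incseq_SucI) (rule jump_time_Suc_mono)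

lemma lifetime_eq_SUP: "lifetime R x u = (SUP k. jump_time R x u k)"
  unfolding lifetime_def by (intro limI LIMSEQ_SUP jump_time_mono)

lemma jump_time_unique:
  assumes "jump_time R x u k \<le> t" "t < jump_time R x u (Suc k)" "jump_time R x u l \<le> t" "t < jump_time R x u (Suc l)"
  shows "k = l"
proof (rule ccontr)
  assume "k \<noteq> l"
  then consider "Suc k \<le> l" | "Suc l \<le> k" by linarith
  then show False
    using assms incseqD[OF jump_time_mono, of "Suc k" l R x u] incseqD[OF jump_time_mono, of "Suc l" k R x u]
    by cases (auto dest: order_less_le_trans simp del: jump_time.simps)
qed

lemma cell_process_eq:
  assumes x: "0 < x" and k: "jump_time R x u k \<le> ennreal t" "ennreal t < jump_time R x u (Suc k)"
  shows "cell_process R x u t = x * exp t * (\<Prod>j=1..k. jump_factor u j)"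
proof -
  have "ennreal t < lifetime R x u" unfolding lifetime_eq_SUP using k(2) by (rule less_SUP_iff[THEN iffD2, OF bexI]) simp
  moreover have "(THE k. jump_time R x u k \<le> ennreal t \<and> ennreal t < jump_time R x u (Suc k)) = k"
    using k jump_time_unique[of R x u _ "ennreal t" k] by (intro the_equality) blast+
  ultimately show ?thesis using x by (simp add: cell_process_def Let_def del: jump_time.simps)
qed

text \<open>After its first jump the process starts afresh from
  \<open>x * exp s * jump_factor u 1\<close>. A jump consumes two entries of the driving sequence,
  one for the time and one for the factor, hence the shift by 2.\<close>

lemma jump_time_shift:
  assumes s: "survival_inv R x (u 1) = ennreal s" "0 \<le> s" and u': "\<And>k. 1 \<le> k \<Longrightarrow> u' k = u (k + 2)"
  shows "jump_time R x u (Suc k) = ennreal s + jump_time R (x * exp s * jump_factor u 1) u' k"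
proof (induction k)
  case 0
  show ?case using s by simp
next
  case (Suc k)
  let ?x' = "x * exp s * jump_factor u 1"
  show ?case
  proof (cases "jump_time R ?x' u' k")
    case top
    then show ?thesis using Suc by simp
  next
    case (real r)
    have sr: "jump_time R x u (Suc k) = ennreal (s + r)" using Suc real s by simp
    have "(\<Prod>j=1..Suc k. jump_factor u j) = jump_factor u 1 * (\<Prod>j=Suc 1..Suc k. jump_factor u j)"
      by (rule prod.atLeast_Suc_atMost) simp
    also have "(\<Prod>j=Suc 1..Suc k. jump_factor u j) = (\<Prod>j=1..k. jump_factor u (Suc j))"
      by (rule prod.atLeast_Suc_atMost_Suc_shift[unfolded o_def])
    also have "\<dots> = (\<Prod>j=1..k. jump_factor u' j)"
      using u' by (intro prod.cong) (auto simp: jump_factor_def)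
    finally have p: "x * exp (s + r) * (\<Prod>j=1..Suc k. jump_factor u j) = ?x' * exp r * (\<Prod>j=1..k. jump_factor u' j)"
      by (simp only: exp_add mult_ac)
    have "jump_time R x u (Suc (Suc k)) = jump_time R x u (Suc k) +
       survival_inv R (x * exp (enn2real (jump_time R x u (Suc k))) * (\<Prod>j=1..Suc k. jump_factor u j)) (u (2 * Suc k + 1))"
      by (subst jump_time.simps(2)) (simp only: sr infinity_ennreal_def ennreal_neq_top if_False)
    also have "\<dots> = ennreal (s + r) + survival_inv R (?x' * exp r * (\<Prod>j=1..k. jump_factor u' j)) (u (2 * Suc k + 1))"
    proof -
      have e: "enn2real (ennreal (s + r)) = s + r" using s real by (simp del: ennreal_plus)
      show ?thesis by (simp only: sr p e)
    qed
    also have "u (2 * Suc k + 1) = u' (2 * k + 1)" using u'[of "2 * k + 1"] by simp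
    finally show ?thesis using real s by (simp add: add.assoc del: jump_time.simps(2)[of R x u])
  qed
qed

text \<open>The value \<open>f X\<^sub>t\<close> if \<open>t < \<tau>\<^sub>n\<close>, and \<open>0\<close> otherwise.\<close>

definition truncated :: "(real \<Rightarrow> real) \<Rightarrow> nat \<Rightarrow> real \<Rightarrow> (real \<Rightarrow> ennreal) \<Rightarrow> real \<Rightarrow> (nat \<Rightarrow> real) \<Rightarrow> ennreal" where
  "truncated R n t f x u = (\<Sum>k<n. if jump_time R x u k \<le> ennreal t \<and> ennreal t < jump_time R x u (Suc k)
     then f (x * exp t * (\<Prod>j=1..k. jump_factor u j)) else 0)"

lemma truncated_cong:
  assumes "\<And>k. 1 \<le> k \<Longrightarrow> u k = u' k"
  shows "truncated R n t f x u = truncated R n t f x u'"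
proof -
  have "jump_time R x u = jump_time R x u'" by (intro ext jump_time_cong assms)
  moreover have "(\<Prod>j=1..n. jump_factor u j) = (\<Prod>j=1..n. jump_factor u' j)" for n
    using assms by (intro prod.cong) (auto simp: jump_factor_def)
  ultimately show ?thesis by (simp only: truncated_def)
qed

text \<open>At most one summand is non-zero, by \<open>jump_time_unique\<close>, and it is the value
  at the process. If no summand is active, the truncation is 0, hence an inequality.\<close>

lemma truncated_le:
  assumes x: "0 < x"
  shows "truncated R n t f x u \<le> f (cell_process R x u t)"
proof (cases "\<exists>k<n. jump_time R x u k \<le> ennreal t \<and> ennreal t < jump_time R x u (Suc k)")
  case True
  then obtain k where k: "k < n" "jump_time R x u k \<le> ennreal t" "ennreal t < jump_time R x u (Suc k)" by blast
  have "truncated R n t f x u = (\<Sum>l<n. if l = k then f (x * exp t * (\<Prod>j=1..k. jump_factor u j)) else 0)"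
    unfolding truncated_def
  proof (rule sum.cong[OF refl])
    fix l
    show "(if jump_time R x u l \<le> ennreal t \<and> ennreal t < jump_time R x u (Suc l)
        then f (x * exp t * (\<Prod>j=1..l. jump_factor u j)) else 0) =
      (if l = k then f (x * exp t * (\<Prod>j=1..k. jump_factor u j)) else 0)"
    proof (cases "l = k")
      case True
      then show ?thesis using k by (simp only: simp_thms if_True)
    next
      case False
      then have "\<not> (jump_time R x u l \<le> ennreal t \<and> ennreal t < jump_time R x u (Suc l))"
        using k jump_time_unique by blast
      then show ?thesis using False by (simp only: if_False)
    qed
  qed
  also have "\<dots> = f (x * exp t * (\<Prod>j=1..k. jump_factor u j))" using k by simp
  finally show ?thesis using cell_process_eq[OF x k(2,3)] by simp
next
  case False
  then have "truncated R n t f x u = 0" unfolding truncated_def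
    by (intro sum.neutral ballI if_not_P) blast
  then show ?thesis by simp
qed

text \<open>The pathwise form of the recursion that defines \<open>W\<close>.\<close>

lemma truncated_Suc:
  assumes s: "survival_inv R x (u 1) = ennreal s" "0 \<le> s" and u': "\<And>k. 1 \<le> k \<Longrightarrow> u' k = u (k + 2)" and t: "0 \<le> t"
  shows "truncated R (Suc n) t f x u =
    (if t < s then f (x * exp t) else truncated R n (t - s) f (x * exp s * jump_factor u 1) u')"
proof -
  let ?x' = "x * exp s * jump_factor u 1"
  have shift: "jump_time R x u (Suc k) = ennreal s + jump_time R ?x' u' k" for k
    by (intro jump_time_shift s u')
  have prod: "x * exp t * (\<Prod>j=1..Suc k. jump_factor u j) = ?x' * exp (t - s) * (\<Prod>j=1..k. jump_factor u' j)" for k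
  proof -
    have "(\<Prod>j=1..Suc k. jump_factor u j) = jump_factor u 1 * (\<Prod>j=Suc 1..Suc k. jump_factor u j)"
      by (rule prod.atLeast_Suc_atMost) simp
    also have "(\<Prod>j=Suc 1..Suc k. jump_factor u j) = (\<Prod>j=1..k. jump_factor u (Suc j))"
      by (rule prod.atLeast_Suc_atMost_Suc_shift[unfolded o_def])
    also have "\<dots> = (\<Prod>j=1..k. jump_factor u' j)"
      using u' by (intro prod.cong) (auto simp: jump_factor_def)
    finally show ?thesis by (simp add: exp_diff)
  qed
  have split: "truncated R (Suc n) t f x u = (if jump_time R x u 0 \<le> ennreal t \<and> ennreal t < jump_time R x u (Suc 0)
     then f (x * exp t * (\<Prod>j=1..0. jump_factor u j)) else 0) +
     (\<Sum>k<n. if jump_time R x u (Suc k) \<le> ennreal t \<and> ennreal t < jump_time R x u (Suc (Suc k))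
     then f (x * exp t * (\<Prod>j=1..Suc k. jump_factor u j)) else 0)"
    unfolding truncated_def by (rule sum.lessThan_Suc_shift)
  show ?thesis
  proof (cases "t < s")
    case True
    then have "ennreal t < ennreal s" using t s by (simp add: ennreal_less_iff)
    then have "ennreal t < jump_time R x u (Suc k)" for k
      unfolding shift by (rule order_less_le_trans) simp
    then have no: "\<not> (jump_time R x u (Suc k) \<le> ennreal t \<and> P)" for k P
      unfolding not_le[symmetric] by blast
    have "jump_time R x u 0 \<le> ennreal t \<and> ennreal t < jump_time R x u (Suc 0)"
      unfolding shift using \<open>ennreal t < ennreal s\<close> by (simp del: jump_time.simps(2) add: jump_time.simps(1))
    then show ?thesis unfolding split if_not_P[OF no] using True by (simp del: jump_time.simps)
  next
    case False
    have ts: "ennreal t = ennreal s + ennreal (t - s)" using False t s by (simp add: ennreal_plus[symmetric] del: ennreal_plus)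
    have le: "ennreal s + a \<le> ennreal t \<longleftrightarrow> a \<le> ennreal (t - s)" "ennreal t < ennreal s + a \<longleftrightarrow> ennreal (t - s) < a" for a
      unfolding ts by (auto simp: ennreal_add_left_cancel_le ennreal_add_left_cancel_less)
    have "\<not> ennreal t < jump_time R x u (Suc 0)" unfolding shift using False s by (simp add: ennreal_leI not_less)
    then show ?thesis unfolding split unfolding shift le prod using False
      by (simp only: truncated_def jump_time.simps(1) not_less_zero simp_thms if_False add_0_left)
  qed
qed

text \<open>The rate \<open>R\<close> enters only through its survival function. Negative
  \<open>z\<close> are included so that measurability can be proved for arbitrary real
  arguments.\<close>

locale cell_model = growth_jump L C for L C +
  fixes R :: "real \<Rightarrow> real"
  assumes survival_eq: "\<And>z t. 0 \<le> t \<Longrightarrow> survival R z t = L (z * exp t) / L z"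
begin

section \<open>Measurability, and the law of the truncated process for uniform driving
  variables\<close>

lemma survival_antimono: "0 \<le> s \<Longrightarrow> s \<le> t \<Longrightarrow> survival R z t \<le> survival R z s"
proof -
  assume st: "0 \<le> s" "s \<le> t"
  have "L (z * exp t) \<le> L (z * exp s)"
  proof (cases "0 \<le> z")
    case True
    then show ?thesis using st by (intro L_antimono mult_left_mono) auto
  next
    case False
    then have "z * exp t \<le> 0" "z * exp s \<le> 0" by (auto intro: mult_nonpos_nonneg)
    then show ?thesis by (simp add: L_0)
  qed
  then show ?thesis using st L_pos[of z] by (simp add: survival_eq divide_right_mono)
qed

text \<open>If survival at \<open>c\<close> still exceeds \<open>v\<close>, by continuity it does so
  at some \<open>c' > c\<close>, and by monotonicity every admissible time is at least
  \<open>c'\<close>. Hence the infimum cannot be \<open>c\<close> or less.\<close>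

lemma survival_inv_le_iff:
  assumes c: "0 \<le> c"
  shows "survival_inv R z v \<le> ennreal c \<longleftrightarrow> survival R z c \<le> v"
proof
  assume "survival R z c \<le> v"
  then show "survival_inv R z v \<le> ennreal c"
    unfolding survival_inv_def using c by (intro Inf_lower) auto
next
  assume le: "survival_inv R z v \<le> ennreal c"
  show "survival R z c \<le> v"
  proof (rule ccontr)
    assume "\<not> survival R z c \<le> v"
    then have gt: "v < L (z * exp c) / L z" using c by (simp add: survival_eq)
    have "isCont L y" for y using L_cont by (simp add: continuous_on_eq_continuous_at)
    then have "isCont (\<lambda>t. L (z * exp t)) c"
      by (intro isCont_o2[where g=L and f="\<lambda>t. z * exp t"] isCont_mult isCont_exp continuous_const)
    then have "isCont (\<lambda>t. L (z * exp t) / L z) c"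
      using L_pos[of z] by (intro continuous_divide continuous_const) auto
    then have "\<forall>\<^sub>F t in at c. v < L (z * exp t) / L z"
      using gt unfolding isCont_def by (rule order_tendstoD)
    then have "\<forall>\<^sub>F t in at_right c. v < L (z * exp t) / L z"
      by (rule filter_leD[OF at_le, rotated]) simp
    then have "\<forall>\<^sub>F t in at_right c. v < L (z * exp t) / L z \<and> c < t"
      using eventually_at_right_less by eventually_elim auto
    then obtain c' where c': "v < L (z * exp c') / L z" "c < c'"
      using eventually_happens'[OF trivial_limit_at_right_real] by blast
    have "ennreal c' \<le> survival_inv R z v"
      unfolding survival_inv_def
    proof (rule Inf_greatest)
      fix e assume "e \<in> ennreal ` {t. 0 \<le> t \<and> survival R z t \<le> v}"
      then obtain t where t: "e = ennreal t" "0 \<le> t" "survival R z t \<le> v" by auto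
      have "c' \<le> t"
      proof (rule ccontr)
        assume "\<not> c' \<le> t"
        then show False using survival_antimono[of t c' z] t c' c by (simp add: survival_eq)
      qed
      then show "ennreal c' \<le> e" using t by (simp add: ennreal_leI)
    qed
    then show False using order_trans[OF _ le, of "ennreal c'"] c c' by simp
  qed
qed

lemma survival_inv_measurable [measurable (raw)]:
  assumes [measurable]: "g \<in> borel_measurable N" "h \<in> borel_measurable N"
  shows "(\<lambda>y. survival_inv R (g y) (h y)) \<in> borel_measurable N"
proof (rule borel_measurableI_le)
  fix e :: ennreal
  show "{y \<in> space N. survival_inv R (g y) (h y) \<le> e} \<in> sets N"
  proof (cases e)
    case (real c)
    then have "{y \<in> space N. survival_inv R (g y) (h y) \<le> e} = {y \<in> space N. L (g y * exp c) / L (g y) \<le> h y}"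
      by (simp add: survival_inv_le_iff survival_eq)
    then show ?thesis by simp
  qed simp
qed

lemma prod_jump_factor_measurable [measurable (raw)]:
  assumes [measurable]: "\<And>k. (\<lambda>y. h y k) \<in> borel_measurable N"
  shows "(\<lambda>y. prod (jump_factor (h y)) A) \<in> borel_measurable N"
proof -
  have "(\<lambda>y. \<Prod>j\<in>A. jump_factor (h y) j) \<in> borel_measurable N" unfolding jump_factor_def by measurable
  then show ?thesis .
qed

lemma jump_time_measurable [measurable (raw)]:
  assumes [measurable]: "g \<in> borel_measurable N" "\<And>k. (\<lambda>y. h y k) \<in> borel_measurable N"
  shows "(\<lambda>y. jump_time R (g y) (h y) n) \<in> borel_measurable N"
proof (induction n)
  case (Suc n)
  note [measurable] = Suc
  show ?case by simp
qed simp

lemma truncated_measurable [measurable (raw)]: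
  assumes [measurable]: "f \<in> borel_measurable borel" "g \<in> borel_measurable N" "\<And>k. (\<lambda>y. h y k) \<in> borel_measurable N"
  shows "(\<lambda>y. truncated R n t f (g y) (h y)) \<in> borel_measurable N"
proof -
  have [measurable]: "(\<lambda>y. jump_time R (g y) (h y) k) \<in> borel_measurable N" for k
    by (rule jump_time_measurable) measurable
  show ?thesis unfolding truncated_def by measurable
qed

lemma cell_process_measurable [measurable (raw)]:
  assumes [measurable]: "g \<in> borel_measurable N" "\<And>k. (\<lambda>y. h y k) \<in> borel_measurable N"
  shows "(\<lambda>y. cell_process R (g y) (h y) t) \<in> borel_measurable N"
proof -
  have j [measurable]: "(\<lambda>y. jump_time R (g y) (h y) k) \<in> borel_measurable N" for k
    by (rule jump_time_measurable) measurable
  have [measurable]: "(\<lambda>y. lifetime R (g y) (h y)) \<in> borel_measurable N"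
    unfolding lifetime_eq_SUP by measurable
  let ?P = "\<lambda>k y. g y > 0 \<and> ennreal t < lifetime R (g y) (h y) \<and> jump_time R (g y) (h y) k \<le> ennreal t \<and> ennreal t < jump_time R (g y) (h y) (Suc k)"
  have [measurable]: "Measurable.pred N (?P k)" for k
    by measurable
  have [measurable]: "(\<lambda>y. THE k. ?P k y) \<in> measurable N (count_space UNIV)"
  proof (rule measurable_THE[where I=UNIV])
    show "k = l" if "?P k y" "?P l y" for y k l
      using that jump_time_unique[of R "g y" "h y" k "ennreal t" l] by blast
  qed auto
  have [measurable]: "(\<lambda>y. \<Prod>j=1..(THE k. ?P k y). jump_factor (h y) j) \<in> borel_measurable N"
    by (rule measurable_compose_countable[where g="\<lambda>y. THE k. ?P k y" and f="\<lambda>i y. \<Prod>j=1..i. jump_factor (h y) j"])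
      measurable
  have eq: "cell_process R (g y) (h y) t = (if g y \<le> 0 \<or> lifetime R (g y) (h y) \<le> ennreal t then 0 else
      g y * exp t * (\<Prod>j=1..(THE k. ?P k y). jump_factor (h y) j))" for y
  proof (cases "g y \<le> 0 \<or> lifetime R (g y) (h y) \<le> ennreal t")
    case False
    then have "?P k y \<longleftrightarrow> jump_time R (g y) (h y) k \<le> ennreal t \<and> ennreal t < jump_time R (g y) (h y) (Suc k)" for k
      by (simp only: not_le de_Morgan_disj simp_thms)
    then show ?thesis unfolding cell_process_def Let_def if_not_P[OF False] by (simp only:)
  qed (simp add: cell_process_def)
  show ?thesis unfolding eq by measurable
qed

text \<open>Both sides are at most \<open>c\<close> exactly when
  \<open>L (x * exp c) \<le> v * L x\<close>; the inverse survival function is thus the time needed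
  to grow from \<open>x\<close> to \<open>q (v * L x)\<close>.\<close>

lemma survival_inv_eq:
  assumes x: "0 < x" and v: "v \<in> {0<..<1}"
  shows "survival_inv R x v = ennreal (ln (q (v * L x) / x))" "x < q (v * L x)"
proof -
  have vL: "v * L x \<in> {0<..<L x}" using v L_pos[of x] by simp
  then show xq: "x < q (v * L x)" using x by (subst q_gt_iff) auto
  let ?s = "ln (q (v * L x) / x)"
  have s0: "0 \<le> ?s" using xq x by (simp add: ln_ge_zero)
  have iff: "survival_inv R x v \<le> ennreal c \<longleftrightarrow> ?s \<le> c" if c: "0 \<le> c" for c
  proof -
    have "survival_inv R x v \<le> ennreal c \<longleftrightarrow> L (x * exp c) \<le> v * L x"
      using c L_pos[of x] by (simp add: survival_inv_le_iff survival_eq divide_le_eq)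
    also have "\<dots> \<longleftrightarrow> q (v * L x) \<le> x * exp c" using vL x by (subst q_le_iff) auto
    also have "\<dots> \<longleftrightarrow> q (v * L x) / x \<le> exp c" using x by (simp add: field_simps)
    also have "\<dots> \<longleftrightarrow> ?s \<le> c" using x xq by (subst ln_le_iff_le_exp) auto
    finally show ?thesis .
  qed
  show "survival_inv R x v = ennreal ?s"
  proof (rule antisym)
    show le: "survival_inv R x v \<le> ennreal ?s" using iff s0 by simp
    then obtain c where c: "survival_inv R x v = ennreal c" "0 \<le> c" by (cases "survival_inv R x v") (auto simp: top_unique)
    then show "ennreal ?s \<le> survival_inv R x v" using iff[of c] by (simp add: ennreal_leI)
  qed
qed

text \<open>Scaling \<open>a\<close> to the level \<open>v = a * L x\<close> makes the jump position
  depend on \<open>v\<close> alone, and \<open>t < ln (q v / x)\<close> becomes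
  \<open>v < L (x * exp t)\<close>, which separates the flow from the jump term.\<close>

lemma jump_term_uniform:
  assumes [measurable]: "f \<in> borel_measurable borel" "case_prod \<phi> \<in> borel_measurable (borel \<Otimes>\<^sub>M borel)"
    and x: "0 < x" and t: "0 \<le> t"
  shows "(\<integral>\<^sup>+a. (if t < ln (q (a * L x) / x) then f (x * exp t) else jump_mean (q (a * L x)) (\<phi> (t - ln (q (a * L x) / x)))) *
     indicator {0<..<1} a \<partial>lborel) = flow f t x + jump_term \<phi> t x"
proof -
  note [measurable (raw)] = measurable_uncurried[OF assms(2)]
  have [measurable]: "Measurable.pred borel (\<lambda>v. v \<in> {0<..<L x})" "Measurable.pred borel (\<lambda>v. q v \<in> {..x})" for x by simp_all
  let ?J = "\<lambda>v. jump_mean (q v) (\<phi> (t - ln (q v / x)))"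
  let ?\<psi> = "\<lambda>v. if t < ln (q v / x) then f (x * exp t) else ?J v"
  let ?y = "x * exp t"
  have y: "0 < ?y" "x \<le> ?y" using x t by auto
  have "(\<integral>\<^sup>+v. ?\<psi> v * indicator {0<..<L x} v \<partial>lborel) =
     ennreal \<bar>L x\<bar> * (\<integral>\<^sup>+a. ?\<psi> (0 + L x * a) * indicator {0<..<L x} (0 + L x * a) \<partial>lborel)"
    by (rule nn_integral_real_affine) (measurable, use L_pos[of x] in simp)
  then have "ennreal (1 / L x) * (\<integral>\<^sup>+v. ?\<psi> v * indicator {0<..<L x} v \<partial>lborel) =
     ennreal (1 / L x) * (ennreal (L x) * (\<integral>\<^sup>+a. ?\<psi> (L x * a) * indicator {0<..<L x} (L x * a) \<partial>lborel))"
    by (simp only: add_0_left abs_of_pos[OF L_pos])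
  also have "\<dots> = (\<integral>\<^sup>+a. ?\<psi> (L x * a) * indicator {0<..<L x} (L x * a) \<partial>lborel)"
    using L_pos[of x] by (simp add: mult.assoc[symmetric] ennreal_mult[symmetric])
  also have "\<dots> = (\<integral>\<^sup>+a. ?\<psi> (a * L x) * indicator {0<..<1} a \<partial>lborel)"
    using L_pos[of x] by (intro nn_integral_cong) (auto simp: indicator_def mult.commute zero_less_mult_iff)
  finally have 1: "(\<integral>\<^sup>+a. ?\<psi> (a * L x) * indicator {0<..<1} a \<partial>lborel) = ennreal (1 / L x) * (\<integral>\<^sup>+v. ?\<psi> v * indicator {0<..<L x} v \<partial>lborel)" ..
  have "?\<psi> v * indicator {0<..<L x} v = f ?y * indicator {0<..<L ?y} v + indicator {0<..<L x} v * indicator {..?y} (q v) * ?J v" for v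
  proof (cases "v \<in> {0<..<L x}")
    case False
    then show ?thesis using L_antimono[OF y(2)] by (auto simp: indicator_def)
  next
    case True
    then have xq: "x < q v" using x by (subst q_gt_iff) auto
    have "t < ln (q v / x) \<longleftrightarrow> exp t < q v / x" using xq x ln_le_iff_le_exp[of "q v / x" t, OF divide_pos_pos] by (simp add: not_le[symmetric])
    also have "\<dots> \<longleftrightarrow> ?y < q v" using x by (simp add: field_simps)
    finally have "t < ln (q v / x) \<longleftrightarrow> ?y < q v" .
    moreover have "?y < q v \<longleftrightarrow> v < L ?y" using True y by (intro q_gt_iff) auto
    ultimately show ?thesis using True by (auto simp: indicator_def)
  qed
  then have "(\<integral>\<^sup>+v. ?\<psi> v * indicator {0<..<L x} v \<partial>lborel) =
     (\<integral>\<^sup>+v. f ?y * indicator {0<..<L ?y} v \<partial>lborel) + (\<integral>\<^sup>+v. indicator {0<..<L x} v * indicator {..?y} (q v) * ?J v \<partial>lborel)"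
    by (simp only:) (subst nn_integral_add, auto simp: indicator_def)
  also have "(\<integral>\<^sup>+v. f ?y * indicator {0<..<L ?y} v \<partial>lborel) = f ?y * ennreal (L ?y)"
    using L_pos[of ?y] by (subst nn_integral_cmult) auto
  finally have 2: "(\<integral>\<^sup>+v. ?\<psi> v * indicator {0<..<L x} v \<partial>lborel) = f ?y * ennreal (L ?y) +
     (\<integral>\<^sup>+v. indicator {0<..<L x} v * indicator {..?y} (q v) * ?J v \<partial>lborel)" .
  have "ennreal (1 / L x) * (f ?y * ennreal (L ?y)) = flow f t x"
  proof -
    have "ennreal (1 / L x) * ennreal (L ?y) = ennreal (L ?y / L x)"
      using L_pos[of x] L_pos[of ?y] by (simp add: ennreal_mult[symmetric])
    then show ?thesis unfolding flow_def by (metis mult.assoc mult.commute)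
  qed
  then show ?thesis unfolding 1 2 distrib_left jump_term_def by simp
qed

text \<open>Two coordinates are split off the product: \<open>a\<close> determines the first jump
  time, \<open>b\<close> the first jump factor. The rest is again an i.i.d. uniform sequence, to
  which the induction hypothesis applies at the landing point.\<close>

lemma nn_integral_truncated:
  assumes f [measurable]: "f \<in> borel_measurable borel"
  shows "0 < x \<Longrightarrow> 0 \<le> t \<Longrightarrow>
    (\<integral>\<^sup>+w. truncated R n t f x (\<lambda>k. w (k - 1)) \<partial>(PiM UNIV (\<lambda>_::nat. uniform_measure lborel {0<..<1::real}))) = W n f t x"
proof (induction n arbitrary: x t)
  case 0
  then show ?case by (simp add: truncated_def)
next
  case (Suc n)
  let ?U = "uniform_measure lborel {0<..<1::real}"
  interpret U: prob_space ?U by (rule prob_space_uniform_measure) auto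
  interpret sequence_space ?U ..
  have [measurable_cong]: "sets ?U = sets borel" by simp
  have coord [measurable]: "(\<lambda>w. w k) \<in> borel_measurable S" for k
    using measurable_component_singleton[of k UNIV "\<lambda>_. ?U"] by (simp cong: measurable_cong_sets)
  have int_U: "(\<integral>\<^sup>+a. g a \<partial>?U) = (\<integral>\<^sup>+a. g a * indicator {0<..<1} a \<partial>lborel)" if "g \<in> borel_measurable borel" for g
    using that by (subst nn_integral_uniform_measure) (auto simp: divide_ennreal_def)
  have iter: "(\<integral>\<^sup>+w. g w \<partial>S) = (\<integral>\<^sup>+a. \<integral>\<^sup>+w. g (case_nat a w) \<partial>S \<partial>?U)" if g [measurable]: "g \<in> borel_measurable S" for g
  proof -
    have "(\<integral>\<^sup>+w. g w \<partial>S) = (\<integral>\<^sup>+w. g w \<partial>(distr (?U \<Otimes>\<^sub>M S) S (\<lambda>(s, \<omega>). case_nat s \<omega>)))"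
      by (simp add: PiM_iter)
    also have "\<dots> = (\<integral>\<^sup>+p. g (case_nat (fst p) (snd p)) \<partial>(?U \<Otimes>\<^sub>M S))"
      by (subst nn_integral_distr) (auto simp: case_prod_beta)
    also have "\<dots> = (\<integral>\<^sup>+a. \<integral>\<^sup>+w. g (case_nat a w) \<partial>S \<partial>?U)"
      by (subst nn_integral_fst[symmetric]) auto
    finally show ?thesis .
  qed
  let ?T = "\<lambda>w. truncated R (Suc n) t f x (\<lambda>k. w (k - 1))"
  have mT [measurable]: "?T \<in> borel_measurable S" by measurable
  have "(\<integral>\<^sup>+w. ?T w \<partial>S) = (\<integral>\<^sup>+a. \<integral>\<^sup>+w. ?T (case_nat a w) \<partial>S \<partial>?U)"
    by (rule iter) measurable
  also have "\<dots> = (\<integral>\<^sup>+a. \<integral>\<^sup>+b. \<integral>\<^sup>+w. ?T (case_nat a (case_nat b w)) \<partial>S \<partial>?U \<partial>?U)"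
    by (intro nn_integral_cong iter) measurable
  also have "\<dots> = (\<integral>\<^sup>+a. (\<integral>\<^sup>+b. (\<integral>\<^sup>+w. ?T (case_nat a (case_nat b w)) \<partial>S) \<partial>?U) * indicator {0<..<1} a \<partial>lborel)"
    by (rule int_U) measurable
  also have "\<dots> = (\<integral>\<^sup>+a. (if t < ln (q (a * L x) / x) then f (x * exp t) else jump_mean (q (a * L x)) (W n f (t - ln (q (a * L x) / x)))) *
     indicator {0<..<1} a \<partial>lborel)"
  proof (rule nn_integral_cong)
    fix a :: real
    let ?z = "q (a * L x)" and ?s = "ln (q (a * L x) / x)"
    show "(\<integral>\<^sup>+b. (\<integral>\<^sup>+w. ?T (case_nat a (case_nat b w)) \<partial>S) \<partial>?U) * indicator {0<..<1} a =
      (if t < ?s then f (x * exp t) else jump_mean ?z (W n f (t - ?s))) * indicator {0<..<1} a"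
    proof (cases "a \<in> {0<..<1}")
      case True
      note si = survival_inv_eq[OF Suc.prems(1) True]
      have z: "0 < ?z" using si(2) Suc.prems by simp
      have s0: "0 \<le> ?s" using si(2) Suc.prems by (simp add: ln_ge_zero)
      have xs: "x * exp ?s = ?z" using z Suc.prems by simp
      have T_eq: "?T (case_nat a (case_nat b w)) =
          (if t < ?s then f (x * exp t) else truncated R n (t - ?s) f (?z * sqrt b) (\<lambda>k. w (k - 1)))" for b w
      proof -
        let ?u = "\<lambda>k. case_nat a (case_nat b w) (k - 1)"
        have 1: "survival_inv R x (?u 1) = ennreal ?s" using si by simp
        \<comment> \<open>The product is indexed from 0 and the driving sequence from 1, so removing
          two coordinates is a shift by 2 in either numbering.\<close>
        have 2: "w (k - 1) = ?u (k + 2)" if "1 \<le> k" for k using that by (cases k) auto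
        have 3: "jump_factor ?u 1 = sqrt b" by (simp add: jump_factor_def numeral_2_eq_2)
        show ?thesis
          using truncated_Suc[where u="?u" and u'="\<lambda>k. w (k - 1)", OF 1 s0 2 Suc.prems(2), of n f] unfolding 3 xs by blast
      qed
      have inner: "(\<integral>\<^sup>+w. ?T (case_nat a (case_nat b w)) \<partial>S) = (if t < ?s then f (x * exp t) else W n f (t - ?s) (?z * sqrt b))"
        if "0 < b" for b
      proof (cases "t < ?s")
        case True
        then show ?thesis unfolding T_eq by (simp add: emeasure_space_1)
      next
        case False
        then have "(\<integral>\<^sup>+w. ?T (case_nat a (case_nat b w)) \<partial>S) = (\<integral>\<^sup>+w. truncated R n (t - ?s) f (?z * sqrt b) (\<lambda>k. w (k - 1)) \<partial>S)"
          unfolding T_eq by simp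
        also have "\<dots> = W n f (t - ?s) (?z * sqrt b)" using False z that by (intro Suc.IH) auto
        finally show ?thesis using False by simp
      qed
      have "(\<integral>\<^sup>+b. (\<integral>\<^sup>+w. ?T (case_nat a (case_nat b w)) \<partial>S) \<partial>?U) =
         (\<integral>\<^sup>+b. (\<integral>\<^sup>+w. ?T (case_nat a (case_nat b w)) \<partial>S) * indicator {0<..<1} b \<partial>lborel)"
        by (rule int_U) measurable
      also have "\<dots> = (\<integral>\<^sup>+b. (if t < ?s then f (x * exp t) else W n f (t - ?s) (?z * sqrt b)) * indicator {0<..<1} b \<partial>lborel)"
      proof (rule nn_integral_cong)
        fix b
        show "(\<integral>\<^sup>+w. ?T (case_nat a (case_nat b w)) \<partial>S) * indicator {0<..<1} b =
          (if t < ?s then f (x * exp t) else W n f (t - ?s) (?z * sqrt b)) * indicator {0<..<1} b"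
          using inner[of b] by (cases "b \<in> {0<..<1}") (simp_all only: greaterThanLessThan_iff indicator_simps mult_zero_right simp_thms)
      qed
      also have "\<dots> = (if t < ?s then f (x * exp t) else jump_mean ?z (W n f (t - ?s)))"
      proof (cases "t < ?s")
        case True
        then show ?thesis by (simp add: nn_integral_cmult)
      next
        case False
        then show ?thesis using jump_mean_subst[of "W n f (t - ?s)" ?z] z by simp
      qed
      finally show ?thesis by simp
    qed simp
  qed
  also have "\<dots> = flow f t x + jump_term (W n f) t x"
    by (rule jump_term_uniform[OF f W_measurable_aux[OF f] Suc.prems])
  finally show ?case by simp
qed

end

section \<open>The law of the process for the given driving sequence\<close>

locale driven_cell_model = cell_model L C R + prob_space M for L C R and M :: "'a measure" +
  fixes U :: "nat \<Rightarrow> 'a \<Rightarrow> real"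
  assumes U_indep: "indep_vars (\<lambda>k. borel) U {1..}"
    and U_uniform: "\<And>k. 1 \<le> k \<Longrightarrow> distr M borel (U k) = uniform_measure lborel {0<..<1}"
begin

lemma U_measurable [measurable]: "U (Suc k) \<in> borel_measurable M"
  using U_indep unfolding indep_vars_def by auto

text \<open>Independence yields a product measure over the indices from 1 on; reindexing by
  \<open>Suc\<close> moves it to all natural numbers.\<close>

lemma distr_U: "distr M (PiM UNIV (\<lambda>_::nat. borel)) (\<lambda>\<omega> k. U (Suc k) \<omega>) = PiM UNIV (\<lambda>_::nat. uniform_measure lborel {0<..<1::real})"
proof -
  have rv: "random_variable borel (U k)" if "k \<in> {1..}" for k
    using that U_indep unfolding indep_vars_def by auto
  have 1: "distr M (PiM {1..} (\<lambda>_. borel)) (\<lambda>\<omega>. \<lambda>k\<in>{1..}. U k \<omega>) = PiM {1..} (\<lambda>k. distr M borel (U k))"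
    using U_indep rv by (subst indep_vars_iff_distr_eq_PiM'[symmetric]) auto
  have "PiM UNIV (\<lambda>k. distr M borel (U (Suc k))) =
      distr (PiM {1..} (\<lambda>k. distr M borel (U k))) (PiM UNIV (\<lambda>k. distr M borel (U (Suc k)))) (\<lambda>\<omega>. \<lambda>n\<in>UNIV. \<omega> (Suc n))"
    using rv by (intro distr_PiM_reindex[symmetric] prob_space_distr) auto
  also have "\<dots> = distr (PiM {1..} (\<lambda>k. distr M borel (U k))) (PiM UNIV (\<lambda>_. borel)) (\<lambda>\<omega> n. \<omega> (Suc n))"
    by (intro distr_cong refl sets_PiM_cong) auto
  also have "\<dots> = distr M (PiM UNIV (\<lambda>_. borel)) ((\<lambda>\<omega> n. \<omega> (Suc n)) \<circ> (\<lambda>\<omega>. \<lambda>k\<in>{1..}. U k \<omega>))"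
    unfolding 1[symmetric] using rv
    by (intro distr_distr measurable_PiM_single' measurable_restrict measurable_component_singleton) auto
  also have "(\<lambda>\<omega> n. \<omega> (Suc n)) \<circ> (\<lambda>\<omega>. \<lambda>k\<in>{1..}. U k \<omega>) = (\<lambda>\<omega> k. U (Suc k) \<omega>)"
    by (auto simp: fun_eq_iff)
  finally show ?thesis using U_uniform by simp
qed

lemma nn_integral_truncated_U:
  assumes f [measurable]: "f \<in> borel_measurable borel" and x: "0 < x" and t: "0 \<le> t"
  shows "(\<integral>\<^sup>+\<omega>. truncated R n t f x (\<lambda>k. U k \<omega>) \<partial>M) = W n f t x"
proof -
  have "(\<integral>\<^sup>+\<omega>. truncated R n t f x (\<lambda>k. U k \<omega>) \<partial>M) = (\<integral>\<^sup>+\<omega>. truncated R n t f x (\<lambda>k. U (Suc (k - 1)) \<omega>) \<partial>M)"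
    by (intro nn_integral_cong truncated_cong) simp
  also have "\<dots> = (\<integral>\<^sup>+w. truncated R n t f x (\<lambda>k. w (k - 1)) \<partial>(distr M (PiM UNIV (\<lambda>_::nat. borel)) (\<lambda>\<omega> k. U (Suc k) \<omega>)))"
    by (subst nn_integral_distr) (auto intro!: measurable_PiM_single')
  finally show ?thesis unfolding distr_U using nn_integral_truncated[OF f x t] by simp
qed

lemma cell_process_U_measurable [measurable (raw)]:
  assumes [measurable]: "g \<in> borel_measurable N" "h \<in> measurable N M"
  shows "(\<lambda>y. cell_process R (g y) (\<lambda>k. U k (h y)) t) \<in> borel_measurable N"
proof -
  have "(\<lambda>y. cell_process R (g y) (\<lambda>k. U (Suc (k - 1)) (h y)) t) \<in> borel_measurable N" by measurable
  moreover have "cell_process R (g y) (\<lambda>k. U k (h y)) t = cell_process R (g y) (\<lambda>k. U (Suc (k - 1)) (h y)) t" for y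
    by (rule cell_process_cong) simp
  ultimately show ?thesis by simp
qed

text \<open>Truncation shows only that \<open>Q\<close> is a lower bound for the law. Applied to
  \<open>A\<close> and to its complement, where both sides add up to 1, it leaves no room for a
  strict inequality; non-explosion enters through \<open>Q_one\<close>.\<close>

lemma nn_integral_cell_process:
  assumes A [measurable]: "A \<in> sets borel" and x: "0 < x" and t: "0 \<le> t"
  shows "(\<integral>\<^sup>+\<omega>. indicator A (cell_process R x (\<lambda>k. U k \<omega>) t) \<partial>M) = Q (indicator A) t x"
proof (rule antisym)
  have ge: "Q (indicator B) t x \<le> (\<integral>\<^sup>+\<omega>. indicator B (cell_process R x (\<lambda>k. U k \<omega>) t) \<partial>M)" (is "_ \<le> ?P B")
    if [measurable]: "B \<in> sets borel" for B
    unfolding Q_def using x t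
    by (intro SUP_least) (auto simp: nn_integral_truncated_U[symmetric] intro!: nn_integral_mono truncated_le)
  then show "Q (indicator A) t x \<le> ?P A" by simp
  have "?P A + ?P (- A) = (\<integral>\<^sup>+\<omega>. indicator A (cell_process R x (\<lambda>k. U k \<omega>) t) + indicator (- A) (cell_process R x (\<lambda>k. U k \<omega>) t) \<partial>M)"
    by (intro nn_integral_add[symmetric]) measurable
  also have "\<dots> = (\<integral>\<^sup>+\<omega>. 1 \<partial>M)" by (rule nn_integral_cong) (simp add: indicator_def)
  finally have sum: "?P A + ?P (- A) = 1" by (simp add: emeasure_space_1)
  have "Q (indicator A) t x + Q (indicator (- A)) t x = Q (\<lambda>y. indicator A y + indicator (- A) y) t x"
    using x t by (intro Q_add[symmetric]) auto
  also have "\<dots> = Q (\<lambda>_. 1) t x" using x t by (intro Q_cong) (auto simp: indicator_def)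
  also have "\<dots> = 1" using x t by (rule Q_one)
  finally have "?P A + ?P (- A) \<le> Q (indicator A) t x + ?P (- A)"
    using sum ge[of "- A"] by (metis A borel_comp add_left_mono)
  moreover have "?P (- A) \<noteq> \<top>" using sum by auto
  ultimately show "?P A \<le> Q (indicator A) t x"
    by (simp add: add.commute[of _ "?P (- A)"] ennreal_add_left_cancel_le)
qed

lemma emeasure_cell_law:
  assumes \<nu>: "pos_distribution \<nu>" and A [measurable]: "A \<in> sets borel" and t: "0 \<le> t"
  shows "emeasure (cell_law R M U \<nu> t) A = (\<integral>\<^sup>+x. Q (indicator A) t x \<partial>\<nu>)"
proof -
  interpret \<nu>: prob_space \<nu> using \<nu> by (simp add: pos_distribution_def)
  have [measurable_cong]: "sets \<nu> = sets borel" using \<nu> by (simp add: pos_distribution_def)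
  have pos: "AE x in \<nu>. 0 < x"
    using \<nu> sets_eq_imp_space_eq[of \<nu> borel]
    by (subst \<nu>.AE_iff_emeasure_eq_1) (auto simp: pos_distribution_def greaterThan_def)
  have "emeasure (cell_law R M U \<nu> t) A = (\<integral>\<^sup>+y. indicator A y \<partial>(cell_law R M U \<nu> t))"
    by (simp add: cell_law_def)
  also have "\<dots> = (\<integral>\<^sup>+p. indicator A (cell_process R (fst p) (\<lambda>k. U k (snd p)) t) \<partial>(\<nu> \<Otimes>\<^sub>M M))"
    unfolding cell_law_def by (subst nn_integral_distr) (auto simp: case_prod_beta)
  also have "\<dots> = (\<integral>\<^sup>+x. \<integral>\<^sup>+\<omega>. indicator A (cell_process R x (\<lambda>k. U k \<omega>) t) \<partial>M \<partial>\<nu>)"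
    by (subst nn_integral_fst[symmetric]) auto
  also have "\<dots> = (\<integral>\<^sup>+x. Q (indicator A) t x \<partial>\<nu>)"
    using pos by (intro nn_integral_cong_AE) (auto simp: nn_integral_cell_process t)
  finally show ?thesis .
qed

lemma prob_space_cell_law:
  assumes "pos_distribution \<nu>"
  shows "prob_space (cell_law R M U \<nu> t)"
proof -
  interpret \<nu>: prob_space \<nu> using assms by (simp add: pos_distribution_def)
  interpret P: pair_prob_space \<nu> M ..
  have [measurable_cong]: "sets \<nu> = sets borel" using assms by (simp add: pos_distribution_def)
  show ?thesis unfolding cell_law_def by (intro P.prob_space_distr) (simp add: case_prod_beta)
qed

end

section \<open>The stationary distribution\<close>

text \<open>\<open>h\<close> solves \<open>dh = - h d\<Lambda>\<close>; as \<open>\<Lambda>\<close> need not be differentiable anywhere, the solution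
  formula is obtained by subdividing into pieces of equal \<open>\<Lambda>\<close>-increment.\<close>

lemma exp_decay:
  fixes h \<Lambda> :: "real \<Rightarrow> real"
  assumes ab: "a \<le> b" and cont: "continuous_on {a..b} \<Lambda>"
    and mono: "\<And>x y. a \<le> x \<Longrightarrow> x \<le> y \<Longrightarrow> y \<le> b \<Longrightarrow> \<Lambda> x \<le> \<Lambda> y"
    and lower: "\<And>x y. a \<le> x \<Longrightarrow> x \<le> y \<Longrightarrow> y \<le> b \<Longrightarrow> h y * (1 + (\<Lambda> y - \<Lambda> x)) \<le> h x"
    and upper: "\<And>x y. a \<le> x \<Longrightarrow> x \<le> y \<Longrightarrow> y \<le> b \<Longrightarrow> h x * (1 - (\<Lambda> y - \<Lambda> x)) \<le> h y"
  shows "h a * exp (\<Lambda> a) = h b * exp (\<Lambda> b)"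
proof -
  define d where "d = \<Lambda> b - \<Lambda> a"
  have d: "0 \<le> d" using mono[of a b] ab by (simp add: d_def)
  \<comment> \<open>The subdivision points are preimages under \<Lambda> of equidistant values;
    continuity supplies them.\<close>
  have ivt: "\<exists>x. a \<le> x \<and> x \<le> z \<and> \<Lambda> x = y" if "\<Lambda> a \<le> y" "y \<le> \<Lambda> z" "a \<le> z" "z \<le> b" for y z
    using that cont by (intro IVT') (auto intro: continuous_on_subset)
  \<comment> \<open>Each piece has \<Lambda>-increment \<open>d / n\<close> and contributes one
    factor to either product; \<open>d \<le> n\<close> keeps \<open>1 - d / n\<close> non-negative,
    so that inequalities can be multiplied by it.\<close>
  have step: "h z * (1 + d / n) ^ i \<le> h a \<and> (d \<le> n \<longrightarrow> h a * (1 - d / n) ^ i \<le> h z)"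
    if "z \<in> {a..b}" "\<Lambda> z = \<Lambda> a + i * (d / n)" "0 < n" for z n and i :: nat
    using that
  proof (induction i arbitrary: z)
    case 0
    then show ?case using lower[of a z] upper[of a z] by auto
  next
    case (Suc i)
    have dn: "0 \<le> d / n" using d Suc.prems by simp
    have "\<Lambda> a \<le> \<Lambda> a + i * (d / n)" using dn by (simp del: times_divide_eq_right)
    moreover have "\<Lambda> a + i * (d / n) \<le> \<Lambda> z" using Suc.prems dn by (simp add: algebra_simps)
    ultimately obtain z' where z': "a \<le> z'" "z' \<le> z" "\<Lambda> z' = \<Lambda> a + i * (d / n)"
      using ivt[of "\<Lambda> a + i * (d / n)" z] Suc.prems by auto
    have diff: "\<Lambda> z - \<Lambda> z' = d / n" using z' Suc.prems by (simp add: field_simps)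
    have IH: "h z' * (1 + d / n) ^ i \<le> h a" "d \<le> n \<Longrightarrow> h a * (1 - d / n) ^ i \<le> h z'"
      using Suc.IH[of z'] z' Suc.prems by auto
    have "h z * (1 + d / n) ^ Suc i = (h z * (1 + d / n)) * (1 + d / n) ^ i" by simp
    also have "\<dots> \<le> h z' * (1 + d / n) ^ i"
      using lower[of z' z] z' Suc.prems dn unfolding diff by (intro mult_right_mono) auto
    finally have "h z * (1 + d / n) ^ Suc i \<le> h a" using IH by simp
    moreover have "h a * (1 - d / n) ^ Suc i \<le> h z" if "d \<le> n"
    proof -
      have "h a * (1 - d / n) ^ Suc i = (h a * (1 - d / n) ^ i) * (1 - d / n)" by simp
      also have "\<dots> \<le> h z' * (1 - d / n)" using IH(2) that Suc.prems by (intro mult_right_mono) auto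
      also have "\<dots> \<le> h z" using upper[of z' z] z' Suc.prems unfolding diff by auto
      finally show ?thesis .
    qed
    ultimately show ?case by blast
  qed
  \<comment> \<open>For \<open>i = n\<close> the last point is \<open>b\<close>. The two products
    tend to \<open>exp d\<close> and its reciprocal, so the inequalities close up to an equality in
    the limit.\<close>
  have st: "h b * (1 + d / real n) ^ n \<le> h a \<and> (d \<le> real n \<longrightarrow> h a * (1 - d / real n) ^ n \<le> h b)" if "0 < n" for n
    using step[of b n "real n"] that ab by (simp add: d_def)
  have "h b * exp d \<le> h a"
  proof (rule tendsto_upperbound)
    show "(\<lambda>n. h b * (1 + d / real n) ^ n) \<longlonglongrightarrow> h b * exp d"
      by (intro tendsto_mult tendsto_const tendsto_exp_limit_sequentially)
    show "\<forall>\<^sub>F n in sequentially. h b * (1 + d / real n) ^ n \<le> h a"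
      using eventually_gt_at_top[of 0] by eventually_elim (use st in blast)
  qed simp
  moreover have "h a * exp (- d) \<le> h b"
  proof (rule tendsto_upperbound)
    show "(\<lambda>n. h a * (1 + (- d) / real n) ^ n) \<longlonglongrightarrow> h a * exp (- d)"
      by (intro tendsto_mult tendsto_const tendsto_exp_limit_sequentially)
    show "\<forall>\<^sub>F n in sequentially. h a * (1 + (- d) / real n) ^ n \<le> h b"
      using eventually_gt_at_top[of 0] eventually_ge_at_top[of "nat \<lceil>d\<rceil>"]
      by eventually_elim (use st in \<open>auto simp: nat_le_iff ceiling_le_iff\<close>)
  qed simp
  then have "h a \<le> h b * exp d" by (simp add: exp_minus field_simps)
  ultimately have "h a = h b * exp d" by simp
  also have "exp d = exp (\<Lambda> b) / exp (\<Lambda> a)" by (simp add: d_def exp_diff)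
  finally show ?thesis by simp
qed

section \<open>The integrated jump rate and the survival function\<close>

locale jump_rate =
  fixes R :: "real \<Rightarrow> real"
  assumes R_borel: "R \<in> borel_measurable (restrict_space borel {0..})"
    and R_nonneg: "\<And>x. 0 \<le> x \<Longrightarrow> 0 \<le> R x"
    and R_locally_integrable: "\<And>k. 0 < k \<Longrightarrow> (\<integral>\<^sup>+x\<in>{0..k}. ennreal (R x) \<partial>lborel) < \<infinity>"
begin

definition Lam :: "real \<Rightarrow> real" where
  "Lam z = (LBINT y:{0..z}. R y)"

text \<open>Nothing is assumed about \<open>R\<close> on the negative axis; the extension by 0 is
  measurable and non-negative on the whole line.\<close>

definition R0 :: "real \<Rightarrow> real" where
  "R0 y = indicator {0..} y * R y"

lemma R0_measurable [measurable]: "R0 \<in> borel_measurable borel"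
  using R_borel unfolding R0_def[abs_def] by (subst (asm) borel_measurable_restrict_space_iff) auto

lemma R0_nonneg: "0 \<le> R0 y"
  using R_nonneg by (simp add: R0_def indicator_def)

lemma R0_eq: "0 \<le> y \<Longrightarrow> R0 y = R y"
  by (simp add: R0_def)

lemma R0_integrable: "set_integrable lborel {a..b} R0"
proof -
  have "(\<integral>\<^sup>+x. ennreal (indicator {a..b} x * R0 x) \<partial>lborel) \<le> (\<integral>\<^sup>+x\<in>{0..max 1 b}. ennreal (R x) \<partial>lborel)"
    by (intro nn_integral_mono) (auto simp: indicator_def R0_def)
  also have "\<dots> < \<infinity>" by (rule R_locally_integrable) simp
  finally show ?thesis
    unfolding set_integrable_def using R0_nonneg
    by (intro integrableI_nonneg) auto
qed

lemma Lam_R0: "Lam z = (LBINT y:{0..z}. R0 y)"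
  unfolding Lam_def by (intro set_lebesgue_integral_cong) (auto simp: R0_eq)

lemma LBINT_R0: "(LBINT y:{a..b}. R0 y) = integral {a..b} R0" and R0_integrable_on: "R0 integrable_on {a..b}"
  using set_borel_integral_eq_integral[OF R0_integrable] by auto

lemma Lam_diff: "0 \<le> a \<Longrightarrow> a \<le> b \<Longrightarrow> Lam b - Lam a = (LBINT y:{a..b}. R0 y)"
  using Henstock_Kurzweil_Integration.integral_combine[of 0 a b R0] R0_integrable_on by (simp add: Lam_R0 LBINT_R0)

lemma Lam_diff_nn:
  assumes "0 \<le> a" "a \<le> b"
  shows "(\<integral>\<^sup>+y. ennreal (R0 y) * indicator {a<..b} y \<partial>lborel) = ennreal (Lam b - Lam a)"
proof -
  have "(\<integral>\<^sup>+y. ennreal (R0 y) * indicator {a<..b} y \<partial>lborel) = (\<integral>\<^sup>+y. ennreal (indicator {a..b} y *\<^sub>R R0 y) \<partial>lborel)"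
    by (intro nn_integral_cong_AE eventually_mono[OF AE_lborel_singleton[of a]]) (auto simp: indicator_def)
  also have "\<dots> = ennreal (LBINT y:{a..b}. R0 y)"
    unfolding set_lebesgue_integral_def using R0_integrable[of a b] R0_nonneg
    by (intro nn_integral_eq_integral) (auto simp: set_integrable_def)
  finally show ?thesis using Lam_diff[OF assms] by simp
qed

lemma Lam_nonpos: "z \<le> 0 \<Longrightarrow> Lam z = 0"
  unfolding Lam_R0 LBINT_R0 by (cases "z = 0") auto

lemma Lam_mono: "x \<le> y \<Longrightarrow> Lam x \<le> Lam y"
proof -
  assume xy: "x \<le> y"
  have nonneg: "0 \<le> (LBINT u:{a..b}. R0 u)" for a b
    unfolding LBINT_R0 by (intro integral_nonneg R0_integrable_on) (simp add: R0_nonneg)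
  show ?thesis
  proof (cases "0 \<le> x")
    case True
    then show ?thesis using Lam_diff[of x y] nonneg[of x y] xy by simp
  next
    case False
    then show ?thesis using Lam_nonpos[of x] nonneg[of 0 y] by (simp add: Lam_R0[of y])
  qed
qed

lemma Lam_cont: "continuous_on UNIV Lam"
proof -
  \<comment> \<open>Starting the integral at -1 makes 0 an interior point of the interval on which
    the indefinite integral is continuous.\<close>
  have eq: "Lam x = integral {-1..x} R0" if "-1 \<le> x" for x
  proof (cases "0 \<le> x")
    case True
    have "(LBINT y:{-1..0}. R0 y) = 0"
      unfolding set_lebesgue_integral_def
      by (rule integral_eq_zero_AE) (auto intro!: eventually_mono[OF AE_lborel_singleton[of 0]] simp: R0_def indicator_def split: if_splits)
    then have "integral {-1..0} R0 = 0" by (simp only: LBINT_R0)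
    then show ?thesis
      using True Henstock_Kurzweil_Integration.integral_combine[of "-1" 0 x R0] R0_integrable_on[of "-1" x] by (simp add: Lam_R0 LBINT_R0)
  next
    case False
    have "integral {-1..x} R0 = integral {-1..x} (\<lambda>_. 0)"
      by (rule Henstock_Kurzweil_Integration.integral_cong) (use False in \<open>auto simp: R0_def\<close>)
    then show ?thesis using False by (simp add: Lam_nonpos)
  qed
  have "isCont Lam z" for z
  proof (cases "z < 0")
    case True
    have "\<forall>\<^sub>F x in nhds z. Lam x = 0"
      using eventually_nhds_in_open[of "{..<0}" z] True by (auto elim!: eventually_mono simp: Lam_nonpos)
    then show ?thesis by (subst isCont_cong[of _ "\<lambda>_. 0"]) auto
  next
    case False
    have "continuous_on {-1..z+1} Lam"
      using indefinite_integral_continuous_1[OF R0_integrable_on[of "-1" "z+1"]] eq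
      by (subst continuous_on_cong[OF refl, of _ Lam "\<lambda>x. integral {-1..x} R0"]) auto
    then show ?thesis using False by (intro continuous_on_interior) auto
  qed
  then show ?thesis by (simp add: continuous_at_imp_continuous_on)
qed

text \<open>For negative \<open>z\<close> the interval from \<open>z\<close> to
  \<open>z * exp t\<close> is empty or a single point, so survival is 1, in agreement with the
  vanishing of \<open>Lam\<close> there.\<close>

lemma survival_Lam:
  assumes t: "0 \<le> t"
  shows "survival R z t = exp (- Lam (z * exp t)) / exp (- Lam z)"
proof (cases "0 \<le> z")
  case True
  then have "z \<le> z * exp t" using t by (simp add: mult_le_cancel_left1)
  then have "Lam (z * exp t) - Lam z = (LBINT y:{z..z * exp t}. R0 y)" using True by (intro Lam_diff)
  also have "\<dots> = (LBINT y:{z..z * exp t}. R y)" using True by (intro set_lebesgue_integral_cong) (auto simp: R0_eq)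
  finally show ?thesis by (simp add: survival_def exp_diff[symmetric])
next
  case False
  then have neg: "z * exp t \<le> 0" by (simp add: mult_nonpos_nonneg)
  have "(LBINT y:{z..z * exp t}. R y) = 0"
  proof (cases "t = 0")
    case True
    have "(LBINT y:{z..z}. R y) = 0"
      unfolding set_lebesgue_integral_def
      by (rule integral_eq_zero_AE) (auto intro!: eventually_mono[OF AE_lborel_singleton[of z]])
    then show ?thesis using True by simp
  next
    case False
    then have "z * exp t < z" using t \<open>\<not> 0 \<le> z\<close> by (simp add: mult_less_cancel_left2)
    then show ?thesis by (simp add: set_lebesgue_integral_def)
  qed
  then show ?thesis using neg False by (simp add: survival_def Lam_nonpos)
qed

end

section \<open>Solving the stationary equation\<close>

locale stationary_jump_rate = jump_rate R for R +
  fixes F :: "ennreal \<Rightarrow> real"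
  assumes stationarity: "(\<lambda>t. F) \<in> evolution_family R"
begin

text \<open>Membership in \<open>dist_funs\<close> is implicit in the measurability of the constant
  family, whose values must lie in the space of \<open>L1loc_borel\<close>.\<close>

lemma F_dist: "F \<in> dist_funs"
proof -
  have "(\<lambda>t::real. F) \<in> measurable (restrict_space borel {0..}) L1loc_borel"
    using stationarity[unfolded evolution_family_def, THEN CollectD, THEN conjunct1] .
  then have "F \<in> space L1loc_borel" by (rule measurable_space[where x=0]) (simp add: space_restrict_space)
  then show ?thesis by (simp add: L1loc_borel_def space_measure_of_conv)
qed

lemma F_mono: "x \<le> y \<Longrightarrow> F x \<le> F y"
  and F_range: "0 \<le> F x" "F x \<le> 1"
  and F_right: "(F \<longlongrightarrow> F x) (at_right x)"
  and F_left_top: "(F \<longlongrightarrow> F \<top>) (at_left \<top>)"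
  using F_dist by (auto simp: dist_funs_def continuous_within dest: monoD)

lemma F_top: "F \<top> = 1" and F_0: "F 0 = 0"
  using stationarity by (auto simp: evolution_family_def)

definition G :: "real \<Rightarrow> real" where
  "G x = (if x < 0 then 0 else F (ennreal x))"

lemma G_mono: "x \<le> y \<Longrightarrow> G x \<le> G y"
  using F_mono F_range by (auto simp: G_def ennreal_leI)

lemma filterlim_ennreal_at_right: "0 \<le> a \<Longrightarrow> filterlim ennreal (at_right (ennreal a)) (at_right a)"
  unfolding filterlim_at
proof (intro conjI)
  assume a: "0 \<le> a"
  show "\<forall>\<^sub>F x in at_right a. ennreal x \<in> {ennreal a<..} \<and> ennreal x \<noteq> ennreal a"
    using eventually_at_right_less[of a]
  proof eventually_elim
    case (elim x)
    then have "ennreal a < ennreal x" using a by (subst ennreal_less_iff) auto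
    then show ?case by auto
  qed
  show "(ennreal \<longlongrightarrow> ennreal a) (at_right a)"
    by (intro tendsto_ennrealI tendsto_ident_at)
qed

lemma G_right: "continuous (at_right a) G"
proof (cases "a < 0")
  case True
  then have "\<forall>\<^sub>F x in at_right a. x < 0" by (intro eventually_at_rightI[of a 0]) auto
  then have "\<forall>\<^sub>F x in at_right a. G x = 0" by eventually_elim (simp add: G_def)
  then show ?thesis using True by (simp add: continuous_within G_def tendsto_eventually)
next
  case False
  have "((\<lambda>x. F (ennreal x)) \<longlongrightarrow> F (ennreal a)) (at_right a)"
    using False by (intro filterlim_compose[OF F_right filterlim_ennreal_at_right]) auto
  moreover have "\<forall>\<^sub>F x in at_right a. F (ennreal x) = G x"
    using eventually_at_right_less[of a] by eventually_elim (use False in \<open>simp add: G_def\<close>)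
  ultimately have "(G \<longlongrightarrow> F (ennreal a)) (at_right a)" by (rule Lim_transform_eventually)
  then show ?thesis using False by (simp add: continuous_within G_def)
qed

lemma G_bot: "(G \<longlongrightarrow> 0) at_bot"
proof (rule tendsto_eventually)
  show "\<forall>\<^sub>F x in at_bot. G x = 0"
    using eventually_gt_at_bot[of 0] by eventually_elim (simp add: G_def)
qed

lemma G_top: "(G \<longlongrightarrow> 1) at_top"
proof -
  have "filterlim ennreal (at_left \<top>) at_top"
    unfolding filterlim_at
  proof (intro conjI)
    show "(ennreal \<longlongrightarrow> \<top>) at_top"
    proof (rule order_tendstoI)
      fix a :: ennreal assume "a < \<top>"
      then obtain r where r: "a = ennreal r" "0 \<le> r" by (cases a) auto
      show "\<forall>\<^sub>F x in at_top. a < ennreal x"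
        using eventually_gt_at_top[of r] by eventually_elim (use r in \<open>simp add: ennreal_less_iff\<close>)
    qed simp
  qed simp
  then have "((\<lambda>x. F (ennreal x)) \<longlongrightarrow> 1) at_top"
    using filterlim_compose[OF F_left_top] F_top by simp
  moreover have "\<forall>\<^sub>F x in at_top. F (ennreal x) = G x"
    using eventually_ge_at_top[of 0] by eventually_elim (simp add: G_def)
  ultimately show ?thesis by (rule Lim_transform_eventually)
qed

lemma stieltjes_eq: "stieltjes F = interval_measure G"
  by (simp add: stieltjes_def G_def[abs_def])

lemma real_distribution_stieltjes: "real_distribution (stieltjes F)"
  unfolding stieltjes_eq by (intro real_distribution_interval_measure G_mono G_right G_bot G_top)

lemma cdf_stieltjes: "cdf (stieltjes F) = G"
  unfolding stieltjes_eq by (intro cdf_interval_measure G_mono G_right G_bot)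

lemma sets_stieltjes [measurable_cong, simp]: "sets (stieltjes F) = sets borel" and space_stieltjes [simp]: "space (stieltjes F) = UNIV"
  by (simp_all add: stieltjes_eq)

definition g :: "real \<Rightarrow> ennreal" where
  "g y = (\<integral>\<^sup>+z. ennreal (R0 z / z) * indicator {y<..} z \<partial>stieltjes F)"

lemma g_antimono: "x \<le> y \<Longrightarrow> g y \<le> g x"
  unfolding g_def by (intro nn_integral_mono) (auto simp: indicator_def)

lemma g_measurable [measurable]: "g \<in> borel_measurable borel"
proof -
  interpret real_distribution "stieltjes F" by (rule real_distribution_stieltjes)
  have [measurable]: "Measurable.pred (borel \<Otimes>\<^sub>M borel) (\<lambda>p::real\<times>real. snd p \<in> {fst p<..})" by simp
  show ?thesis unfolding g_def[abs_def] indicator_def by measurable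
qed

text \<open>The time \<open>t = ln (x / a)\<close> makes \<open>exp (- t) * x\<close> equal to
  \<open>a\<close>. With \<open>y = exp (s - t) * x\<close> one has \<open>dy = y ds\<close>, so one
  factor of the square in the evolution equation is the Jacobian.\<close>

lemma F_increment:
  assumes a: "0 < a" "a \<le> x"
  shows "ennreal (G x) = ennreal (G a) + (\<integral>\<^sup>+y. ennreal y * g y * indicator {a..x} y \<partial>lborel)"
proof (cases "a = x")
  case True
  have "(\<integral>\<^sup>+y. ennreal y * g y * indicator {a..x} y \<partial>lborel) = 0"
    using True by (intro nn_integral_zero'[OF eventually_mono[OF AE_lborel_singleton[of a]]]) (auto simp: indicator_def)
  then show ?thesis using True by simp
next
  case False
  define t where "t = ln (x / a)"
  have x: "0 < x" using a by simp
  have t: "0 < t" unfolding t_def using a False by (intro ln_gt_zero) simp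
  have et: "exp (- t) * x = a" using a x by (simp add: t_def exp_minus)
  have "ennreal (F (ennreal x)) = ennreal (F (ennreal (exp (- t) * x))) +
        (\<integral>\<^sup>+s\<in>{0..t}. ennreal ((exp (s - t) * x)\<^sup>2) *
           (\<integral>\<^sup>+z\<in>{exp (s - t) * x<..}. ennreal (R z / z) \<partial>stieltjes F) \<partial>lborel)"
    using stationarity t x by (simp add: evolution_family_def)
  also have "(\<integral>\<^sup>+s\<in>{0..t}. ennreal ((exp (s - t) * x)\<^sup>2) *
           (\<integral>\<^sup>+z\<in>{exp (s - t) * x<..}. ennreal (R z / z) \<partial>stieltjes F) \<partial>lborel) =
     (\<integral>\<^sup>+s. (ennreal (exp (s - t) * x) * g (exp (s - t) * x)) * ennreal (exp (s - t) * x) * indicator {0..t} s \<partial>lborel)"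
  proof (rule nn_integral_cong)
    fix s
    have p: "0 < exp (s - t) * x" using x by simp
    have "(\<integral>\<^sup>+z\<in>{exp (s - t) * x<..}. ennreal (R z / z) \<partial>stieltjes F) = g (exp (s - t) * x)"
      unfolding g_def using p by (intro nn_integral_cong) (auto simp: indicator_def R0_eq dest: less_trans)
    moreover have "ennreal ((exp (s - t) * x)\<^sup>2) = ennreal (exp (s - t) * x) * ennreal (exp (s - t) * x)"
      using p by (simp add: power2_eq_square ennreal_mult)
    ultimately show "ennreal ((exp (s - t) * x)\<^sup>2) * (\<integral>\<^sup>+z\<in>{exp (s - t) * x<..}. ennreal (R z / z) \<partial>stieltjes F) * indicator {0..t} s
      = (ennreal (exp (s - t) * x) * g (exp (s - t) * x)) * ennreal (exp (s - t) * x) * indicator {0..t} s"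
      by (simp only: mult_ac)
  qed
  also have "\<dots> = (\<integral>\<^sup>+y. ennreal y * g y * indicator {exp (0 - t) * x..exp (t - t) * x} y \<partial>lborel)"
    using t x by (intro nn_integral_substitution_aux[symmetric]) (auto intro!: derivative_eq_intros continuous_intros)
  finally show ?thesis using a x et by (simp add: G_def)
qed

text \<open>As \<open>g\<close> is non-increasing, an infinite value at \<open>y\<close> would
  persist on \<open>[y/2, y]\<close> and make the increment of \<open>G\<close> there
  infinite.\<close>

lemma g_finite:
  assumes y: "0 < y"
  shows "g y < \<top>"
proof (rule ccontr)
  assume "\<not> g y < \<top>"
  then have top: "g y = \<top>" by (simp add: less_top[symmetric])
  have "(\<integral>\<^sup>+z. \<top> * indicator {y/2..y} z \<partial>lborel) \<le> (\<integral>\<^sup>+z. ennreal z * g z * indicator {y/2..y} z \<partial>lborel)"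
  proof (rule nn_integral_mono)
    fix z
    have "g z = \<top>" if "z \<le> y" using g_antimono[OF that] top by (simp add: top_unique)
    then show "\<top> * indicator {y/2..y} z \<le> ennreal z * g z * indicator {y/2..y} z"
      using y by (auto simp: indicator_def ennreal_mult_top)
  qed
  also have "\<dots> \<le> ennreal (G y)" using F_increment[of "y/2" y] y by simp
  also have "\<dots> < \<top>" by simp
  also have "(\<integral>\<^sup>+z. \<top> * indicator {y/2..y} z \<partial>lborel) = \<top> * emeasure lborel {y/2..y}"
    by (rule nn_integral_cmult_indicator) simp
  finally show False using y by (simp add: ennreal_top_mult)
qed

definition dens :: "real measure" where
  "dens = density lborel (\<lambda>y. ennreal y * g y * indicator {0<..} y)"

text \<open>\<open>F_increment\<close> stays away from 0, so it is used from
  \<open>x / real (Suc n)\<close> to \<open>x\<close>; the values of \<open>G\<close> at the left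
  ends tend to \<open>F 0 = 0\<close> by right continuity.\<close>

lemma emeasure_dens_Iic: "emeasure dens {..x} = ennreal (G x)"
proof (cases "0 < x")
  case False
  have "emeasure dens {..x} = (\<integral>\<^sup>+y. 0 \<partial>(lborel :: real measure))"
    unfolding dens_def
  proof (subst emeasure_density)
    show "(\<integral>\<^sup>+y. ennreal y * g y * indicator {0<..} y * indicator {..x} y \<partial>lborel) = (\<integral>\<^sup>+y. 0 \<partial>(lborel :: real measure))"
      by (rule nn_integral_cong) (use False in \<open>simp add: indicator_def\<close>)
  qed auto
  then show ?thesis using False F_0 by (cases "x = 0") (auto simp: G_def)
next
  case True
  let ?a = "\<lambda>n. x / real (Suc n)"
  have a: "0 < ?a n" "?a n \<le> x" for n using True by (auto simp: field_simps)
  have "emeasure dens {..x} = (\<integral>\<^sup>+y. (SUP n. ennreal y * g y * indicator {?a n..x} y) \<partial>lborel)"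
    unfolding dens_def
  proof (subst emeasure_density)
    show "(\<integral>\<^sup>+y. ennreal y * g y * indicator {0<..} y * indicator {..x} y \<partial>lborel) = (\<integral>\<^sup>+y. (SUP n. ennreal y * g y * indicator {?a n..x} y) \<partial>lborel)"
    proof (rule nn_integral_cong)
      fix y
      have "(SUP n. indicator {?a n..x} y) = (indicator {0<..x} y :: ennreal)"
      proof (cases "y \<in> {0<..x}")
        case True
        obtain n where n: "x / y \<le> real n" using real_arch_simple by blast
        then have "?a n \<le> y" using True by (simp add: field_simps)
        then have "indicator {?a n..x} y = (1::ennreal)" using True by simp
        then have "1 \<le> (SUP n. indicator {?a n..x} y :: ennreal)" by (intro SUP_upper2[of n]) auto
        moreover have "(SUP n. indicator {?a n..x} y :: ennreal) \<le> 1" by (intro SUP_least) (auto simp: indicator_def)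
        ultimately show ?thesis using True by simp
      next
        case False
        then have "indicator {?a n..x} y = (0::ennreal)" for n using a(1)[of n] by (auto simp: indicator_def)
        then show ?thesis using False by simp
      qed
      then show "ennreal y * g y * indicator {0<..} y * indicator {..x} y = (SUP n. ennreal y * g y * indicator {?a n..x} y)"
        by (simp add: SUP_mult_left_ennreal[symmetric]) (auto simp: indicator_def)
    qed
  qed auto
  also have "\<dots> = (SUP n. \<integral>\<^sup>+y. ennreal y * g y * indicator {?a n..x} y \<partial>lborel)"
  proof (rule nn_integral_monotone_convergence_SUP)
    have "?a n \<le> ?a m" if "m \<le> n" for m n using True that by (intro divide_left_mono) auto
    then show "incseq (\<lambda>n y. ennreal y * g y * indicator {?a n..x} y)"
      by (auto simp: incseq_def le_fun_def indicator_def intro: order_trans)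
  qed auto
  finally have eq: "emeasure dens {..x} = (SUP n. \<integral>\<^sup>+y. ennreal y * g y * indicator {?a n..x} y \<partial>lborel)" .
  have inc: "(\<integral>\<^sup>+y. ennreal y * g y * indicator {?a n..x} y \<partial>lborel) = ennreal (G x - G (?a n))" for n
  proof -
    have "ennreal (G x) - ennreal (G (?a n)) = (\<integral>\<^sup>+y. ennreal y * g y * indicator {?a n..x} y \<partial>lborel)"
      using F_increment[OF a, of n] by simp
    then show ?thesis using F_range by (simp add: ennreal_minus G_def)
  qed
  have "?a \<longlonglongrightarrow> 0"
    using tendsto_mult_right_zero[OF LIMSEQ_inverse_real_of_nat, of x] by (simp only: divide_inverse)
  then have "filterlim ?a (at_right 0) sequentially"
    unfolding filterlim_at using True by auto
  moreover have "(G \<longlongrightarrow> 0) (at_right 0)" using G_right[of 0] F_0 by (simp add: continuous_within G_def)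
  ultimately have "(\<lambda>n. G (?a n)) \<longlonglongrightarrow> 0" by (rule filterlim_compose[rotated])
  then have "(\<lambda>n. ennreal (G x - G (?a n))) \<longlonglongrightarrow> ennreal (G x - 0)"
    by (intro tendsto_ennrealI tendsto_diff tendsto_const)
  moreover have "incseq (\<lambda>n. ennreal (G x - G (?a n)))"
    using True by (auto simp: incseq_def intro!: ennreal_leI diff_left_mono G_mono divide_left_mono)
  ultimately show ?thesis unfolding eq inc using LIMSEQ_SUP LIMSEQ_unique by fastforce
qed

lemma stieltjes_eq_dens: "stieltjes F = dens"
proof (rule cdf_unique')
  interpret S: real_distribution "stieltjes F" by (rule real_distribution_stieltjes)
  show "finite_borel_measure (stieltjes F)" by (rule S.finite_borel_measure_M)
  have sets: "sets dens = sets borel" by (simp add: dens_def)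
  have "emeasure dens UNIV = (SUP n. emeasure dens {..real n})"
  proof (subst SUP_emeasure_incseq)
    have "(\<Union>n. {..real n}) = UNIV" by (auto intro!: real_arch_simple)
    then show "emeasure dens UNIV = emeasure dens (\<Union>n. {..real n})" by simp
  qed (auto simp: sets incseq_def)
  also have "\<dots> \<le> 1" unfolding emeasure_dens_Iic using F_range by (intro SUP_least) (auto simp: G_def)
  finally have "emeasure dens UNIV \<noteq> \<infinity>" by (auto simp: top_unique)
  then show "finite_borel_measure dens"
    by (intro finite_borel_measure.intro finite_measureI finite_borel_measure_axioms.intro) (simp_all add: sets sets_eq_imp_space_eq[OF sets])
  show "cdf (stieltjes F) = cdf dens"
  proof
    fix x
    have "0 \<le> G x" by (simp add: G_def F_range)
    then show "cdf (stieltjes F) x = cdf dens x"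
      unfolding cdf_stieltjes by (simp add: cdf_def measure_def emeasure_dens_Iic)
  qed
qed

lemma g_increment:
  assumes a: "0 < a" "a \<le> b"
  shows "g a = g b + (\<integral>\<^sup>+z. ennreal (R0 z) * g z * indicator {a<..b} z \<partial>lborel)"
proof -
  have "g a = (\<integral>\<^sup>+z. ennreal (R0 z / z) * indicator {b<..} z + ennreal (R0 z / z) * indicator {a<..b} z \<partial>stieltjes F)"
    unfolding g_def using a by (intro nn_integral_cong) (auto simp: indicator_def)
  also have "\<dots> = g b + (\<integral>\<^sup>+z. ennreal (R0 z / z) * indicator {a<..b} z \<partial>stieltjes F)"
    unfolding g_def by (intro nn_integral_add) auto
  also have "(\<integral>\<^sup>+z. ennreal (R0 z / z) * indicator {a<..b} z \<partial>stieltjes F) = (\<integral>\<^sup>+z. ennreal (R0 z) * g z * indicator {a<..b} z \<partial>lborel)"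
    unfolding stieltjes_eq_dens dens_def
  proof (subst nn_integral_density)
    show "(\<integral>\<^sup>+z. ennreal z * g z * indicator {0<..} z * (ennreal (R0 z / z) * indicator {a<..b} z) \<partial>lborel) =
      (\<integral>\<^sup>+z. ennreal (R0 z) * g z * indicator {a<..b} z \<partial>lborel)"
    proof (rule nn_integral_cong)
      fix z
      have "ennreal z * ennreal (R0 z / z) = ennreal (R0 z)" if "0 < z"
        using that R0_nonneg[of z] by (simp add: ennreal_mult[symmetric])
      moreover have "ennreal z * g z * indicator {0<..} z * (ennreal (R0 z / z) * indicator {a<..b} z) =
          (ennreal z * ennreal (R0 z / z)) * g z * indicator {0<..} z * indicator {a<..b} z"
        by (simp only: mult_ac)
      ultimately show "ennreal z * g z * indicator {0<..} z * (ennreal (R0 z / z) * indicator {a<..b} z) = ennreal (R0 z) * g z * indicator {a<..b} z"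
        using a by (cases "z \<in> {a<..b}") (auto simp: indicator_def)
    qed
  qed auto
  finally show ?thesis .
qed

definition gr :: "real \<Rightarrow> real" where "gr y = enn2real (g y)"

lemma g_gr: "0 < y \<Longrightarrow> g y = ennreal (gr y)" and gr_nonneg: "0 \<le> gr y"
  using g_finite[of y] by (simp_all add: gr_def)

text \<open>On \<open>(a, b]\<close> the non-increasing \<open>g\<close> lies between
  \<open>g b\<close> and \<open>g a\<close>, which encloses the integral in
  \<open>g_increment\<close>. These are the two discrete inequalities that \<open>exp_decay\<close>
  asks for.\<close>

lemma gr_increment:
  assumes a: "0 < a" "a \<le> b"
  shows "gr b * (1 + (Lam b - Lam a)) \<le> gr a" "gr a * (1 - (Lam b - Lam a)) \<le> gr b"
proof -
  have b: "0 < b" using a by simp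
  let ?I = "\<integral>\<^sup>+z. ennreal (R0 z) * g z * indicator {a<..b} z \<partial>lborel"
  have d: "0 \<le> Lam b - Lam a" using Lam_mono[of a b] a by simp
  have L: "(\<integral>\<^sup>+z. ennreal (R0 z) * indicator {a<..b} z \<partial>lborel) = ennreal (Lam b - Lam a)"
    using Lam_diff_nn a by simp
  have "(\<integral>\<^sup>+z. ennreal (R0 z) * indicator {a<..b} z * g b \<partial>lborel) \<le> ?I"
    by (intro nn_integral_mono) (auto simp: indicator_def intro!: mult_left_mono g_antimono)
  then have 1: "ennreal (Lam b - Lam a) * g b \<le> ?I"
    by (subst (asm) nn_integral_multc) (auto simp: L)
  have "?I \<le> (\<integral>\<^sup>+z. ennreal (R0 z) * indicator {a<..b} z * g a \<partial>lborel)"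
    by (intro nn_integral_mono) (auto simp: indicator_def intro!: mult_left_mono g_antimono)
  then have 2: "?I \<le> ennreal (Lam b - Lam a) * g a"
    by (subst (asm) nn_integral_multc) (auto simp: L)
  have "g b + ennreal (Lam b - Lam a) * g b \<le> g a"
    using 1 g_increment[OF a] by (simp add: add_left_mono)
  then have "ennreal (gr b + (Lam b - Lam a) * gr b) \<le> ennreal (gr a)"
    using d gr_nonneg by (simp add: g_gr a b ennreal_mult)
  then show "gr b * (1 + (Lam b - Lam a)) \<le> gr a"
    using gr_nonneg by (simp add: algebra_simps)
  have "g a \<le> g b + ennreal (Lam b - Lam a) * g a"
    using 2 g_increment[OF a] by (simp add: add_left_mono)
  then have "ennreal (gr a) \<le> ennreal (gr b + (Lam b - Lam a) * gr a)"
    using d gr_nonneg by (simp add: g_gr a b ennreal_mult)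
  then have "gr a \<le> gr b + (Lam b - Lam a) * gr a"
    using d gr_nonneg by (subst (asm) ennreal_le_iff) auto
  then show "gr a * (1 - (Lam b - Lam a)) \<le> gr b" by (simp add: algebra_simps)
qed

text \<open>The product \<open>gr y * exp (Lam y)\<close> is constant on the positive half-line; 1
  is an arbitrary reference point.\<close>

definition C :: real where "C = gr 1 * exp (Lam 1)"

lemma gr_eq: "0 < y \<Longrightarrow> gr y = C * exp (- Lam y)"
proof -
  assume y: "0 < y"
  have *: "gr a * exp (Lam a) = gr b * exp (Lam b)" if "0 < a" "a \<le> b" for a b
    using that gr_increment by (intro exp_decay) (auto intro: Lam_mono continuous_on_subset[OF Lam_cont])
  then have "gr y * exp (Lam y) = C"
    unfolding C_def using *[OF y, of 1] *[OF zero_less_one, of y] by (metis linear)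
  then show ?thesis by (auto simp: exp_minus field_simps)
qed

lemma Lam_measurable [measurable]: "Lam \<in> borel_measurable borel"
  using Lam_cont by (rule borel_measurable_continuous_onI)

lemma stieltjes_density: "stieltjes F = density lborel (\<lambda>y. ennreal (C * y * exp (- Lam y)) * indicator {0<..} y)"
  unfolding stieltjes_eq_dens dens_def
proof (intro arg_cong2[where f=density] refl ext)
  fix y
  show "ennreal y * g y * indicator {0<..} y = ennreal (C * y * exp (- Lam y)) * indicator {0<..} y"
    using gr_nonneg[of y] by (auto simp: indicator_def g_gr gr_eq ennreal_mult[symmetric] mult_ac)
qed

lemma total_mass: "(\<integral>\<^sup>+y. ennreal (C * y * exp (- Lam y)) * indicator {0<..} y \<partial>lborel) = 1"
proof -
  interpret S: real_distribution "stieltjes F" by (rule real_distribution_stieltjes)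
  have "emeasure (stieltjes F) UNIV = 1" using S.emeasure_space_1 by simp
  then show ?thesis unfolding stieltjes_density by (subst (asm) emeasure_density) auto
qed

lemma C_pos: "0 < C"
proof -
  have "0 \<le> C" using gr_nonneg by (simp add: C_def)
  moreover have "C \<noteq> 0" using total_mass by auto
  ultimately show ?thesis by simp
qed

text \<open>Were \<open>exp (- Lam y)\<close> bounded below by some \<open>e > 0\<close>, the
  stationary density would be at least \<open>C * e\<close> on \<open>(1, \<infinity>)\<close> and
  could not have total mass 1. So stationarity forces the integrated rate to diverge.\<close>

lemma exp_Lam_lim: "((\<lambda>x. exp (- Lam x)) \<longlongrightarrow> 0) at_top"
proof -
  have ex: "\<exists>y. exp (- Lam y) < e" if e: "0 < e" for e
  proof (rule ccontr)
    assume "\<not> ?thesis"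
    then have ge: "e \<le> exp (- Lam y)" for y by (simp add: not_less)
    have "ennreal (C * e) * ennreal n \<le> 1" if n: "0 \<le> n" for n
    proof -
      have "ennreal (C * e) * ennreal n = (\<integral>\<^sup>+y. ennreal (C * e) * indicator {1<..<1+n} y \<partial>lborel)"
        using n by (simp add: nn_integral_cmult)
      also have "\<dots> \<le> (\<integral>\<^sup>+y. ennreal (C * y * exp (- Lam y)) * indicator {0<..} y \<partial>lborel)"
      proof (rule nn_integral_mono)
        fix y
        have "C * e \<le> C * y * exp (- Lam y)" if "1 < y"
          using mult_mono[of 1 y e "exp (- Lam y)"] ge[of y] e that C_pos by simp
        then show "ennreal (C * e) * indicator {1<..<1+n} y \<le> ennreal (C * y * exp (- Lam y)) * indicator {0<..} y"
          by (auto simp: indicator_def intro!: ennreal_leI)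
      qed
      finally show ?thesis using total_mass by simp
    qed
    then have "C * e * n \<le> 1" if "0 \<le> n" for n using that C_pos e by (simp add: ennreal_mult[symmetric])
    from this[of "2 / (C * e)"] show False using C_pos e by simp
  qed
  show ?thesis
  proof (rule order_tendstoI)
    fix e :: real assume "e < 0"
    then show "\<forall>\<^sub>F x in at_top. e < exp (- Lam x)" by (intro always_eventually) (auto intro: less_trans)
  next
    fix e :: real assume "0 < e"
    then obtain y where y: "exp (- Lam y) < e" using ex by blast
    show "\<forall>\<^sub>F x in at_top. exp (- Lam x) < e"
      using eventually_ge_at_top[of y]
    proof eventually_elim
      case (elim x)
      then have "exp (- Lam x) \<le> exp (- Lam y)" using Lam_mono by simp
      then show ?case using y by linarith
    qed
  qed
qed

sublocale cell_model "\<lambda>x. exp (- Lam x)" C R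
proof
  show "continuous_on UNIV (\<lambda>x. exp (- Lam x))" by (intro continuous_intros Lam_cont)
qed (simp_all add: Lam_mono Lam_nonpos exp_Lam_lim C_pos total_mass survival_Lam)

lemma equil_eq: "equil = stieltjes F"
  unfolding equil_def stieltjes_density ..

end

section \<open>Convergence in total variation\<close>

lemma tv_dist_le:
  assumes "sets \<mu> \<noteq> {}" "\<And>A. A \<in> sets \<mu> \<Longrightarrow> \<bar>measure \<mu> A - measure \<nu> A\<bar> \<le> \<epsilon>"
  shows "tv_dist \<mu> \<nu> \<le> \<epsilon>"
  unfolding tv_dist_def using assms by (intro cSUP_least)

lemma tv_dist_nonneg:
  assumes "prob_space \<mu>" "prob_space \<nu>"
  shows "0 \<le> tv_dist \<mu> \<nu>"
proof -
  interpret \<mu>: prob_space \<mu> by fact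
  interpret \<nu>: prob_space \<nu> by fact
  have "\<bar>measure \<mu> A - measure \<nu> A\<bar> \<le> 1" for A
    using \<mu>.prob_le_1[of A] \<nu>.prob_le_1[of A] measure_nonneg[of \<mu> A] measure_nonneg[of \<nu> A] by linarith
  then have "\<bar>measure \<mu> {} - measure \<nu> {}\<bar> \<le> tv_dist \<mu> \<nu>"
    unfolding tv_dist_def by (intro cSUP_upper bdd_aboveI[of _ 1]) auto
  then show ?thesis by simp
qed

lemma compact_pos_subset:
  fixes K :: "real set"
  assumes "compact K" "K \<subseteq> {0<..}"
  obtains a b where "0 < a" "a \<le> b" "K \<subseteq> {a..b}"
proof (cases "K = {}")
  case True
  then show ?thesis using that[of 1 1] by simp
next
  case False
  obtain a where a: "a \<in> K" "\<forall>x\<in>K. a \<le> x" using compact_attains_inf[OF assms(1) False] by blast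
  obtain b where b: "b \<in> K" "\<forall>x\<in>K. x \<le> b" using compact_attains_sup[OF assms(1) False] by blast
  show ?thesis using a b assms(2) by (intro that[of a b]) auto
qed

context driven_cell_model
begin

lemma sets_cell_law [simp]: "sets (cell_law R M U \<nu> t) = sets borel" and space_cell_law [simp]: "space (cell_law R M U \<nu> t) = UNIV"
  by (simp_all add: cell_law_def)

text \<open>Starting points in a compact interval obey \<open>Q_converges\<close> with error
  \<epsilon>/2, uniformly in the test set; the others carry mass at most \<epsilon>/2 and are
  estimated by 1. Tightness makes the interval, and so the time \<open>t0\<close>, common to the
  family.\<close>

theorem uniform_tv_convergence:
  assumes pos: "\<And>\<nu>. \<nu> \<in> \<M> \<Longrightarrow> pos_distribution \<nu>" and tight: "tight_on {0<..} \<M>" and \<epsilon>: "0 < \<epsilon>"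
  shows "\<forall>\<^sub>F t in at_top. \<forall>\<nu>\<in>\<M>. tv_dist (cell_law R M U \<nu> t) equil \<le> \<epsilon>"
proof -
  obtain K where K: "compact K" "K \<subseteq> {0<..}" "\<And>\<nu>. \<nu> \<in> \<M> \<Longrightarrow> measure \<nu> (space \<nu> - K) < \<epsilon> / 2"
    using tight \<epsilon> unfolding tight_on_def by (meson half_gt_zero)
  obtain a b where ab: "0 < a" "a \<le> b" "K \<subseteq> {a..b}" using compact_pos_subset[OF K(1,2)] by blast
  obtain t0 where t0: "0 \<le> t0" and conv: "\<And>f t x. f \<in> borel_measurable borel \<Longrightarrow> (\<And>x. 0 < x \<Longrightarrow> f x \<le> 1) \<Longrightarrow> t0 \<le> t \<Longrightarrow> x \<in> {a..b} \<Longrightarrow>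
      Q f t x \<le> equil_mean f + ennreal (\<epsilon> / 2)"
    using Q_converges[OF ab(1,2), of "\<epsilon> / 2"] \<epsilon> by auto
  interpret E: prob_space equil using pos_distribution_equil by (simp add: pos_distribution_def)
  have "tv_dist (cell_law R M U \<nu> t) equil \<le> \<epsilon>" if t: "t0 \<le> t" and \<nu>: "\<nu> \<in> \<M>" for t \<nu>
  proof -
    interpret \<nu>: prob_space \<nu> using pos[OF \<nu>] by (simp add: pos_distribution_def)
    have sets_\<nu> [measurable_cong]: "sets \<nu> = sets borel" using pos[OF \<nu>] by (simp add: pos_distribution_def)
    have space_\<nu>: "space \<nu> = UNIV" using sets_eq_imp_space_eq[OF sets_\<nu>] by simp
    interpret P: prob_space "cell_law R M U \<nu> t" by (rule prob_space_cell_law[OF pos[OF \<nu>]])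
    have AE_pos: "AE x in \<nu>. 0 < x"
      using pos[OF \<nu>] space_\<nu> by (subst \<nu>.AE_iff_emeasure_eq_1) (auto simp: pos_distribution_def greaterThan_def)
    have "measure \<nu> (UNIV - {a..b}) \<le> measure \<nu> (UNIV - K)"
      using ab(3) compact_imp_closed[OF K(1)] by (intro \<nu>.finite_measure_mono) (auto simp: sets_\<nu>)
    then have out: "emeasure \<nu> (UNIV - {a..b}) \<le> ennreal (\<epsilon> / 2)"
      using K(3)[OF \<nu>] by (simp add: space_\<nu> \<nu>.emeasure_eq_measure ennreal_leI)
    have le: "measure (cell_law R M U \<nu> t) A \<le> measure equil A + \<epsilon>" if A [measurable]: "A \<in> sets borel" for A
    proof -
      have "emeasure (cell_law R M U \<nu> t) A = (\<integral>\<^sup>+x. Q (indicator A) t x \<partial>\<nu>)"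
        using t t0 by (intro emeasure_cell_law pos[OF \<nu>] A) simp
      also have "\<dots> \<le> (\<integral>\<^sup>+x. (emeasure equil A + ennreal (\<epsilon> / 2)) + indicator (UNIV - {a..b}) x \<partial>\<nu>)"
      proof (rule nn_integral_mono_AE)
        show "AE x in \<nu>. Q (indicator A) t x \<le> (emeasure equil A + ennreal (\<epsilon> / 2)) + indicator (UNIV - {a..b}) x"
          using AE_pos
        proof eventually_elim
          case (elim x)
          show ?case
          proof (cases "x \<in> {a..b}")
            case True
            then show ?thesis using conv[of "indicator A" t x] t by (simp add: emeasure_equil indicator_def)
          next
            case False
            have "Q (indicator A) t x \<le> 1" using elim t t0 by (intro Q_le_one) (auto simp: indicator_def)
            then show ?thesis using False by (auto intro: order_trans)
          qed
        qed
      qed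
      also have "\<dots> = (emeasure equil A + ennreal (\<epsilon> / 2)) + emeasure \<nu> (UNIV - {a..b})"
        by (subst nn_integral_add) (auto simp: \<nu>.emeasure_space_1)
      also have "\<dots> \<le> (emeasure equil A + ennreal (\<epsilon> / 2)) + ennreal (\<epsilon> / 2)"
        using out by (rule add_left_mono)
      also have "\<dots> = ennreal (measure equil A + \<epsilon>)"
        using \<epsilon> by (simp add: E.emeasure_eq_measure ennreal_plus[symmetric] del: ennreal_plus)
      finally show ?thesis
        using \<epsilon> by (simp add: P.emeasure_eq_measure add_nonneg_nonneg less_imp_le del: ennreal_plus)
    qed
    show ?thesis
    proof (rule tv_dist_le)
      fix A assume "A \<in> sets (cell_law R M U \<nu> t)"
      then have A: "A \<in> sets borel" by simp
      \<comment> \<open>The upper bound for the complement is the lower bound for \<open>A\<close>,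
        as both measures have mass 1.\<close>
      have "measure (cell_law R M U \<nu> t) (UNIV - A) \<le> measure equil (UNIV - A) + \<epsilon>" using A by (intro le) auto
      then have "measure equil A \<le> measure (cell_law R M U \<nu> t) A + \<epsilon>"
        using P.prob_compl[of A] E.prob_compl[of A] A by simp
      then show "\<bar>measure (cell_law R M U \<nu> t) A - measure equil A\<bar> \<le> \<epsilon>" using le[OF A] by (simp add: abs_le_iff)
    qed auto
  qed
  then show ?thesis by (intro eventually_mono[OF eventually_ge_at_top[of t0]] ballI)
qed

corollary tv_convergence:
  assumes \<nu>: "pos_distribution \<nu>"
  shows "((\<lambda>t. tv_dist (cell_law R M U \<nu> t) equil) \<longlongrightarrow> 0) at_top"
proof (rule tendstoI)
  fix e :: real assume e: "0 < e"
  have "tight_on {0<..} {\<nu>}"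
    unfolding tight_on_def
  proof (intro allI impI)
    fix \<epsilon> :: real assume "0 < \<epsilon>"
    then obtain a b where "0 < a" "a \<le> b" "measure \<nu> (UNIV - {a..b}) < \<epsilon>" using pos_distribution_compact[OF \<nu>] by blast
    moreover have "space \<nu> = UNIV" using \<nu> sets_eq_imp_space_eq[of \<nu> borel] by (simp add: pos_distribution_def)
    ultimately show "\<exists>K. compact K \<and> K \<subseteq> {0<..} \<and> (\<forall>\<nu>\<in>{\<nu>}. measure \<nu> (space \<nu> - K) < \<epsilon>)"
      by (intro exI[of _ "{a..b}"]) auto
  qed
  then have "\<forall>\<^sub>F t in at_top. \<forall>\<nu>\<in>{\<nu>}. tv_dist (cell_law R M U \<nu> t) equil \<le> e / 2"
    using \<nu> e by (intro uniform_tv_convergence) auto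
  then show "\<forall>\<^sub>F t in at_top. dist (tv_dist (cell_law R M U \<nu> t) equil) 0 < e"
  proof eventually_elim
    case (elim t)
    have "0 \<le> tv_dist (cell_law R M U \<nu> t) equil"
      using prob_space_cell_law[OF \<nu>] pos_distribution_equil by (intro tv_dist_nonneg) (auto simp: pos_distribution_def)
    then show ?case using elim e by simp
  qed
qed

text \<open>In \<open>ennreal\<close> the supremum is meaningful for every family and equals 0 for
  the empty one.\<close>

corollary uniform_tv_convergence_SUP:
  assumes "\<And>\<nu>. \<nu> \<in> \<M> \<Longrightarrow> pos_distribution \<nu>" "tight_on {0<..} \<M>"
  shows "((\<lambda>t. SUP \<nu>\<in>\<M>. ennreal (tv_dist (cell_law R M U \<nu> t) equil)) \<longlongrightarrow> 0) at_top"
proof (rule order_tendstoI)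
  fix c :: ennreal assume "0 < c"
  then obtain \<epsilon> where \<epsilon>: "0 < \<epsilon>" "ennreal \<epsilon> < c"
  proof (cases c)
    case (real r)
    then show ?thesis using that[of "r / 2"] \<open>0 < c\<close> by (auto simp: ennreal_less_iff)
  next
    case top
    then show ?thesis using that[of 1] by simp
  qed
  have "\<forall>\<^sub>F t in at_top. \<forall>\<nu>\<in>\<M>. tv_dist (cell_law R M U \<nu> t) equil \<le> \<epsilon>"
    using assms \<epsilon>(1) by (rule uniform_tv_convergence)
  then show "\<forall>\<^sub>F t in at_top. (SUP \<nu>\<in>\<M>. ennreal (tv_dist (cell_law R M U \<nu> t) equil)) < c"
  proof eventually_elim
    case (elim t)
    then have "(SUP \<nu>\<in>\<M>. ennreal (tv_dist (cell_law R M U \<nu> t) equil)) \<le> ennreal \<epsilon>"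
      by (intro SUP_least ennreal_leI) auto
    then show ?case using \<epsilon>(2) by simp
  qed
qed simp

end

theorem proposition3p13:
  fixes R :: "real \<Rightarrow> real" and F :: "ennreal \<Rightarrow> real"
    and M :: "'a measure" and U :: "nat \<Rightarrow> 'a \<Rightarrow> real"
  assumes R_borel: "R \<in> borel_measurable (restrict_space borel {0..})"
    and R_nonneg: "\<And>x. 0 \<le> x \<Longrightarrow> 0 \<le> R x"
    and R_locally_integrable: "\<And>k. 0 < k \<Longrightarrow> (\<integral>\<^sup>+x\<in>{0..k}. ennreal (R x) \<partial>lborel) < \<infinity>"
    and stationarity: "(\<lambda>t. F) \<in> evolution_family R"
    and M_prob: "prob_space M"
    and U_indep: "prob_space.indep_vars M (\<lambda>k. borel) U {1..}"
    and U_uniform: "\<And>k. 1 \<le> k \<Longrightarrow> distr M borel (U k) = uniform_measure lborel {0<..<1}"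
    and U_range: "\<And>k \<omega>. 1 \<le> k \<Longrightarrow> \<omega> \<in> space M \<Longrightarrow> U k \<omega> \<in> {0<..<1}"
    and J_prod: "\<And>\<omega>. \<omega> \<in> space M \<Longrightarrow>
      (\<lambda>n. \<Prod>j=1..n. jump_factor (\<lambda>k. U k \<omega>) j) \<longlonglongrightarrow> 0"
  shows "(\<forall>\<nu>. pos_distribution \<nu> \<longrightarrow>
      ((\<lambda>t. tv_dist (cell_law R M U \<nu> t) (stieltjes F)) \<longlongrightarrow> 0) at_top) \<and>
    (\<forall>\<M>. (\<forall>\<nu>\<in>\<M>. pos_distribution \<nu>) \<and> tight_on {0<..} \<M> \<longrightarrow>
      ((\<lambda>t. SUP \<nu>\<in>\<M>. ennreal (tv_dist (cell_law R M U \<nu> t) (stieltjes F))) \<longlongrightarrow> 0) at_top)"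
proof -
  interpret stationary_jump_rate R F
    using R_borel R_nonneg R_locally_integrable stationarity by unfold_locales
  interpret M: prob_space M by (rule M_prob)
  interpret driven_cell_model "\<lambda>x. exp (- Lam x)" C R M U
    using U_indep U_uniform by unfold_locales
  show ?thesis
    using tv_convergence uniform_tv_convergence_SUP unfolding equil_eq by blast
qed

end
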